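(* Let $n\geq 2$. The Johnson morphism is an isomorphism of graded Lie rings \[\mathrm{Lie}\left(\mathcal A_*(RF_n)\right)\cong\mathrm{Der}(R\mathfrak L_n).\]
   Context: Notation: $[x,y]=xyx^{-1}y^{-1}$, $\Gamma_*$ is the lower central series. $RF_n=\langle x_1,\dots,x_n\mid [x_i,w^{-1}x_iw]=1\ (w\in F_n)\rangle$ is the reduced free group. $R\mathfrak L_n$ is the Lie ring generated by $y_1,\dots,y_n$ subject to $[y_{i_1},[y_{i_2},[\cdots[y_{i_{s-1}},y_{i_s}]\cdots]]]=0$ whenever two of the indices coincide; it is graded by length and identified with $\mathrm{Lie}(RF_n)=\bigoplus_k\Gamma_k/\Gamma_{k+1}$ via $\bar x_i\mapsto y_i$. $\mathrm{Der}(R\mathfrak L_n)=\bigoplus_{k\geq1}\mathrm{Der}_k(R\mathfrak L_n)$ denotes the Lie ring of derivations strictly raising the degree ($\mathrm{Der}_k$ = those raising degree by $k$). The Andreadakis filtration is $\mathcal A_j(RF_n)=\{\sigma\in\mathrm{Aut}(RF_n):\sigma(g)g^{-1}\in\Gamma_{i+j}(RF_n)\ \forall i\geq1,\forall g\in\Gamma_i(RF_n)\}$, and $\mathrm{Lie}(\mathcal A_*(RF_n))=\bigoplus_j\mathcal A_j/\mathcal A_{j+1}$ with bracket induced by commutators. The Johnson morphism sends the class of $\sigma\in\mathcal A_j$ to the degree-$j$ derivation of $R\mathfrak L_n$ induced by $x\mapsto\sigma(x)x^{-1}$. *)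

theory Defs
  imports "HOL-Algebra.Algebra"
begin

type_synonym letter = "nat \<times> bool"  (* (i, True) = x_i, (i, False) = x_i^{-1} *)

fun red_cons :: "letter \<Rightarrow> letter list \<Rightarrow> letter list" where
  "red_cons a [] = [a]"
| "red_cons a (b # bs) = (if fst a = fst b \<and> snd a \<noteq> snd b then bs else a # b # bs)"

fun reduce :: "letter list \<Rightarrow> letter list" where
  "reduce [] = []"
| "reduce (a # as) = red_cons a (reduce as)"

definition free_grp :: "nat \<Rightarrow> letter list monoid" where
  "free_grp n = \<lparr>carrier = {w. reduce w = w \<and> (\<forall>x\<in>set w. fst x < n)},
                 monoid.mult = (\<lambda>u v. reduce (u @ v)), one = []\<rparr>"

definition gen :: "nat \<Rightarrow> letter list" where
  "gen i = [(i, True)]"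

definition comm :: "('a, 'b) monoid_scheme \<Rightarrow> 'a \<Rightarrow> 'a \<Rightarrow> 'a" where
  "comm G x y = x \<otimes>\<^bsub>G\<^esub> y \<otimes>\<^bsub>G\<^esub> inv\<^bsub>G\<^esub> x \<otimes>\<^bsub>G\<^esub> inv\<^bsub>G\<^esub> y"

definition normal_closure :: "('a, 'b) monoid_scheme \<Rightarrow> 'a set \<Rightarrow> 'a set" where
  "normal_closure G S = generate G (\<Union>g\<in>carrier G. (\<lambda>s. g \<otimes>\<^bsub>G\<^esub> s \<otimes>\<^bsub>G\<^esub> inv\<^bsub>G\<^esub> g) ` S)"

definition rf_rel :: "nat \<Rightarrow> letter list set" where
  "rf_rel n = {comm (free_grp n) (gen i)
                 (inv\<^bsub>free_grp n\<^esub> w \<otimes>\<^bsub>free_grp n\<^esub> gen i \<otimes>\<^bsub>free_grp n\<^esub> w)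
               | i w. i < n \<and> w \<in> carrier (free_grp n)}"

definition RF :: "nat \<Rightarrow> letter list set monoid" where
  "RF n = free_grp n Mod normal_closure (free_grp n) (rf_rel n)"

text \<open>Lower central series, indexed from 1: Gamma_1 = G, Gamma_{k+1} = [G, Gamma_k].\<close>

fun lcs :: "('a, 'b) monoid_scheme \<Rightarrow> nat \<Rightarrow> 'a set" where
  "lcs G 0 = carrier G"
| "lcs G (Suc 0) = carrier G"
| "lcs G (Suc (Suc k)) =
     generate G {comm G x y | x y. x \<in> carrier G \<and> y \<in> lcs G (Suc k)}"

definition grQ :: "('a, 'b) monoid_scheme \<Rightarrow> nat \<Rightarrow> 'a set monoid" where
  "grQ G i = (G\<lparr>carrier := lcs G i\<rparr>) Mod lcs G (Suc i)"

definition lie_br :: "('a, 'b) monoid_scheme \<Rightarrow> nat \<Rightarrow> nat \<Rightarrow> 'a set \<Rightarrow> 'a set \<Rightarrow> 'a set" where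
  "lie_br G i l a b =
     r_coset G (lcs G (Suc (i + l))) (comm G (SOME x. x \<in> a) (SOME y. y \<in> b))"

definition der :: "('a, 'b) monoid_scheme \<Rightarrow> nat \<Rightarrow> (nat \<Rightarrow> 'a set \<Rightarrow> 'a set) set" where
  "der G k = {D. D 0 = (\<lambda>_. undefined) \<and>
      (\<forall>i\<ge>1. D i \<in> hom (grQ G i) (grQ G (i + k)) \<and> D i \<in> extensional (carrier (grQ G i))) \<and>
      (\<forall>i\<ge>1. \<forall>l\<ge>1. \<forall>a\<in>carrier (grQ G i). \<forall>b\<in>carrier (grQ G l).
          D (i + l) (lie_br G i l a b) =
            lie_br G (i + k) l (D i a) b \<otimes>\<^bsub>grQ G (i + l + k)\<^esub> lie_br G i (l + k) a (D l b))}"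

definition der_grp :: "('a, 'b) monoid_scheme \<Rightarrow> nat \<Rightarrow> (nat \<Rightarrow> 'a set \<Rightarrow> 'a set) monoid" where
  "der_grp G k = \<lparr>carrier = der G k,
     monoid.mult = (\<lambda>D E i. if i = 0 then (\<lambda>_. undefined)
               else (\<lambda>a\<in>carrier (grQ G i). D i a \<otimes>\<^bsub>grQ G (i + k)\<^esub> E i a)),
     one = (\<lambda>i. if i = 0 then (\<lambda>_. undefined)
               else (\<lambda>a\<in>carrier (grQ G i). \<one>\<^bsub>grQ G (i + k)\<^esub>))\<rparr>"

definition der_br :: "('a, 'b) monoid_scheme \<Rightarrow> nat \<Rightarrow> nat \<Rightarrow>
    (nat \<Rightarrow> 'a set \<Rightarrow> 'a set) \<Rightarrow> (nat \<Rightarrow> 'a set \<Rightarrow> 'a set) \<Rightarrow> (nat \<Rightarrow> 'a set \<Rightarrow> 'a set)" where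
  "der_br G j k D E i = (if i = 0 then (\<lambda>_. undefined)
      else (\<lambda>a\<in>carrier (grQ G i).
              D (i + k) (E i a) \<otimes>\<^bsub>grQ G (i + j + k)\<^esub> inv\<^bsub>grQ G (i + j + k)\<^esub> (E (i + j) (D i a))))"

definition andr :: "('a, 'b) monoid_scheme \<Rightarrow> nat \<Rightarrow> ('a \<Rightarrow> 'a) set" where
  "andr G j = {\<sigma> \<in> auto G. \<forall>i\<ge>1. \<forall>g\<in>lcs G i. \<sigma> g \<otimes>\<^bsub>G\<^esub> inv\<^bsub>G\<^esub> g \<in> lcs G (i + j)}"

definition AQ :: "('a, 'b) monoid_scheme \<Rightarrow> nat \<Rightarrow> ('a \<Rightarrow> 'a) set monoid" where
  "AQ G j = ((AutoGroup G)\<lparr>carrier := andr G j\<rparr>) Mod andr G (Suc j)"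

definition aut_br :: "('a, 'b) monoid_scheme \<Rightarrow> nat \<Rightarrow> nat \<Rightarrow> ('a \<Rightarrow> 'a) set \<Rightarrow> ('a \<Rightarrow> 'a) set \<Rightarrow> ('a \<Rightarrow> 'a) set" where
  "aut_br G j k c d =
     r_coset (AutoGroup G) (andr G (Suc (j + k)))
       (comm (AutoGroup G) (SOME s. s \<in> c) (SOME r. r \<in> d))"

definition johnson :: "('a, 'b) monoid_scheme \<Rightarrow> nat \<Rightarrow> ('a \<Rightarrow> 'a) set \<Rightarrow> (nat \<Rightarrow> 'a set \<Rightarrow> 'a set)" where
  "johnson G j c i = (if i = 0 then (\<lambda>_. undefined)
      else (\<lambda>a\<in>carrier (grQ G i).
        r_coset G (lcs G (Suc (i + j)))
          ((SOME s. s \<in> c) (SOME x. x \<in> a) \<otimes>\<^bsub>G\<^esub> inv\<^bsub>G\<^esub> (SOME x. x \<in> a))))"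

end

theory Submission
  imports Defs
begin

text \<open>
  For every group the Johnson morphism is well defined, injective and compatible with brackets; only
  surjectivity is special to \<open>G = RF n\<close>. Let a derivation of degree \<open>j\<close> be given and lift the images
  of the classes of the generators to \<open>g\<^sub>i \<in> \<Gamma>\<^sub>m\<close>, where \<open>m = j + 1\<close>. An endomorphism
  \<open>x\<^sub>i \<mapsto> g\<^sub>i x\<^sub>i\<close> is an automorphism because \<open>G\<close> is nilpotent of class at most \<open>n\<close>; it exists as soon
  as each \<open>g\<^sub>i x\<^sub>i\<close> commutes with its conjugates. This is automatic if \<open>m \<ge> n - 1\<close>. Otherwise the lift
  \<open>g\<^sub>i\<close> can be chosen in the normal closure of \<open>x\<^sub>i\<close>, which is abelian: map \<open>G\<close> into the units of the
  ring of non-commutative polynomials modulo monomials with a repeated letter by \<open>x\<^sub>i \<mapsto> 1 + X\<^sub>i\<close>.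
  Applying the derivation to \<open>[x\<^sub>i, [x\<^sub>k, x\<^sub>i]] = 1\<close> shows that the leading term of \<open>g\<^sub>i\<close> has no
  monomial that avoids \<open>i\<close>. The leading term of an element of \<open>\<Gamma>\<^sub>m\<close> determines its class modulo
  \<open>\<Gamma>\<^sub>m\<^sub>+\<^sub>1\<close>: this quotient is spanned by the commutators
  \<open>[x\<^sub>a\<^sub>1, [x\<^sub>a\<^sub>2, \<dots>, x\<^sub>s]]\<close> with distinct letters and \<open>s\<close> maximal, and the monomials ending
  in their maximal letter separate these. Hence the image of \<open>g\<^sub>i\<close> under the retraction killing
  \<open>x\<^sub>i\<close> lies in \<open>\<Gamma>\<^sub>m\<^sub>+\<^sub>1\<close> and can be divided out.
\<close>

section \<open>Commutators and the lower central series\<close>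

text \<open>The obstacle to surjectivity is that a derivation fixes the images of the generators
  only modulo \<Gamma>_{m+1}, while an endomorphism of \<open>RF n\<close> needs the relations to
  hold exactly. An element of \<open>Ncl i\<close> commutes with its conjugates outright, which is
  why the lift is pushed into that subgroup. The bound n - 1 comes from the test monomial X_k M X_i:
  it needs m + 2 distinct letters, so a spare letter k exists exactly when m + 2 \<le> n; beyond
  that \<Gamma>_{m+2} is already trivial. The Magnus ring is brought in because leading terms can be
  compared there coefficient by coefficient, without knowing in advance that the graded quotients
  are free abelian. The Lie ring of the statement appears as the graded quotients of
  \<open>RF n\<close>, and calculations take place on representatives, with the displacement
  \<open>s x \<otimes> inv x\<close> standing for the value of a derivation.\<close>

declare mult_FactGroup [simp del] one_FactGroup [simp del]

context group
begin

lemma comm_closed [intro, simp]: "x \<in> carrier G \<Longrightarrow> y \<in>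
    carrier G \<Longrightarrow> comm G x y \<in> carrier G"
  by (simp add: comm_def)

lemma cancel_inv [simp]:
  "x \<in> carrier G \<Longrightarrow> y \<in> carrier G \<Longrightarrow> x \<otimes> (inv x \<otimes> y) = y"
  "x \<in> carrier G \<Longrightarrow> y \<in> carrier G \<Longrightarrow> inv x \<otimes> (x \<otimes> y) = y"
  by (simp_all add: m_assoc [symmetric])

lemma comm_mult: "x \<in> carrier G \<Longrightarrow> y \<in> carrier G \<Longrightarrow> x \<otimes> y =
    comm G x y \<otimes> (y \<otimes> x)"
  by (simp add: comm_def m_assoc)

lemma comm_eqI:
  assumes "x \<in> carrier G" "y \<in> carrier G" "c \<in> carrier G" "x \<otimes> y = c \<otimes> (y \<otimes> x)"
  shows "comm G x y = c"
  using assms by (simp add: comm_def m_assoc)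

lemma comm_eq_one_iff:
  "x \<in> carrier G \<Longrightarrow> y \<in> carrier G \<Longrightarrow> comm G x y = \<one> \<longleftrightarrow>
      x \<otimes> y = y \<otimes> x"
  by (metis comm_eqI comm_mult l_one m_closed one_closed)

lemma inv_comm: "x \<in> carrier G \<Longrightarrow> y \<in> carrier G \<Longrightarrow> inv (comm G x y) = comm G y x"
  by (simp add: comm_def inv_mult_group m_assoc)

lemma comm_one [simp]: "x \<in> carrier G \<Longrightarrow> comm G x \<one> =
    \<one>" "x \<in> carrier G \<Longrightarrow> comm G \<one> x = \<one>"
  by (simp_all add: comm_def)

lemma conj_eq_comm:
  "x \<in> carrier G \<Longrightarrow> y \<in> carrier G \<Longrightarrow> x \<otimes> y \<otimes> inv x =
      comm G x y \<otimes> y"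
  by (simp add: comm_def m_assoc)

lemma hom_comm:
  assumes "group H" "h \<in> hom G H" "x \<in> carrier G" "y \<in> carrier G"
  shows "h (comm G x y) = comm H (h x) (h y)"
proof -
  interpret H: group H by fact
  interpret group_hom G H h by unfold_locales fact
  show ?thesis using assms by (simp add: comm_def)
qed

lemma rcos_eq_iff:
  assumes "N \<lhd> G" "x \<in> carrier G" "y \<in> carrier G"
  shows "N #> x = N #> y \<longleftrightarrow> x \<otimes> inv y \<in> N"
proof -
  interpret N: normal N G by fact
  show ?thesis
    by (metis N.rcos_module N.subgroup_axioms assms(2,3) is_group rcos_self repr_independence)
qed

lemma rcos_eq_self_iff:
  assumes "N \<lhd> G" "x \<in> carrier G"
  shows "N #> x = N \<longleftrightarrow> x \<in> N"
  using rcos_eq_iff[OF assms(1,2) one_closed] assms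
  by (simp add: coset_mult_one normal_imp_subgroup subgroup.subset)

lemma comm_mem_iff:
  assumes "N \<lhd> G" "x \<in> carrier G" "y \<in> carrier G"
  shows "comm G x y \<in> N \<longleftrightarrow>
    (N #> x) \<otimes>\<^bsub>G Mod N\<^esub> (N #> y) = (N #> y) \<otimes>\<^bsub>G Mod N\<^esub> (N #> x)"
proof -
  interpret N: normal N G by fact
  interpret Q: group "G Mod N" by (rule N.factorgroup_is_group)
  have q: "(\<lambda>x. N #> x) \<in> hom G (G Mod N)" by (rule N.r_coset_hom_Mod)
  have c: "N #> z \<in> carrier (G Mod N)" if "z \<in> carrier G" for z
    using q that by (auto simp: hom_def)
  have "comm G x y \<in> N \<longleftrightarrow> N #> comm G x y = \<one>\<^bsub>G Mod N\<^esub>"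
    using assms rcos_eq_self_iff by (simp add: one_FactGroup)
  also have "\<dots> \<longleftrightarrow> comm (G Mod N) (N #> x) (N #> y) = \<one>\<^bsub>G Mod N\<^esub>"
    using hom_comm[OF Q.is_group q] assms by simp
  finally show ?thesis using Q.comm_eq_one_iff c assms by simp
qed

text \<open>Modulo N, the elements commuting with a fixed b form a subgroup, so the condition passes
  from A to \<open>generate G A\<close>; the condition is symmetric, so the same argument then
  applies to B.\<close>

lemma comm_generate_subset:
  assumes "N \<lhd> G" "A \<subseteq> carrier G" "B \<subseteq> carrier G"
    and "\<And>a b. a \<in> A \<Longrightarrow> b \<in> B \<Longrightarrow> comm G a b \<in> N"
    and "x \<in> generate G A" "y \<in> generate G B"
  shows "comm G x y \<in> N"
proof -
  interpret N: normal N G by fact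
  interpret Q: group "G Mod N" by (rule N.factorgroup_is_group)
  interpret q: group_hom G "G Mod N" "\<lambda>x. N #> x"
    by unfold_locales (rule N.r_coset_hom_Mod)
  have *: "comm G x b \<in> N" if "b \<in> carrier G" "\<And>a. a \<in> A \<Longrightarrow> comm G a b \<in>
      N" "x \<in> generate G A"
      "A \<subseteq> carrier G" for A x b
    using that(3)
  proof (induction rule: generate.induct)
    case one then show ?case using that by simp
  next
    case (incl h) then show ?case using that by simp
  next
    case (inv h)
    then have h: "h \<in> carrier G" and c: "comm G h b \<in> N" using that by auto
    let ?h = "N #> h" and ?b = "N #> b"
    have "?h \<otimes>\<^bsub>G Mod N\<^esub> ?b = ?b \<otimes>\<^bsub>G Mod N\<^esub> ?h"
      using c comm_mem_iff[OF assms(1) h that(1)] by simp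
    then have "inv\<^bsub>G Mod N\<^esub> ?h \<otimes>\<^bsub>G Mod N\<^esub> ?b =
        ?b \<otimes>\<^bsub>G Mod N\<^esub> inv\<^bsub>G Mod N\<^esub> ?h"
      using Q.inv_comm h that(1)
      by (metis Q.inv_closed Q.inv_solve_left' Q.inv_solve_right Q.m_assoc Q.m_closed q.hom_closed)
    then show ?case using comm_mem_iff[OF assms(1), of "inv h" b] h that(1) by simp
  next
    case (eng h1 h2)
    then have h: "h1 \<in> carrier G" "h2 \<in> carrier G"
      using that generate_in_carrier by auto
    let ?h = "N #> h1" and ?k = "N #> h2" and ?b = "N #> b"
    have e: "?h \<otimes>\<^bsub>G Mod N\<^esub> ?b =
        ?b \<otimes>\<^bsub>G Mod N\<^esub> ?h" "?k \<otimes>\<^bsub>G Mod N\<^esub> ?b = ?b \<otimes>\<^bsub>G Mod N\<^esub> ?k"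
      using eng comm_mem_iff[OF assms(1)] h that(1) by simp_all
    have "?h \<otimes>\<^bsub>G Mod N\<^esub> ?k \<otimes>\<^bsub>G Mod N\<^esub> ?b =
        ?b \<otimes>\<^bsub>G Mod N\<^esub> (?h \<otimes>\<^bsub>G Mod N\<^esub> ?k)"
      using e h that(1) by (metis Q.m_assoc q.hom_closed)
    then show ?case using comm_mem_iff[OF assms(1), of "h1 \<otimes> h2" b] h that(1)
      by (metis m_closed q.hom_mult)
  qed
  have sym: "comm G u v \<in> N \<longleftrightarrow>
      comm G v u \<in> N" if "u \<in> carrier G" "v \<in> carrier G" for u v
    using comm_mem_iff[OF assms(1)] that by metis
  have xc: "x \<in> carrier G" "y \<in> carrier G"
    using assms generate_in_carrier by auto
  have "comm G x b \<in> N" if "b \<in> B" for b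
    using * assms that by blast
  then have "comm G b x \<in> N" if "b \<in> B" for b
    using sym xc assms that by blast
  then have "comm G y x \<in> N" using *[OF xc(1) _ assms(6,3)] by blast
  then show ?thesis using sym xc by blast
qed

lemma comm_normal:
  assumes "N \<lhd> G" "x \<in> carrier G" "y \<in> N"
  shows "comm G x y \<in> N" "comm G y x \<in> N"
proof -
  interpret N: normal N G by fact
  have y: "y \<in> carrier G" using assms by auto
  have "x \<otimes> y \<otimes> inv x \<in> N" using assms by (simp add: N.inv_op_closed2)
  then show 1: "comm G x y \<in> N"
    unfolding comm_def using assms by simp
  then show "comm G y x \<in> N"
    using inv_comm[OF assms(2) y] by (metis N.m_inv_closed)
qed

text \<open>Conjugation by z turns [x, y] into [c x, d y] with c = [z, x] and d = [z, y]; this is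
  the step showing that the result is [x, y] again. The factor d is central and cancels, and c
  commutes with x y x^-1.\<close>

lemma comm_shift:
  assumes c: "c \<in> carrier G" "x \<in> carrier G" "d \<in> carrier G" "y \<in> carrier G"
    and yc: "y \<otimes> c = c \<otimes> y" and xyc: "x \<otimes> y \<otimes> inv x \<otimes> c =
        c \<otimes> (x \<otimes> y \<otimes> inv x)"
    and d: "\<And>u. u \<in> carrier G \<Longrightarrow> d \<otimes> u = u \<otimes> d"
  shows "comm G (c \<otimes> x) (d \<otimes> y) = comm G x y"
proof -
  define k where "k = x \<otimes> y \<otimes> inv x"
  have k: "k \<in> carrier G" "x \<otimes> y = k \<otimes> x" "comm G x y = k \<otimes> inv y"
    using c by (simp_all add: k_def m_assoc comm_def)
  have kc: "c \<otimes> k = k \<otimes> c" using xyc by (simp add: k_def)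
  have dx: "c \<otimes> x \<otimes> d = d \<otimes> (c \<otimes> x)" using d[of "c \<otimes> x"] c by simp
  have dk: "d \<otimes> (k \<otimes> inv y) = k \<otimes> inv y \<otimes> d"
    using d[of "k \<otimes> inv y"] c k(1) by simp
  have "c \<otimes> x \<otimes> (d \<otimes> y) = c \<otimes> x \<otimes> d \<otimes> y"
    using c by (simp add: m_assoc)
  also have "\<dots> = d \<otimes> (c \<otimes> (x \<otimes> y))" unfolding dx using c by (simp add: m_assoc)
  also have "\<dots> = d \<otimes> (c \<otimes> k \<otimes> x)" using c k by (simp add: m_assoc)
  also have "\<dots> = d \<otimes> (k \<otimes> inv y) \<otimes> (y \<otimes> c \<otimes> x)"
    unfolding kc using c k(1) by (simp add: m_assoc)
  also have "\<dots> = k \<otimes> inv y \<otimes> (d \<otimes> y \<otimes> (c \<otimes> x))"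
    unfolding dk using c k(1) by (simp add: m_assoc)
  finally show ?thesis
    by (intro comm_eqI) (use c k in auto)
qed

section \<open>Normal closures\<close>

lemma normal_closure_normal:
  assumes "S \<subseteq> carrier G"
  shows "normal_closure G S \<lhd> G"
  unfolding normal_closure_def
proof (rule normal_generateI)
  show "(\<Union>g\<in>carrier G. (\<lambda>s. g \<otimes> s \<otimes> inv g) ` S) \<subseteq> carrier G"
    using assms by auto
  fix h g assume "h \<in> (\<Union>g\<in>carrier G. (\<lambda>s. g \<otimes> s \<otimes>
      inv g) ` S)" and g: "g \<in> carrier G"
  then obtain k s where k: "k \<in> carrier G" "s \<in> S" "h = k \<otimes> s \<otimes> inv k" by auto
  then have "s \<in> carrier G" using assms by auto
  then have "g \<otimes> h \<otimes> inv g = (g \<otimes> k) \<otimes> s \<otimes> inv (g \<otimes> k)"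
    using k g by (simp add: m_assoc inv_mult_group)
  then show "g \<otimes> h \<otimes> inv g \<in> (\<Union>g\<in>carrier G. (\<lambda>s. g \<otimes> s \<otimes>
      inv g) ` S)"
    using g k by (intro UN_I[of "g \<otimes> k"]) auto
qed

lemma normal_closure_incl: "S \<subseteq> carrier G \<Longrightarrow> S \<subseteq> normal_closure G S"
  unfolding normal_closure_def by (rule subsetI, rule generate.incl, rule UN_I[of \<one>]) force+

lemma normal_closure_subset:
  assumes "N \<lhd> G" "S \<subseteq> N"
  shows "normal_closure G S \<subseteq> N"
  unfolding normal_closure_def
proof (rule generate_subgroup_incl[OF _ normal_imp_subgroup[OF assms(1)]])
  show "(\<Union>g\<in>carrier G. (\<lambda>s. g \<otimes> s \<otimes> inv g) ` S) \<subseteq> N"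
    using normal.inv_op_closed2[OF assms(1)] assms(2) by auto
qed

section \<open>Weights in the lower central series\<close>

lemma lcs_Suc:
  "1 \<le> k \<Longrightarrow> lcs G (Suc k) = generate G {comm G x y | x y. x \<in> carrier G \<and> y \<in> lcs G k}"
  by (cases k) auto

declare lcs.simps(3) [simp del]

lemma normal_carrier: "carrier G \<lhd> G"
  by (simp add: normal_inv_iff subgroup_self)

lemma lcs_normal: "lcs G k \<lhd> G"
proof (induction k)
  case 0
  then show ?case by (simp add: normal_carrier)
next
  case (Suc k)
  show ?case
  proof (cases "k = 0")
    case True
    then show ?thesis by (simp add: normal_carrier)
  next
    case False
    interpret N: normal "lcs G k" G by (rule Suc.IH)
    let ?S = "{comm G x y | x y. x \<in> carrier G \<and> y \<in> lcs G k}"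
    have "generate G ?S \<lhd> G"
    proof (rule normal_generateI)
      show "?S \<subseteq> carrier G" by auto
      fix h g assume "h \<in> ?S" and g: "g \<in> carrier G"
      then obtain x y where h: "h = comm G x y" "x \<in> carrier G" "y \<in> lcs G k" by auto
      then have y: "y \<in> carrier G" by auto
      have "g \<otimes> h \<otimes> inv g = comm G (g \<otimes> x \<otimes> inv g) (g \<otimes> y \<otimes> inv g)"
        using h y g by (simp add: comm_def m_assoc inv_mult_group)
      moreover have "g \<otimes> y \<otimes> inv g \<in> lcs G k" using g h by (simp add: N.inv_op_closed2)
      ultimately show "g \<otimes> h \<otimes> inv g \<in> ?S" using g h by blast
    qed
    then show ?thesis using lcs_Suc[of k] False by simp
  qed
qed

lemma lcs_subgroup: "subgroup (lcs G k) G"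
  by (simp add: lcs_normal normal_imp_subgroup)

lemma lcs_carrier [dest]: "x \<in> lcs G k \<Longrightarrow> x \<in> carrier G"
  using lcs_subgroup subgroup.subset by blast

lemma lcs_closed [intro, simp]:
  "\<one> \<in> lcs G k"
  "x \<in> lcs G k \<Longrightarrow> y \<in> lcs G k \<Longrightarrow> x \<otimes> y \<in> lcs G k"
  "x \<in> lcs G k \<Longrightarrow> inv x \<in> lcs G k"
  using lcs_subgroup subgroup.one_closed subgroup.m_closed subgroup.m_inv_closed by metis+

lemma lcs_one [simp]: "lcs G 1 = carrier G"
  by simp

lemma comm_lcs_Suc:
  "1 \<le> k \<Longrightarrow> x \<in> carrier G \<Longrightarrow> y \<in>
      lcs G k \<Longrightarrow> comm G x y \<in> lcs G (Suc k)"
  by (subst lcs_Suc) (auto intro!: generate.incl)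

lemma lcs_Suc_subset: "lcs G (Suc k) \<subseteq> lcs G k"
proof (cases "k = 0")
  case False
  then show ?thesis
    using generate_subgroup_incl[OF _ lcs_subgroup, of "{comm G x y |x y. x \<in> carrier G \<and> y \<in> lcs G k}" k]
      comm_normal(1)[OF lcs_normal, of _ _ k] lcs_Suc[of k] by auto
qed simp

lemma lcs_antimono: "i \<le> j \<Longrightarrow> lcs G j \<subseteq> lcs G i"
  using lcs_Suc_subset by (metis lift_Suc_antimono_le)

lemma lcs_le: "x \<in> lcs G j \<Longrightarrow> i \<le> j \<Longrightarrow> x \<in> lcs G i"
  using lcs_antimono by blast

text \<open>Induction on i in place of the three subgroup lemma. For a generator [x, y] of
  \<Gamma>_{i+1}, conjugation by z replaces x by c x and y by d y with c in \<Gamma>_{j+1} and d in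
  \<Gamma>_{i+j}. Modulo \<Gamma>_{i+1+j} the element d is central and c commutes with \<Gamma>_i,
  the latter by the induction hypothesis at j + 1; this is why j stays arbitrary. So z commutes with
  [x, y].\<close>

lemma comm_lcs:
  assumes "1 \<le> i" "1 \<le> j" "x \<in> lcs G i" "y \<in> lcs G j"
  shows "comm G x y \<in> lcs G (i + j)"
  using assms
proof (induction i arbitrary: j x y rule: nat_induct_at_least)
  case base
  then show ?case using comm_lcs_Suc[of j x y] by simp
next
  case (Suc i)
  define N where "N = lcs G (Suc i + j)"
  have N: "N \<lhd> G" unfolding N_def by (rule lcs_normal)
  interpret N: normal N G by (rule N)
  interpret Q: group "G Mod N" by (rule N.factorgroup_is_group)
  interpret q: group_hom G "G Mod N" "\<lambda>x. N #> x"
    by unfold_locales (rule N.r_coset_hom_Mod)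
  let ?q = "\<lambda>x. N #> x"
  have gen: "comm G (comm G x y) z \<in> N"
    if x: "x \<in> carrier G" and y: "y \<in> lcs G i" and z: "z \<in> lcs G j" for x y z
  proof -
    have yc: "y \<in> carrier G" and zc: "z \<in> carrier G" using y z by auto
    define c where "c = comm G z x"
    have c: "c \<in> lcs G (Suc j)"
      unfolding c_def using comm_lcs_Suc[OF Suc.prems(1) x z] inv_comm[OF x zc, symmetric] by simp
    have cc: "c \<in> carrier G" using c by auto
    have k: "x \<otimes> y \<otimes> inv x \<in> lcs G i"
      using lcs_normal x y by (simp add: normal.inv_op_closed2)
    have cent: "?q u \<otimes>\<^bsub>G Mod N\<^esub> ?q v =
        ?q v \<otimes>\<^bsub>G Mod N\<^esub> ?q u" if "comm G u v \<in> N" "u \<in> carrier G" "v \<in> carrier G" for u v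
      by (rule iffD1[OF comm_mem_iff[OF N that(2,3)] that(1)])
    have yc': "comm G y c \<in> N" "comm G (x \<otimes> y \<otimes> inv x) c \<in> N"
      using Suc.IH[OF _ y c] Suc.IH[OF _ k c] by (auto simp: N_def)
    define d where "d = comm G z y"
    have d: "d \<in> lcs G (i + j)"
      unfolding d_def using Suc.IH[OF Suc.prems(1) y z] inv_comm[OF yc zc, symmetric] by simp
    have dc: "d \<in> carrier G" using d by auto
    have dcen: "comm G u d \<in> N" if "u \<in> carrier G" for u
      using comm_lcs_Suc[OF _ that d] Suc.hyps by (simp add: N_def)
    have zx: "z \<otimes> x \<otimes> inv z = c \<otimes> x" "z \<otimes> y \<otimes> inv z = d \<otimes> y"
      using x yc zc unfolding c_def d_def by (simp_all add: conj_eq_comm)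
    have "z \<otimes> comm G x y \<otimes> inv z =
        comm G (z \<otimes> x \<otimes> inv z) (z \<otimes> y \<otimes> inv z)"
      using x yc zc by (simp add: comm_def m_assoc inv_mult_group)
    also have "\<dots> = comm G (c \<otimes> x) (d \<otimes> y)" by (simp add: zx)
    finally have e: "z \<otimes> comm G x y \<otimes> inv z = comm G (c \<otimes> x) (d \<otimes> y)" .
    have "comm (G Mod N) (?q c \<otimes>\<^bsub>G Mod N\<^esub> ?q x) (?q d \<otimes>\<^bsub>G Mod N\<^esub> ?q y) =
        comm (G Mod N) (?q x) (?q y)"
    proof (rule Q.comm_shift)
      show "?q y \<otimes>\<^bsub>G Mod N\<^esub> ?q c = ?q c \<otimes>\<^bsub>G Mod N\<^esub> ?q y"
        by (rule cent[OF yc'(1) yc cc])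
      show "?q x \<otimes>\<^bsub>G Mod N\<^esub> ?q y \<otimes>\<^bsub>G Mod N\<^esub> inv\<^bsub>G Mod N\<^esub> ?q x \<otimes>\<^bsub>G Mod N\<^esub> ?q c =
        ?q c \<otimes>\<^bsub>G Mod N\<^esub> (?q x \<otimes>\<^bsub>G Mod N\<^esub> ?q y \<otimes>\<^bsub>G Mod N\<^esub> inv\<^bsub>G Mod N\<^esub> ?q x)"
        using cent[OF yc'(2)] x yc cc by simp
      show "?q d \<otimes>\<^bsub>G Mod N\<^esub> u =
          u \<otimes>\<^bsub>G Mod N\<^esub> ?q d" if u: "u \<in> carrier (G Mod N)" for u
      proof -
        obtain v where v: "v \<in> carrier G" "u = N #> v" using u by (auto simp: carrier_FactGroup)
        show ?thesis unfolding v(2) by (rule cent[OF dcen[OF v(1)] v(1) dc, symmetric])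
      qed
    qed (simp_all only: q.hom_closed x yc cc dc)
    then have "?q (comm G (c \<otimes> x) (d \<otimes> y)) = ?q (comm G x y)"
      using x yc cc dc by (simp add: hom_comm[OF Q.is_group q.homh])
    then have "?q (z \<otimes> comm G x y \<otimes> inv z) = ?q (comm G x y)" by (simp add: e)
    then have "z \<otimes> comm G x y \<otimes> inv z \<otimes> inv (comm G x y) \<in> N"
      by (rule iffD1[OF rcos_eq_iff[OF N], rotated 2]) (use x yc zc in simp_all)
    then have "comm G z (comm G x y) \<in> N" by (simp add: comm_def)
    then show ?thesis using inv_comm[of z "comm G x y", symmetric] x yc zc N.m_inv_closed by simp
  qed
  have x: "x \<in> generate G {comm G x y | x y. x \<in> carrier G \<and> y \<in> lcs G i}"
    using Suc.prems Suc.hyps lcs_Suc by blast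
  have y: "y \<in> generate G (lcs G j)" using Suc.prems by (simp add: generate.incl)
  have "comm G x y \<in> N"
    by (rule comm_generate_subset[OF N _ _ _ x y]) (use gen in \<open>blast+\<close>)
  then show ?case by (simp add: N_def)
qed

text \<open>Bilinearity of the commutator without error terms; the hypotheses describe a quotient in
  which the commutators of higher weight have been killed.\<close>

lemma comm_expand:
  assumes c: "a \<in> carrier G" "x \<in> carrier G" "b \<in> carrier G" "y \<in> carrier G"
    and ab: "a \<otimes> b = b \<otimes> a"
    and axy: "a \<otimes> comm G x y = comm G x y \<otimes> a" "b \<otimes> comm G x y = comm G x y \<otimes> b"
    and p: "\<And>u. u \<in> carrier G \<Longrightarrow> comm G a y \<otimes> u = u \<otimes> comm G a y"
    and r: "\<And>u. u \<in> carrier G \<Longrightarrow> comm G x b \<otimes> u = u \<otimes> comm G x b"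
  shows "comm G (a \<otimes> x) (b \<otimes> y) = comm G x y \<otimes> comm G a y \<otimes> comm G x b"
proof -
  define k p' r' where "k = comm G x y" and "p' = comm G a y" and "r' = comm G x b"
  have cc: "k \<in> carrier G" "p' \<in> carrier G" "r' \<in> carrier G"
    using c by (simp_all add: k_def p'_def r'_def)
  have m: "x \<otimes> y = k \<otimes> (y \<otimes> x)" "a \<otimes> y =
      p' \<otimes> (y \<otimes> a)" "x \<otimes> b = r' \<otimes> (b \<otimes> x)"
    unfolding k_def p'_def r'_def using c by (simp_all add: comm_mult[symmetric])
  have ak: "a \<otimes> k = k \<otimes> a" "b \<otimes> k = k \<otimes> b" using axy by (simp_all add: k_def)
  have "a \<otimes> x \<otimes> (b \<otimes> y) = a \<otimes> (x \<otimes> b) \<otimes> y"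
    using c by (simp add: m_assoc)
  also have "\<dots> = (a \<otimes> r') \<otimes> b \<otimes> (x \<otimes> y)"
    unfolding m(3) using c cc by (simp add: m_assoc)
  also have "\<dots> = (r' \<otimes> a) \<otimes> b \<otimes> (x \<otimes> y)"
    using r[of a] c by (simp add: r'_def)
  also have "\<dots> = r' \<otimes> (a \<otimes> (b \<otimes> k)) \<otimes> (y \<otimes> x)"
    unfolding m(1) using c cc by (simp add: m_assoc)
  also have "\<dots> = r' \<otimes> (a \<otimes> k) \<otimes> b \<otimes> (y \<otimes> x)"
    unfolding ak(2) using c cc by (simp add: m_assoc)
  also have "\<dots> = r' \<otimes> k \<otimes> (a \<otimes> b) \<otimes> (y \<otimes> x)"
    unfolding ak(1) using c cc by (simp add: m_assoc)
  also have "\<dots> = r' \<otimes> k \<otimes> b \<otimes> (a \<otimes> y) \<otimes> x"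
    unfolding ab using c cc by (simp add: m_assoc)
  also have "\<dots> = (r' \<otimes> k) \<otimes> (b \<otimes> p') \<otimes> (y \<otimes> a \<otimes> x)"
    unfolding m(2) using c cc by (simp add: m_assoc)
  also have "\<dots> = (r' \<otimes> k) \<otimes> (p' \<otimes> b) \<otimes> (y \<otimes> a \<otimes> x)"
    using p[of b] c by (simp add: p'_def)
  also have "\<dots> = r' \<otimes> (k \<otimes> p') \<otimes> (b \<otimes> y \<otimes> (a \<otimes> x))"
    using c cc by (simp add: m_assoc)
  also have "r' \<otimes> (k \<otimes> p') = k \<otimes> p' \<otimes> r'"
    using r[of "k \<otimes> p'"] cc by (simp add: r'_def)
  finally show ?thesis
    unfolding k_def[symmetric] p'_def[symmetric] r'_def[symmetric]
    by (intro comm_eqI) (use c cc in auto)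
qed

lemma comm_lcs_ge:
  "1 \<le> i \<Longrightarrow> 1 \<le> l \<Longrightarrow> x \<in> lcs G i \<Longrightarrow> y \<in>
      lcs G l \<Longrightarrow> m \<le> i + l \<Longrightarrow> comm G x y \<in> lcs G m"
  by (rule lcs_le[OF comm_lcs])

text \<open>The source of the linearity and Leibniz statements below. What is discarded has weight
  at least i + l + j + 1: [a, b] has weight i + l + 2j, while [a, [x, y]] and [b, [x, y]] have
  weights 2i + l + j and i + 2l + j.\<close>

lemma comm_expand_lcs:
  assumes "1 \<le> i" "1 \<le> l" "1 \<le> j"
    and x: "x \<in> lcs G i" and y: "y \<in> lcs G l" and a: "a \<in> lcs G (i + j)" and b: "b \<in> lcs G (l + j)"
  shows "lcs G (Suc (i + l + j)) #> comm G (a \<otimes> x) (b \<otimes> y) =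
         lcs G (Suc (i + l + j)) #> (comm G x y \<otimes> comm G a y \<otimes> comm G x b)"
proof -
  define N where "N = lcs G (Suc (i + l + j))"
  have N: "N \<lhd> G" unfolding N_def by (rule lcs_normal)
  interpret N: normal N G by (rule N)
  interpret Q: group "G Mod N" by (rule N.factorgroup_is_group)
  interpret q: group_hom G "G Mod N" "\<lambda>x. N #> x"
    by unfold_locales (rule N.r_coset_hom_Mod)
  let ?q = "\<lambda>x. N #> x"
  have c: "a \<in> carrier G" "x \<in> carrier G" "b \<in> carrier G" "y \<in> carrier G"
    using x y a b by auto
  have com: "?q u \<otimes>\<^bsub>G Mod N\<^esub> ?q v = ?q v \<otimes>\<^bsub>G Mod N\<^esub> ?q u"
    if "u \<in> lcs G s" "v \<in> lcs G t" "1 \<le> s" "1 \<le> t" "Suc (i + l + j) \<le> s + t" for u v s t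
    by (rule iffD1[OF comm_mem_iff[OF N]]) (use that comm_lcs_ge[OF that(3,4,1,2,5)] in \<open>auto simp: N_def\<close>)
  have k: "comm G x y \<in> lcs G (i + l)" "comm G a y \<in> lcs G (i + l + j)" "comm G x b \<in> lcs G (i + l + j)"
    using comm_lcs[OF _ _ x y] comm_lcs[OF _ _ a y] comm_lcs[OF _ _ x b] assms(1-3) by (simp_all add: ac_simps)
  have cen: "?q u \<otimes>\<^bsub>G Mod N\<^esub> v = v \<otimes>\<^bsub>G Mod N\<^esub> ?q u"
    if u: "u \<in> lcs G (i + l + j)" and v: "v \<in> carrier (G Mod N)" for u v
  proof -
    obtain w where w: "w \<in> carrier G" "v = N #> w" using v by (auto simp: carrier_FactGroup)
    show ?thesis unfolding w(2) by (rule com[OF u, of w 1]) (use w assms in auto)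
  qed
  have "comm (G Mod N) (?q a \<otimes>\<^bsub>G Mod N\<^esub> ?q x) (?q b \<otimes>\<^bsub>G Mod N\<^esub> ?q y) =
    comm (G Mod N) (?q x) (?q y) \<otimes>\<^bsub>G Mod N\<^esub> comm (G Mod N) (?q a) (?q y) \<otimes>\<^bsub>G Mod N\<^esub> comm (G Mod N) (?q x) (?q b)"
  proof (rule Q.comm_expand)
    show "?q a \<otimes>\<^bsub>G Mod N\<^esub> ?q b = ?q b \<otimes>\<^bsub>G Mod N\<^esub> ?q a"
      by (rule com[OF a b]) (use assms in auto)
    show "?q a \<otimes>\<^bsub>G Mod N\<^esub> comm (G Mod N) (?q x) (?q y) =
        comm (G Mod N) (?q x) (?q y) \<otimes>\<^bsub>G Mod N\<^esub> ?q a"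
      using com[OF a k(1)] c assms(1-3) by (simp add: hom_comm[OF Q.is_group q.homh])
    show "?q b \<otimes>\<^bsub>G Mod N\<^esub> comm (G Mod N) (?q x) (?q y) =
        comm (G Mod N) (?q x) (?q y) \<otimes>\<^bsub>G Mod N\<^esub> ?q b"
      using com[OF b k(1)] c assms(1-3) by (simp add: hom_comm[OF Q.is_group q.homh])
    show "comm (G Mod N) (?q a) (?q y) \<otimes>\<^bsub>G Mod N\<^esub> u =
        u \<otimes>\<^bsub>G Mod N\<^esub> comm (G Mod N) (?q a) (?q y)"
      if "u \<in> carrier (G Mod N)" for u
      using cen[OF k(2) that] c by (simp add: hom_comm[OF Q.is_group q.homh])
    show "comm (G Mod N) (?q x) (?q b) \<otimes>\<^bsub>G Mod N\<^esub> u =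
        u \<otimes>\<^bsub>G Mod N\<^esub> comm (G Mod N) (?q x) (?q b)"
      if "u \<in> carrier (G Mod N)" for u
      using cen[OF k(3) that] c by (simp add: hom_comm[OF Q.is_group q.homh])
  qed (simp_all only: q.hom_closed c)
  then show ?thesis
    unfolding N_def[symmetric] using c by (simp add: hom_comm[OF Q.is_group q.homh])
qed

end

section \<open>The graded Lie ring of a group\<close>

text \<open>For x in \<open>lcs G i\<close> this is an element of \<Gamma>_i/\<Gamma>_{i+1}, but it
  makes sense for every x, so that classes can be rewritten without carrying membership
  along.\<close>

definition gcl :: "('a, 'b) monoid_scheme \<Rightarrow> nat \<Rightarrow> 'a \<Rightarrow> 'a set" where
  "gcl G i x = r_coset G (lcs G (Suc i)) x"

context group
begin

text \<open>Both gradings have this shape: \<Gamma>_i/\<Gamma>_{i+1} in G, and A_j/A_{j+1} in the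
  automorphism group, where the denominator is normal in the whole group.\<close>

lemma subquotient_carrier:
  "carrier ((G\<lparr>carrier := P\<rparr>) Mod N) = (\<lambda>x. N #> x) ` P"
  by (simp add: carrier_FactGroup r_coset_def)

lemma subquotient_mult:
  assumes "N \<lhd> G" "x \<in> carrier G" "y \<in> carrier G"
  shows "(N #> x) \<otimes>\<^bsub>(G\<lparr>carrier := P\<rparr>) Mod N\<^esub> (N #> y) = N #> (x \<otimes> y)"
  using normal.rcos_sum[OF assms] by (simp add: mult_FactGroup set_mult_def)

lemma subquotient_group:
  assumes "N \<lhd> G" "subgroup P G" "N \<subseteq> P"
  shows "group ((G\<lparr>carrier := P\<rparr>) Mod N)"
  by (rule normal.factorgroup_is_group[OF normal_restrict_supergroup[OF assms(2,1,3)]])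

lemma subquotient_inv:
  assumes "N \<lhd> G" "subgroup P G" "N \<subseteq> P" "x \<in> P"
  shows "inv\<^bsub>(G\<lparr>carrier := P\<rparr>) Mod N\<^esub> (N #> x) = N #> inv x"
proof -
  interpret Q: group "(G\<lparr>carrier := P\<rparr>) Mod N" by (rule subquotient_group[OF assms(1-3)])
  interpret P: subgroup P G by fact
  interpret N: normal N G by fact
  have x: "x \<in> carrier G" "inv x \<in> P" "inv x \<in> carrier G"
    using assms(4) by auto
  have "N #> (inv x \<otimes> x) = \<one>\<^bsub>(G\<lparr>carrier := P\<rparr>) Mod N\<^esub>"
    using x N.subset by (simp add: one_FactGroup coset_mult_one)
  then show ?thesis
    using x assms(4) subquotient_mult[OF assms(1) x(3,1), of P]
    by (intro Q.inv_equality) (simp_all add: subquotient_carrier)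
qed

text \<open>The brackets and \<open>johnson\<close> pick representatives by \<open>SOME\<close>.
  Writing the choice as a x with a in N reduces well-definedness to independence of a.\<close>

lemma some_rcos:
  assumes "N \<lhd> G" "x \<in> carrier G"
  obtains a where "a \<in> N" "(SOME y. y \<in> N #> x) = a \<otimes> x"
proof -
  have "x \<in> N #> x" using assms by (simp add: normal_imp_subgroup rcos_self)
  then have "(SOME y. y \<in> N #> x) \<in> N #> x" by (rule someI)
  then show ?thesis using that by (auto simp: r_coset_def)
qed

lemma carrier_grQ: "carrier (grQ G i) = gcl G i ` lcs G i"
  unfolding grQ_def gcl_def by (rule subquotient_carrier)

lemma gcl_closed [intro, simp]: "x \<in> lcs G i \<Longrightarrow> gcl G i x \<in> carrier (grQ G i)"
  by (simp add: carrier_grQ)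

lemma grQ_mult:
  "x \<in> carrier G \<Longrightarrow> y \<in>
      carrier G \<Longrightarrow> gcl G i x \<otimes>\<^bsub>grQ G i\<^esub> gcl G i y = gcl G i (x \<otimes> y)"
  unfolding grQ_def gcl_def by (rule subquotient_mult[OF lcs_normal])

lemma grQ_group: "group (grQ G i)"
  unfolding grQ_def by (rule subquotient_group[OF lcs_normal lcs_subgroup lcs_Suc_subset])

lemma grQ_inv: "x \<in> lcs G i \<Longrightarrow> inv\<^bsub>grQ G i\<^esub> gcl G i x = gcl G i (inv x)"
  unfolding grQ_def gcl_def by (rule subquotient_inv[OF lcs_normal lcs_subgroup lcs_Suc_subset])

lemma gcl_eq_iff:
  "x \<in> carrier G \<Longrightarrow> y \<in> carrier G \<Longrightarrow> gcl G i x =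
      gcl G i y \<longleftrightarrow> x \<otimes> inv y \<in> lcs G (Suc i)"
  unfolding gcl_def by (rule rcos_eq_iff[OF lcs_normal])

lemma grQ_one: "\<one>\<^bsub>grQ G i\<^esub> = gcl G i \<one>"
  unfolding grQ_def gcl_def
  by (simp add: one_FactGroup coset_mult_one lcs_subgroup subgroup.subset)

lemma gcl_eq_one_iff: "x \<in> carrier G \<Longrightarrow> gcl G i x = gcl G i \<one> \<longleftrightarrow>
    x \<in> lcs G (Suc i)"
  by (simp add: gcl_eq_iff)

lemma gcl_mult_cong:
  assumes "x \<in> carrier G" "y \<in> carrier G" "x' \<in> carrier G" "y' \<in> carrier G"
    "gcl G i x = gcl G i x'" "gcl G i y = gcl G i y'"
  shows "gcl G i (x \<otimes> y) = gcl G i (x' \<otimes> y')"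
  using assms by (simp flip: grQ_mult)

lemma gcl_mult_left:
  assumes "a \<in> lcs G (Suc i)" "x \<in> carrier G"
  shows "gcl G i (a \<otimes> x) = gcl G i x"
proof -
  have a: "a \<in> carrier G" using assms by auto
  then show ?thesis using assms by (simp add: gcl_eq_iff m_assoc)
qed

lemma gcl_commute:
  assumes "1 \<le> i" "x \<in> lcs G i" "y \<in> carrier G"
  shows "gcl G i (x \<otimes> y) = gcl G i (y \<otimes> x)"
proof -
  have x: "x \<in> carrier G" using assms by auto
  have "comm G x y \<in> lcs G (Suc i)"
    using comm_lcs_ge[of i 1 x y "Suc i"] assms by simp
  then show ?thesis
    using gcl_mult_left[of "comm G x y" i "y \<otimes> x"] comm_mult[OF x assms(3)] x assms(3) by simp
qed

lemma gcl_conj: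
  assumes "1 \<le> i" "u \<in> lcs G i" "k \<in> carrier G"
  shows "gcl G i (k \<otimes> u \<otimes> inv k) = gcl G i u"
proof -
  have u: "u \<in> carrier G" using assms by auto
  have "comm G k u \<in> lcs G (Suc i)"
    using comm_lcs_Suc assms by blast
  then show ?thesis using gcl_mult_left[of "comm G k u" i u] conj_eq_comm[of k u] u assms by simp
qed

lemma some_gcl:
  assumes "x \<in> lcs G i"
  obtains a where "a \<in> lcs G (Suc i)" "(SOME y. y \<in> gcl G i x) = a \<otimes> x"
  unfolding gcl_def using some_rcos[OF lcs_normal lcs_carrier[OF assms]] .

text \<open>\<open>comm_expand_lcs\<close> with j = 1: the terms [a, y] and [x, b] then lie in
  \<Gamma>_{i+l+1} and disappear from the class.\<close>

lemma gcl_comm_cong: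
  assumes "1 \<le> i" "1 \<le> l" "x \<in> lcs G i" "y \<in> lcs G l" "a \<in> lcs G (Suc i)" "b \<in> lcs G (Suc l)"
  shows "gcl G (i + l) (comm G (a \<otimes> x) (b \<otimes> y)) = gcl G (i + l) (comm G x y)"
proof -
  have c: "x \<in> carrier G" "y \<in> carrier G" "a \<in> carrier G" "b \<in> carrier G"
    using assms by auto
  have k: "comm G a y \<in> lcs G (Suc (i + l))" "comm G x b \<in> lcs G (Suc (i + l))"
    using comm_lcs[OF _ _ assms(5,4)] comm_lcs[OF _ _ assms(3,6)] assms(1,2) by simp_all
  have "gcl G (i + l) (comm G (a \<otimes> x) (b \<otimes> y)) =
      gcl G (i + l) (comm G x y \<otimes> comm G a y \<otimes> comm G x b)"
  proof -
    have "lcs G (Suc (i + l + 1)) #> comm G (a \<otimes> x) (b \<otimes> y) =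
         lcs G (Suc (i + l + 1)) #> (comm G x y \<otimes> comm G a y \<otimes> comm G x b)"
      by (rule comm_expand_lcs) (use assms in auto)
    then have "comm G (a \<otimes> x) (b \<otimes> y) \<otimes> inv (comm G x y \<otimes> comm G a y \<otimes>
        comm G x b) \<in> lcs G (Suc (i + l + 1))"
      using c by (subst (asm) rcos_eq_iff[OF lcs_normal]) auto
    then have "comm G (a \<otimes> x) (b \<otimes> y) \<otimes> inv (comm G x y \<otimes> comm G a y \<otimes>
        comm G x b) \<in> lcs G (Suc (i + l))"
      by (rule lcs_le) simp
    then show ?thesis using c by (simp add: gcl_eq_iff)
  qed
  also have "\<dots> = gcl G (i + l) (comm G x y \<otimes> \<one> \<otimes> \<one>)"
    using c k by (intro gcl_mult_cong) (auto simp: gcl_eq_iff)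
  finally show ?thesis using c by simp
qed

lemma lie_br_gcl:
  assumes "1 \<le> i" "1 \<le> l" "x \<in> lcs G i" "y \<in> lcs G l"
  shows "lie_br G i l (gcl G i x) (gcl G l y) = gcl G (i + l) (comm G x y)"
proof -
  obtain a where a: "a \<in> lcs G (Suc i)" "(SOME y. y \<in> gcl G i x) = a \<otimes> x"
    using some_gcl assms by blast
  obtain b where b: "b \<in> lcs G (Suc l)" "(SOME z. z \<in> gcl G l y) = b \<otimes> y"
    using some_gcl assms by blast
  show ?thesis
    unfolding lie_br_def a(2) b(2) gcl_def[symmetric] using gcl_comm_cong assms a b by blast
qed

text \<open>The graded ring is generated in degree one, since \<Gamma>_{i+1} is generated by the
  [x, y] with y in \<Gamma>_i; the Leibniz rule carries agreement from degrees 1 and i to degree i +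
  1. Degree 0 and values off the carriers agree because both sides are \<open>undefined\<close>
  there.\<close>

lemma der_eqI:
  assumes D: "D \<in> der G k" and E: "E \<in> der G k" and k: "1 \<le> k" and S: "S \<subseteq> carrier G"
    and gen: "generate G S = carrier G"
    and eq: "\<And>x. x \<in> S \<Longrightarrow> D 1 (gcl G 1 x) = E 1 (gcl G 1 x)"
  shows "D = E"
proof -
  have homD: "D i \<in> hom (grQ G i) (grQ G (i + k))" "E i \<in> hom (grQ G i) (grQ G (i + k))" if "1 \<le> i" for i
    using D E that by (auto simp: der_def)
  have ext: "D i (gcl G i x) = E i (gcl G i x)"
    if "1 \<le> i" "T \<subseteq> lcs G i" "\<And>x. x \<in> T \<Longrightarrow> D i (gcl G i x) =
        E i (gcl G i x)" "x \<in> generate G T" for i T x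
  proof -
    interpret D: group_hom "grQ G i" "grQ G (i + k)" "D i"
      using homD[OF that(1)] grQ_group by (simp add: group_hom_axioms_def group_hom_def)
    interpret E: group_hom "grQ G i" "grQ G (i + k)" "E i"
      using homD[OF that(1)] grQ_group by (simp add: group_hom_axioms_def group_hom_def)
    have "x \<in> lcs G i \<and> D i (gcl G i x) = E i (gcl G i x)"
      using that(4)
    proof (induction rule: generate.induct)
      case one
      show ?case using D.hom_one E.hom_one by (simp add: grQ_one)
    next
      case (incl h) then show ?case using that by auto
    next
      case (inv h)
      then have h: "h \<in> lcs G i" "D i (gcl G i h) = E i (gcl G i h)" using that by auto
      then show ?case using D.hom_inv[of "gcl G i h"] E.hom_inv[of "gcl G i h"] by (simp add: grQ_inv)
    next
      case (eng h1 h2)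
      then have h: "h1 \<in> lcs G i" "h2 \<in> lcs G i" "h1 \<in> carrier G" "h2 \<in> carrier G" by auto
      show ?case using D.hom_mult[of "gcl G i h1" "gcl G i h2"] E.hom_mult[of "gcl G i h1" "gcl G i h2"]
          eng.IH h by (simp add: grQ_mult)
    qed
    then show ?thesis by simp
  qed
  have all: "\<forall>x\<in>lcs G i. D i (gcl G i x) = E i (gcl G i x)" if "1 \<le> i" for i
    using that
  proof (induction i rule: nat_induct_at_least)
    case base
    show ?case using ext[of 1 S] S gen eq by simp
  next
    case (Suc i)
    let ?T = "{comm G x y | x y. x \<in> carrier G \<and> y \<in> lcs G i}"
    have T: "?T \<subseteq> lcs G (Suc i)" using comm_lcs_Suc Suc.hyps by auto
    have *: "D (Suc i) (gcl G (Suc i) h) = E (Suc i) (gcl G (Suc i) h)" if "h \<in> ?T" for h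
    proof -
      obtain x y where h: "h = comm G x y" and x: "x \<in> lcs G 1" and y: "y \<in> lcs G i"
        using \<open>h \<in> ?T\<close> by auto
      have br: "gcl G (Suc i) h = lie_br G 1 i (gcl G 1 x) (gcl G i y)"
        using lie_br_gcl[OF _ Suc.hyps x y] h by simp
      have der: "F (1 + i) (lie_br G 1 i (gcl G 1 x) (gcl G i y)) =
            lie_br G (1 + k) i (F 1 (gcl G 1 x)) (gcl G i y) \<otimes>\<^bsub>grQ G (1 + i + k)\<^esub>
            lie_br G 1 (i + k) (gcl G 1 x) (F i (gcl G i y))" if "F \<in> der G k" for F
        using that Suc.hyps gcl_closed[OF x] gcl_closed[OF y] unfolding der_def by blast
      have "D 1 (gcl G 1 x) = E 1 (gcl G 1 x)" using ext[of 1 S x] S gen eq x by simp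
      then show ?thesis using br der[OF D] der[OF E] Suc.IH y by simp
    qed
    show ?case using ext[OF _ T *] lcs_Suc[OF Suc.hyps] by simp
  qed
  show ?thesis
  proof
    fix i
    show "D i = E i"
    proof (cases "i = 0")
      case True then show ?thesis using D E by (simp add: der_def)
    next
      case False
      then have "D i \<in> extensional (carrier (grQ G i))" "E i \<in> extensional (carrier (grQ G i))"
        using D E by (auto simp: der_def)
      then show ?thesis
        by (rule extensionalityI) (use all[of i] False in \<open>auto simp: carrier_grQ\<close>)
    qed
  qed
qed

end

section \<open>The Andreadakis filtration and the Johnson morphism\<close>

definition acl :: "('a, 'b) monoid_scheme \<Rightarrow> nat \<Rightarrow> ('a \<Rightarrow> 'a) \<Rightarrow> ('a \<Rightarrow> 'a) set" where
  "acl G j s = r_coset (AutoGroup G) (andr G (Suc j)) s"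

lemma carrier_AutoGroup [simp]: "carrier (AutoGroup G) = auto G"
  by (simp add: AutoGroup_def)

context group
begin

lemma auto_hom: "s \<in> auto G \<Longrightarrow> group_hom G G s"
  by unfold_locales (simp add: auto_def)

lemma AutoGroup_mult:
  "s \<in> auto G \<Longrightarrow> t \<in> auto G \<Longrightarrow> x \<in>
      carrier G \<Longrightarrow> (s \<otimes>\<^bsub>AutoGroup G\<^esub> t) x = s (t x)"
  by (simp add: AutoGroup_def BijGroup_def auto_def compose_eq)

lemma AutoGroup_one: "x \<in> carrier G \<Longrightarrow> \<one>\<^bsub>AutoGroup G\<^esub> x = x"
  by (simp add: AutoGroup_def BijGroup_def)

lemma auto_closed: "s \<in> auto G \<Longrightarrow> x \<in> carrier G \<Longrightarrow> s x \<in> carrier G"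
  by (auto simp: auto_def hom_def)

lemma AutoGroup_inv:
  assumes "s \<in> auto G"
  shows "inv\<^bsub>AutoGroup G\<^esub> s \<in> auto G"
    and "x \<in> carrier G \<Longrightarrow> s ((inv\<^bsub>AutoGroup G\<^esub> s) x) = x"
    and "x \<in> carrier G \<Longrightarrow> (inv\<^bsub>AutoGroup G\<^esub> s) (s x) = x"
proof -
  interpret A: group "AutoGroup G" by (rule AutoGroup)
  show i: "inv\<^bsub>AutoGroup G\<^esub> s \<in> auto G" using A.inv_closed[of s] assms by simp
  show "s ((inv\<^bsub>AutoGroup G\<^esub> s) x) = x" if "x \<in> carrier G"
    using AutoGroup_mult[OF assms i that] A.r_inv[of s] assms AutoGroup_one[OF that] by simp
  show "(inv\<^bsub>AutoGroup G\<^esub> s) (s x) = x" if "x \<in> carrier G"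
    using AutoGroup_mult[OF i assms that] A.l_inv[of s] assms AutoGroup_one[OF that] by simp
qed

lemma hom_lcs:
  assumes "h \<in> hom G G" "x \<in> lcs G i"
  shows "h x \<in> lcs G i"
proof -
  interpret h: group_hom G G h by unfold_locales fact
  have "\<forall>x\<in>lcs G i. h x \<in> lcs G i"
  proof (induction i)
    case 0 then show ?case by simp
  next
    case (Suc i)
    show ?case
    proof (cases "i = 0")
      case True then show ?thesis by simp
    next
      case False
      show ?thesis
      proof
        fix x assume "x \<in> lcs G (Suc i)"
        then have "x \<in> generate G {comm G x y | x y. x \<in> carrier G \<and> y \<in> lcs G i}"
          using lcs_Suc False by simp
        then have "x \<in> carrier G \<and> h x \<in> lcs G (Suc i)"
        proof (induction rule: generate.induct)
          case one then show ?case by simp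
        next
          case (incl u)
          then obtain x y where u: "u = comm G x y" "x \<in> carrier G" "y \<in> lcs G i" by auto
          have "comm G (h x) (h y) \<in> lcs G (Suc i)"
            using comm_lcs_Suc[of i "h x" "h y"] Suc.IH u False by simp
          then show ?case using u hom_comm[OF is_group assms(1) u(2), of y] by auto
        next
          case (inv u)
          then obtain x y where u: "u = comm G x y" "x \<in> carrier G" "y \<in> lcs G i" by auto
          have "comm G (h x) (h y) \<in> lcs G (Suc i)"
            using comm_lcs_Suc[of i "h x" "h y"] Suc.IH u False by simp
          then show ?case using u hom_comm[OF is_group assms(1) u(2), of y] by auto
        next
          case (eng u v) then show ?case by simp
        qed
        then show "h x \<in> lcs G (Suc i)" by simp
      qed
    qed
  qed
  then show ?thesis using assms by blast
qed

section \<open>The filtration of the automorphism group\<close>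

lemma andr_auto: "s \<in> andr G j \<Longrightarrow> s \<in> auto G"
  by (simp add: andr_def)

lemma andr_lcs: "s \<in> andr G j \<Longrightarrow> 1 \<le> i \<Longrightarrow> x \<in>
    lcs G i \<Longrightarrow> s x \<otimes> inv x \<in> lcs G (i + j)"
  by (simp add: andr_def)

lemma auto_lcs: "s \<in> auto G \<Longrightarrow> x \<in> lcs G i \<Longrightarrow> s x \<in> lcs G i"
  using hom_lcs by (simp add: auto_def)

lemma andr_subgroup: "subgroup (andr G j) (AutoGroup G)"
proof (rule subgroup.intro)
  show "andr G j \<subseteq> carrier (AutoGroup G)" using andr_auto by auto
next
  interpret A: group "AutoGroup G" by (rule AutoGroup)
  fix s t assume s: "s \<in> andr G j" and t: "t \<in> andr G j"
  have st: "s \<in> auto G" "t \<in> auto G" using s t andr_auto by auto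
  have "(s \<otimes>\<^bsub>AutoGroup G\<^esub> t) x \<otimes> inv x \<in> lcs G (i + j)" if "1 \<le> i" "x \<in>
      lcs G i" for i x
  proof -
    have x: "x \<in> carrier G" using that by auto
    have 1: "s (t x) \<otimes> inv (t x) \<in> lcs G (i + j)"
      using andr_lcs[OF s that(1) auto_lcs[OF st(2) that(2)]] .
    have 2: "t x \<otimes> inv x \<in> lcs G (i + j)" using andr_lcs[OF t that] .
    have "(s (t x) \<otimes> inv (t x)) \<otimes> (t x \<otimes> inv x) = s (t x) \<otimes> inv x"
      using x st by (simp add: m_assoc auto_closed)
    then show ?thesis using lcs_closed(2)[OF 1 2] AutoGroup_mult[OF st x] by simp
  qed
  then show "s \<otimes>\<^bsub>AutoGroup G\<^esub> t \<in> andr G j"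
    using A.m_closed[of s t] st by (simp add: andr_def)
next
  interpret A: group "AutoGroup G" by (rule AutoGroup)
  show "\<one>\<^bsub>AutoGroup G\<^esub> \<in> andr G j"
    using A.one_closed by (auto simp: andr_def AutoGroup_one lcs_carrier)
next
  fix s assume s: "s \<in> andr G j"
  let ?t = "inv\<^bsub>AutoGroup G\<^esub> s"
  have sa: "s \<in> auto G" using s andr_auto by auto
  have "?t x \<otimes> inv x \<in> lcs G (i + j)" if "1 \<le> i" "x \<in> lcs G i" for i x
  proof -
    have x: "x \<in> carrier G" using that by auto
    have t: "?t x \<in> lcs G i" "?t x \<in> carrier G"
      using auto_lcs[OF AutoGroup_inv(1)[OF sa] that(2)] by auto
    have "s (?t x) \<otimes> inv (?t x) \<in> lcs G (i + j)" using andr_lcs[OF s that(1) t(1)] .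
    then have "x \<otimes> inv (?t x) \<in> lcs G (i + j)" using AutoGroup_inv(2)[OF sa x] by simp
    then have "inv (x \<otimes> inv (?t x)) \<in> lcs G (i + j)" by (rule lcs_closed)
    then show ?thesis using x t by (simp add: inv_mult_group)
  qed
  then show "inv\<^bsub>AutoGroup G\<^esub> s \<in> andr G j"
    using AutoGroup_inv(1)[OF sa] by (simp add: andr_def)
qed

text \<open>The displacement of t s t^-1 at x is the image under t of the displacement of s at t^-1
  x.\<close>

lemma andr_normal: "andr G j \<lhd> AutoGroup G"
proof -
  interpret A: group "AutoGroup G" by (rule AutoGroup)
  have "t \<otimes>\<^bsub>AutoGroup G\<^esub> s \<otimes>\<^bsub>AutoGroup G\<^esub> inv\<^bsub>AutoGroup G\<^esub> t \<in> andr G j"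
    if t: "t \<in> auto G" and s: "s \<in> andr G j" for s t
  proof -
    let ?r = "inv\<^bsub>AutoGroup G\<^esub> t" and ?c = "t \<otimes>\<^bsub>AutoGroup G\<^esub> s \<otimes>\<^bsub>AutoGroup G\<^esub> inv\<^bsub>AutoGroup G\<^esub> t"
    interpret t: group_hom G G t by (rule auto_hom[OF t])
    have a: "s \<in> auto G" "?r \<in> auto G" "t \<otimes>\<^bsub>AutoGroup G\<^esub> s \<in> auto G"
      using s t andr_auto AutoGroup_inv(1)[OF t] A.m_closed[of t s] by auto
    have "?c x \<otimes> inv x \<in> lcs G (i + j)" if "1 \<le> i" "x \<in> lcs G i" for i x
    proof -
      have x: "x \<in> carrier G" using that by auto
      have r: "?r x \<in> lcs G i" "?r x \<in> carrier G" using auto_lcs[OF a(2) that(2)] by auto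
      have "s (?r x) \<otimes> inv (?r x) \<in> lcs G (i + j)" using andr_lcs[OF s that(1) r(1)] .
      then have "t (s (?r x) \<otimes> inv (?r x)) \<in> lcs G (i + j)" by (rule auto_lcs[OF t])
      then show ?thesis using AutoGroup_inv(2)[OF t x] AutoGroup_mult[OF a(3,2) x] AutoGroup_mult[OF t a(1) r(2)]
          r a by (simp add: auto_closed)
    qed
    then show ?thesis using A.m_closed[OF A.m_closed[of t s], of ?r] a t by (simp add: andr_def)
  qed
  then show ?thesis by (simp add: A.normal_inv_iff andr_subgroup)
qed

lemma andr_Suc_subset: "andr G (Suc j) \<subseteq> andr G j"
proof
  fix s assume "s \<in> andr G (Suc j)"
  then have "s \<in> auto G" "\<And>i x. 1 \<le> i \<Longrightarrow> x \<in> lcs G i \<Longrightarrow> s x \<otimes>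
      inv x \<in> lcs G (i + Suc j)"
    by (auto simp: andr_def)
  moreover have "lcs G (i + Suc j) \<subseteq> lcs G (i + j)" for i using lcs_Suc_subset by simp
  ultimately show "s \<in> andr G j"
    unfolding andr_def by blast
qed

lemma carrier_AQ: "carrier (AQ G j) = acl G j ` andr G j"
  unfolding AQ_def acl_def by (rule group.subquotient_carrier[OF AutoGroup])

lemma AQ_mult:
  "s \<in> auto G \<Longrightarrow> t \<in>
      auto G \<Longrightarrow> acl G j s \<otimes>\<^bsub>AQ G j\<^esub> acl G j t = acl G j (s \<otimes>\<^bsub>AutoGroup G\<^esub> t)"
  unfolding AQ_def acl_def by (rule group.subquotient_mult[OF AutoGroup andr_normal]) simp_all

lemma some_acl:
  assumes "s \<in> andr G j"
  obtains r where "r \<in> andr G (Suc j)" "(SOME t. t \<in> acl G j s) = r \<otimes>\<^bsub>AutoGroup G\<^esub> s"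
proof -
  have "s \<in> carrier (AutoGroup G)" using andr_auto[OF assms] by simp
  then show ?thesis
    using that unfolding acl_def by (rule group.some_rcos[OF AutoGroup andr_normal])
qed

text \<open>The origin of injectivity: with y = t^-1 x, the displacement of s t^-1 at x is the
  quotient of the displacements of s and t at y.\<close>

lemma acl_eqI:
  assumes s: "s \<in> auto G" and t: "t \<in> auto G"
    and eq: "\<And>i x. 1 \<le> i \<Longrightarrow> x \<in> lcs G i \<Longrightarrow> gcl G (i + j) (s x \<otimes>
        inv x) = gcl G (i + j) (t x \<otimes> inv x)"
  shows "acl G j s = acl G j t"
proof -
  interpret A: group "AutoGroup G" by (rule AutoGroup)
  let ?r = "inv\<^bsub>AutoGroup G\<^esub> t"
  have r: "?r \<in> auto G" by (rule AutoGroup_inv(1)[OF t])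
  have "(s \<otimes>\<^bsub>AutoGroup G\<^esub> ?r) x \<otimes> inv x \<in>
      lcs G (i + Suc j)" if "1 \<le> i" "x \<in> lcs G i" for i x
  proof -
    have x: "x \<in> carrier G" using that by auto
    have y: "?r x \<in> lcs G i" "?r x \<in> carrier G" using auto_lcs[OF r that(2)] by auto
    have c: "s (?r x) \<in> carrier G" using auto_closed[OF s y(2)] .
    have e: "t (?r x) = x" using AutoGroup_inv(2)[OF t x] .
    have "s (?r x) \<otimes> inv (?r x) \<otimes> inv (x \<otimes> inv (?r x)) \<in> lcs G (Suc (i + j))"
      using eq[OF that(1) y(1)] unfolding e by (subst (asm) gcl_eq_iff) (use c x y in auto)
    then show ?thesis using AutoGroup_mult[OF s r x] c x y by (simp add: inv_mult_group m_assoc)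
  qed
  then have "s \<otimes>\<^bsub>AutoGroup G\<^esub> ?r \<in> andr G (Suc j)"
    using A.m_closed[of s ?r] s r by (simp add: andr_def)
  then show ?thesis unfolding acl_def using A.rcos_eq_iff[OF andr_normal, of s t] s t by simp
qed

text \<open>The cocycle rule for displacements involves a conjugation by x, which acts trivially on
  \<Gamma>_{i+j}/\<Gamma>_{i+j+1}.\<close>

lemma andr_gcl_mult:
  assumes s: "s \<in> andr G j" and i: "1 \<le> i" and x: "x \<in> lcs G i" and y: "y \<in> lcs G i"
  shows "gcl G (i + j) (s (x \<otimes> y) \<otimes> inv (x \<otimes> y)) =
    gcl G (i + j) ((s x \<otimes> inv x) \<otimes> (s y \<otimes> inv y))"
proof -
  interpret s: group_hom G G s by (rule auto_hom[OF andr_auto[OF s]])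
  have c: "x \<in> carrier G" "y \<in> carrier G" using x y by auto
  have "s (x \<otimes> y) \<otimes> inv (x \<otimes> y) =
      (s x \<otimes> inv x) \<otimes> (x \<otimes> (s y \<otimes> inv y) \<otimes> inv x)"
    using c by (simp add: m_assoc inv_mult_group)
  then have "gcl G (i + j) (s (x \<otimes> y) \<otimes> inv (x \<otimes> y)) =
      gcl G (i + j) ((s x \<otimes> inv x) \<otimes> (x \<otimes> (s y \<otimes> inv y) \<otimes> inv x))"
    by (rule arg_cong)
  also have "\<dots> = gcl G (i + j) ((s x \<otimes> inv x) \<otimes> (s y \<otimes> inv y))"
    by (rule gcl_mult_cong[OF _ _ _ _ refl gcl_conj]) (use i andr_lcs[OF s i y] c in auto)
  finally show ?thesis .
qed

text \<open>Neither choice matters: a factor r in A_{j+1} contributes a displacement of weight i + j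
  + 1, and a factor a in \<Gamma>_{i+1} contributes one of weight i + 1 + j. From here on the
  Johnson map is computed on arbitrary representatives.\<close>

lemma johnson_gcl:
  assumes s: "s \<in> andr G j" and j: "1 \<le> j" and i: "1 \<le> i" and x: "x \<in> lcs G i"
  shows "johnson G j (acl G j s) i (gcl G i x) = gcl G (i + j) (s x \<otimes> inv x)"
proof -
  interpret A: group "AutoGroup G" by (rule AutoGroup)
  obtain r where r: "r \<in> andr G (Suc j)" "(SOME t. t \<in> acl G j s) = r \<otimes>\<^bsub>AutoGroup G\<^esub> s"
    using some_acl[OF s] .
  obtain a where a: "a \<in> lcs G (Suc i)" "(SOME y. y \<in> gcl G i x) = a \<otimes> x"
    using some_gcl[OF x] .
  let ?t = "r \<otimes>\<^bsub>AutoGroup G\<^esub> s"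
  have au: "s \<in> auto G" "r \<in> auto G" using s r(1) andr_auto by auto
  have t: "?t \<in> andr G j"
    using r s subgroup.m_closed[OF andr_subgroup] andr_Suc_subset by blast
  have ta: "?t \<in> auto G" using t by (rule andr_auto)
  have c: "x \<in> carrier G" "a \<in> carrier G" "s x \<in> carrier G" "?t x \<in> carrier G" "?t a \<in> carrier G"
     "r (s x) \<in> carrier G"
    using x a au ta by (auto simp: auto_closed)
  have ai: "a \<in> lcs G i" using a(1) by (rule lcs_le) simp
  have "?t a \<otimes> inv a \<in> lcs G (Suc (i + j))" using andr_lcs[OF t _ a(1)] by simp
  then have "gcl G (i + j) (?t (a \<otimes> x) \<otimes> inv (a \<otimes> x)) = gcl G (i + j) (?t x \<otimes> inv x)"
    using andr_gcl_mult[OF t i ai x] gcl_mult_left[of "?t a \<otimes> inv a" "i + j" "?t x \<otimes> inv x"] c by simp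
  also have "?t x = r (s x) \<otimes> inv (s x) \<otimes> s x"
    using AutoGroup_mult[OF au(2,1) c(1)] c by (simp add: m_assoc)
  also have "gcl G (i + j) (r (s x) \<otimes> inv (s x) \<otimes> s x \<otimes> inv x) =
      gcl G (i + j) (s x \<otimes> inv x)"
    using gcl_mult_left[of "r (s x) \<otimes> inv (s x)" "i + j" "s x \<otimes> inv x"] c
      andr_lcs[OF r(1) i auto_lcs[OF au(1) x]] by (simp add: m_assoc)
  finally show ?thesis
    using i x unfolding johnson_def a(2) r(2) by (simp add: gcl_def[symmetric] a(2))
qed

lemma johnson_ext: "johnson G j c 0 = (\<lambda>_. undefined)"
  "1 \<le> i \<Longrightarrow> johnson G j c i \<in> extensional (carrier (grQ G i))"
  by (auto simp: johnson_def)

text \<open>Group form of the Leibniz rule. It mentions only the displacements u and v because it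
  serves automorphisms, endomorphisms not yet known to be bijective, and conjugation by an
  element.\<close>

lemma gcl_comm_displacement:
  assumes i: "1 \<le> i" and l: "1 \<le> l" and j: "1 \<le> j" and x: "x \<in> lcs G i" and y: "y \<in> lcs G l"
    and uv: "u \<in> lcs G (i + j)" "v \<in> lcs G (l + j)"
  shows "gcl G (i + l + j) (comm G (u \<otimes> x) (v \<otimes> y) \<otimes> inv (comm G x y)) =
    gcl G (i + l + j) (comm G u y \<otimes> comm G x v)"
proof -
  have c: "x \<in> carrier G" "y \<in> carrier G" "u \<in> carrier G" "v \<in> carrier G" using x y uv by auto
  have k: "comm G u y \<in> lcs G (i + l + j)" "comm G x v \<in> lcs G (i + l + j)"
    using comm_lcs[OF _ _ uv(1) y] comm_lcs[OF _ _ x uv(2)] i l j by (simp_all add: ac_simps)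
  have kc: "comm G u y \<otimes> comm G x v \<in> lcs G (i + l + j)" using k by simp
  have "gcl G (i + l + j) (comm G (u \<otimes> x) (v \<otimes> y)) =
      gcl G (i + l + j) (comm G x y \<otimes> comm G u y \<otimes> comm G x v)"
    unfolding gcl_def using comm_expand_lcs[OF i l j x y uv] by simp
  then have "gcl G (i + l + j) (comm G (u \<otimes> x) (v \<otimes> y) \<otimes> inv (comm G x y)) =
      gcl G (i + l + j) (comm G x y \<otimes> comm G u y \<otimes> comm G x v \<otimes> inv (comm G x y))"
    using c by (intro gcl_mult_cong) auto
  also have "\<dots> = gcl G (i + l + j) (comm G x y \<otimes> (comm G u y \<otimes> comm G x v) \<otimes>
      inv (comm G x y))"
    using c by (simp add: m_assoc)
  also have "\<dots> = gcl G (i + l + j) (comm G u y \<otimes> comm G x v)"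
    by (rule gcl_conj) (use i kc c in auto)
  finally show ?thesis .
qed

text \<open>Conjugation by z has displacements [z, x] and [z, y], so the Jacobi identity is the
  Leibniz rule for this automorphism.\<close>

lemma gcl_jacobi:
  assumes i: "1 \<le> i" and l: "1 \<le> l" and j: "1 \<le> j" and x: "x \<in> lcs G i" and y: "y \<in> lcs G l"
    and z: "z \<in> lcs G j"
  shows "gcl G (i + l + j) (comm G z (comm G x y)) =
    gcl G (i + l + j) (comm G (comm G z x) y \<otimes> comm G x (comm G z y))"
proof -
  have c: "x \<in> carrier G" "y \<in> carrier G" "z \<in> carrier G" using x y z by auto
  have uv: "comm G z x \<in> lcs G (i + j)" "comm G z y \<in> lcs G (l + j)"
    using comm_lcs[OF j i z x] comm_lcs[OF j l z y] by (simp_all add: add.commute)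
  have "comm G z (comm G x y) =
      comm G (z \<otimes> x \<otimes> inv z) (z \<otimes> y \<otimes> inv z) \<otimes> inv (comm G x y)"
    using c by (simp add: comm_def m_assoc inv_mult_group)
  then show ?thesis
    using gcl_comm_displacement[OF i l j x y uv] c by (simp add: conj_eq_comm)
qed

lemma johnson_der:
  assumes s: "s \<in> andr G j" and j: "1 \<le> j"
  shows "johnson G j (acl G j s) \<in> der G j"
proof -
  let ?D = "johnson G j (acl G j s)"
  interpret s: group_hom G G s by (rule auto_hom[OF andr_auto[OF s]])
  have "?D i \<in> hom (grQ G i) (grQ G (i + j))" if i: "1 \<le> i" for i
  proof (rule homI)
    fix a assume "a \<in> carrier (grQ G i)"
    then obtain x where x: "x \<in> lcs G i" "a = gcl G i x" by (auto simp: carrier_grQ)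
    then show "?D i a \<in> carrier (grQ G (i + j))"
      using johnson_gcl[OF s j i x(1)] andr_lcs[OF s i x(1)] by simp
  next
    fix a b assume "a \<in> carrier (grQ G i)" "b \<in> carrier (grQ G i)"
    then obtain x y where x: "x \<in> lcs G i" "a = gcl G i x" and y: "y \<in> lcs G i" "b = gcl G i y"
      by (auto simp: carrier_grQ)
    have c: "x \<in> carrier G" "y \<in> carrier G" using x y by auto
    show "?D i (a \<otimes>\<^bsub>grQ G i\<^esub> b) = ?D i a \<otimes>\<^bsub>grQ G (i + j)\<^esub> ?D i b"
      unfolding x(2) y(2) using c johnson_gcl[OF s j i] x(1) y(1) andr_gcl_mult[OF s i x(1) y(1)]
      by (simp add: grQ_mult del: s.hom_mult)
  qed
  moreover have "?D (i + l) (lie_br G i l a b) =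
            lie_br G (i + j) l (?D i a) b \<otimes>\<^bsub>grQ G (i + l + j)\<^esub> lie_br G i (l + j) a (?D l b)"
    if i: "1 \<le> i" and l: "1 \<le> l" and "a \<in> carrier (grQ G i)" "b \<in> carrier (grQ G l)" for i l a b
  proof -
    obtain x y where x: "x \<in> lcs G i" "a = gcl G i x" and y: "y \<in> lcs G l" "b = gcl G l y"
      using \<open>a \<in> _\<close> \<open>b \<in> _\<close> by (auto simp: carrier_grQ)
    define u v where "u = s x \<otimes> inv x" and "v = s y \<otimes> inv y"
    have uv: "u \<in> lcs G (i + j)" "v \<in> lcs G (l + j)"
      using andr_lcs[OF s i x(1)] andr_lcs[OF s l y(1)] by (auto simp: u_def v_def)
    have c: "x \<in> carrier G" "y \<in> carrier G" "u \<in> carrier G" "v \<in> carrier G"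
      using x y uv by auto
    have k: "comm G u y \<in> lcs G (i + l + j)" "comm G x v \<in> lcs G (i + l + j)" "comm G x y \<in> lcs G (i + l)"
      using comm_lcs[OF _ _ uv(1) y(1)] comm_lcs[OF _ _ x(1) uv(2)] comm_lcs[OF _ _ x(1) y(1)] i l j
      by (simp_all add: ac_simps)
    have e: "s x = u \<otimes> x" "s y = v \<otimes> y" using c by (simp_all add: u_def v_def m_assoc)
    have "s (comm G x y) = comm G (u \<otimes> x) (v \<otimes> y)"
      using hom_comm[OF is_group s.homh c(1,2)] e by simp
    then have "gcl G (i + l + j) (s (comm G x y) \<otimes> inv (comm G x y)) =
        gcl G (i + l + j) (comm G u y \<otimes> comm G x v)"
      using gcl_comm_displacement[OF i l j x(1) y(1) uv] by simp
    then have 1: "?D (i + l) (gcl G (i + l) (comm G x y)) = gcl G (i + l + j) (comm G u y \<otimes> comm G x v)"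
      using johnson_gcl[OF s j _ k(3)] i by simp
    have 2: "lie_br G (i + j) l (?D i a) b = gcl G (i + l + j) (comm G u y)"
      unfolding x y using johnson_gcl[OF s j i x(1)] lie_br_gcl[of "i + j" l u y] uv y i l
      by (simp add: u_def ac_simps)
    have 3: "lie_br G i (l + j) a (?D l b) = gcl G (i + l + j) (comm G x v)"
      unfolding x y using johnson_gcl[OF s j l y(1)] lie_br_gcl[of i "l + j" x v] uv x i l
      by (simp add: v_def ac_simps)
    show ?thesis unfolding 2 3 using 1 lie_br_gcl[OF i l x(1) y(1)] x y c by (simp add: grQ_mult)
  qed
  ultimately show ?thesis using johnson_ext by (simp add: der_def)
qed

lemma johnson_hom:
  assumes j: "1 \<le> j"
  shows "johnson G j \<in> hom (AQ G j) (der_grp G j)"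
proof (rule homI)
  fix c assume "c \<in> carrier (AQ G j)"
  then show "johnson G j c \<in> carrier (der_grp G j)"
    using johnson_der j by (auto simp: carrier_AQ der_grp_def)
next
  fix c d assume "c \<in> carrier (AQ G j)" "d \<in> carrier (AQ G j)"
  then obtain s t where s: "s \<in> andr G j" "c = acl G j s" and t: "t \<in> andr G j" "d = acl G j t"
    by (auto simp: carrier_AQ)
  let ?r = "s \<otimes>\<^bsub>AutoGroup G\<^esub> t"
  have r: "?r \<in> andr G j" using subgroup.m_closed[OF andr_subgroup s(1) t(1)] .
  have a: "s \<in> auto G" "t \<in> auto G" using s t andr_auto by auto
  have "johnson G j (c \<otimes>\<^bsub>AQ G j\<^esub> d) = johnson G j (acl G j ?r)"
    using AQ_mult[OF a] s t by simp
  also have "\<dots> = johnson G j c \<otimes>\<^bsub>der_grp G j\<^esub> johnson G j d"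
  proof
    fix i
    show "johnson G j (acl G j ?r) i = (johnson G j c \<otimes>\<^bsub>der_grp G j\<^esub> johnson G j d) i"
    proof (cases "i = 0")
      case True then show ?thesis by (simp add: der_grp_def johnson_ext)
    next
      case False
      then have i: "1 \<le> i" by simp
      have "johnson G j (acl G j ?r) i b = johnson G j c i b \<otimes>\<^bsub>grQ G (i + j)\<^esub> johnson G j d i b"
        if "b \<in> carrier (grQ G i)" for b
      proof -
        obtain x where x: "x \<in> lcs G i" "b = gcl G i x"
          using \<open>b \<in> _\<close> by (auto simp: carrier_grQ)
        interpret s: group_hom G G s by (rule auto_hom[OF a(1)])
        interpret t: group_hom G G t by (rule auto_hom[OF a(2)])
        define u v where "u = s x \<otimes> inv x" and "v = t x \<otimes> inv x"
        have uv: "u \<in> lcs G (i + j)" "v \<in> lcs G (i + j)"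
          using andr_lcs[OF s(1) i x(1)] andr_lcs[OF t(1) i x(1)] by (auto simp: u_def v_def)
        have c: "x \<in> carrier G" "u \<in> carrier G" "v \<in> carrier G" using x uv by auto
        have e: "s x = u \<otimes> x" "t x = v \<otimes> x" using c by (simp_all add: u_def v_def m_assoc)
        \<comment> \<open>The weight i + 2j exceeds i + j since j \<ge> 1; this is what makes
          composition of automorphisms an addition of derivations.\<close>
        have sv: "s v \<otimes> inv v \<in> lcs G (Suc (i + j))"
          using lcs_le[OF andr_lcs[OF s(1) _ uv(2)]] i j by simp
        have "?r x \<otimes> inv x = (s v \<otimes> inv v) \<otimes> (v \<otimes> u)"
          using AutoGroup_mult[OF a c(1)] e(2) c by (simp add: m_assoc e(1))
        then have "gcl G (i + j) (?r x \<otimes> inv x) = gcl G (i + j) (v \<otimes> u)"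
          using gcl_mult_left[OF sv] c by simp
        also have "\<dots> = gcl G (i + j) (u \<otimes> v)" using gcl_commute uv c i by simp
        finally show ?thesis unfolding x s(2) t(2)
          using johnson_gcl[OF r j i x(1)] johnson_gcl[OF s(1) j i x(1)] johnson_gcl[OF t(1) j i x(1)] c
          by (simp add: u_def[symmetric] v_def[symmetric] grQ_mult)
      qed
      then show ?thesis
        using i johnson_ext(2)[OF i, of j "acl G j ?r"]
        by (intro extensionalityI[OF johnson_ext(2)[OF i]]) (auto simp: der_grp_def)
    qed
  qed
  finally show "johnson G j (c \<otimes>\<^bsub>AQ G j\<^esub> d) =
      johnson G j c \<otimes>\<^bsub>der_grp G j\<^esub> johnson G j d" .
qed

lemma johnson_inj:
  assumes j: "1 \<le> j"
  shows "inj_on (johnson G j) (carrier (AQ G j))"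
proof (rule inj_onI)
  fix c d assume "c \<in> carrier (AQ G j)" "d \<in> carrier (AQ G j)" and eq: "johnson G j c = johnson G j d"
  then obtain s t where s: "s \<in> andr G j" "c = acl G j s" and t: "t \<in> andr G j" "d = acl G j t"
    by (auto simp: carrier_AQ)
  have "gcl G (i + j) (s x \<otimes> inv x) =
      gcl G (i + j) (t x \<otimes> inv x)" if "1 \<le> i" "x \<in> lcs G i" for i x
    using johnson_gcl[OF s(1) j that] johnson_gcl[OF t(1) j that] eq s t by simp
  then show "c = d" unfolding s(2) t(2) using s(1) t(1) by (intro acl_eqI andr_auto)
qed

text \<open>An exact identity, from h (k x) = (h v) u x and k (h x) = (k u) v x. The outer factors
  become the bracket of the two derivations, and [v, u] will have higher weight.\<close>

lemma commutator_displacement: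
  assumes "h \<in> hom G G" "k \<in> hom G G" "x \<in> carrier G"
    and "u = h x \<otimes> inv x" "v = k x \<otimes> inv x"
  shows "h (k x) \<otimes> inv (k (h x)) =
      (h v \<otimes> inv v) \<otimes> comm G v u \<otimes> inv (k u \<otimes> inv u)"
proof -
  interpret h: group_hom G G h by unfold_locales fact
  interpret k: group_hom G G k by unfold_locales fact
  have c: "u \<in> carrier G" "v \<in> carrier G" using assms by simp_all
  have e: "h x = u \<otimes> x" "k x = v \<otimes> x" using assms by (simp_all add: m_assoc)
  show ?thesis
    unfolding e using c assms(3) by (simp add: e m_assoc inv_mult_group comm_def)
qed

text \<open>Comparing s t with t s evaluates the commutator at y = t (s x) and not at x. Every y has
  this form, with x in the same class because s and t act trivially on \<Gamma>_i/\<Gamma>_{i+1};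
  the displacements at x and y then have equal classes.\<close>

lemma andr_comm:
  assumes s: "s \<in> andr G j" and t: "t \<in> andr G k" and j: "1 \<le> j" and k: "1 \<le> k"
  shows "comm (AutoGroup G) s t \<in> andr G (j + k)"
    and "\<And>i x. 1 \<le> i \<Longrightarrow> x \<in> lcs G i \<Longrightarrow>
      gcl G (i + (j + k)) (comm (AutoGroup G) s t x \<otimes> inv x) =
      gcl G (i + (j + k)) ((s (t x \<otimes> inv x) \<otimes> inv (t x \<otimes> inv x)) \<otimes> inv (t (s x \<otimes> inv x) \<otimes> inv (s x \<otimes> inv x)))"
proof -
  interpret A: group "AutoGroup G" by (rule AutoGroup)
  have a: "s \<in> auto G" "t \<in> auto G" using s t andr_auto by auto
  interpret s: group_hom G G s by (rule auto_hom[OF a(1)])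
  interpret t: group_hom G G t by (rule auto_hom[OF a(2)])
  let ?k = "comm (AutoGroup G) s t"
  have ka: "?k \<in> auto G" using A.comm_closed[of s t] a by simp
  have "s \<otimes>\<^bsub>AutoGroup G\<^esub> t =
      ?k \<otimes>\<^bsub>AutoGroup G\<^esub> (t \<otimes>\<^bsub>AutoGroup G\<^esub> s)"
    using A.comm_mult[of s t] a by simp
  then have st: "s (t x) = ?k (t (s x))" if "x \<in> carrier G" for x
    using AutoGroup_mult[OF a that] AutoGroup_mult[OF a(2,1) that] A.m_closed[of t s] a
      AutoGroup_mult[OF ka _ that, of "t \<otimes>\<^bsub>AutoGroup G\<^esub> s"] by simp
  \<comment> \<open>The witness is w = [v, u], of weight 2i + j + k and hence negligible modulo
    \<Gamma>_{i+j+k+1}.\<close>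
  have main: "\<exists>w. ?k y \<otimes> inv y =
      (s (t x \<otimes> inv x) \<otimes> inv (t x \<otimes> inv x)) \<otimes> w \<otimes> inv (t (s x \<otimes> inv x) \<otimes> inv (s x \<otimes> inv x))
      \<and> w \<in> lcs G (Suc (i + (j + k)))
      \<and> s (t x \<otimes> inv x) \<otimes> inv (t x \<otimes> inv x) \<in> lcs G (i + (j + k))
      \<and> t (s x \<otimes> inv x) \<otimes> inv (s x \<otimes> inv x) \<in> lcs G (i + (j + k))"
    if i: "1 \<le> i" and x: "x \<in> lcs G i" and y: "y = t (s x)" for i x y
  proof -
    define u v where "u = s x \<otimes> inv x" and "v = t x \<otimes> inv x"
    have uv: "u \<in> lcs G (i + j)" "v \<in> lcs G (i + k)"
      using andr_lcs[OF s i x] andr_lcs[OF t i x] by (auto simp: u_def v_def)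
    have "?k y \<otimes> inv y = (s v \<otimes> inv v) \<otimes> comm G v u \<otimes> inv (t u \<otimes> inv u)"
      using commutator_displacement[OF s.homh t.homh lcs_carrier[OF x] u_def v_def] st[OF lcs_carrier[OF x]] y by simp
    moreover have "comm G v u \<in> lcs G (Suc (i + (j + k)))"
      using comm_lcs_ge[OF _ _ uv(2,1)] i by simp
    moreover have "s v \<otimes> inv v \<in> lcs G (i + (j + k))" "t u \<otimes> inv u \<in> lcs G (i + (j + k))"
      using andr_lcs[OF s _ uv(2)] andr_lcs[OF t _ uv(1)] i by (simp_all add: ac_simps)
    ultimately show ?thesis unfolding u_def v_def by blast
  qed
  have pre: "\<exists>x. x \<in> lcs G i \<and> y = t (s x) \<and> gcl G i x =
      gcl G i y" if i: "1 \<le> i" and y: "y \<in> lcs G i" for i y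
  proof -
    let ?s = "inv\<^bsub>AutoGroup G\<^esub> s" and ?t = "inv\<^bsub>AutoGroup G\<^esub> t"
    have at: "?t \<in> andr G k" "?s \<in> andr G j"
      using subgroup.m_inv_closed[OF andr_subgroup] s t by auto
    have 1: "?t y \<in> lcs G i" "?s (?t y) \<in> lcs G i" using auto_lcs[OF andr_auto] at y by auto
    have c: "y \<in> carrier G" "?t y \<in> carrier G" "?s (?t y) \<in> carrier G" using y 1 by auto
    have "?t y \<otimes> inv y \<in> lcs G (Suc i)" "?s (?t y) \<otimes> inv (?t y) \<in> lcs G (Suc i)"
      using lcs_le[OF andr_lcs[OF at(1) i y]] lcs_le[OF andr_lcs[OF at(2) i 1(1)]] j k by auto
    then have "gcl G i (?t y) = gcl G i y" "gcl G i (?s (?t y)) = gcl G i (?t y)"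
      using c by (simp_all add: gcl_eq_iff)
    then show ?thesis
      using 1 AutoGroup_inv(2)[OF a(2) c(1)] AutoGroup_inv(2)[OF a(1) c(2)] by (intro exI[of _ "?s (?t y)"]) simp
  qed
  have "?k y \<otimes> inv y \<in> lcs G (i + (j + k))" if i: "1 \<le> i" and y: "y \<in> lcs G i" for i y
  proof -
    obtain x where x: "x \<in> lcs G i" "y = t (s x)" using pre[OF i y] by auto
    obtain w where "?k y \<otimes> inv y =
        (s (t x \<otimes> inv x) \<otimes> inv (t x \<otimes> inv x)) \<otimes> w \<otimes> inv (t (s x \<otimes> inv x) \<otimes> inv (s x \<otimes> inv x))"
      "w \<in> lcs G (Suc (i + (j + k)))"
      "s (t x \<otimes> inv x) \<otimes> inv (t x \<otimes> inv x) \<in> lcs G (i + (j + k))"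
      "t (s x \<otimes> inv x) \<otimes> inv (s x \<otimes> inv x) \<in> lcs G (i + (j + k))"
      using main[OF i x] by blast
    moreover have "w \<in> lcs G (i + (j + k))"
      by (rule lcs_le[OF \<open>w \<in> _\<close>]) simp
    ultimately show ?thesis by (simp del: s.hom_mult t.hom_mult)
  qed
  then show kk: "?k \<in> andr G (j + k)" using ka by (simp add: andr_def)
  fix i y assume i: "1 \<le> i" and y: "y \<in> lcs G i"
  obtain x where x: "x \<in> lcs G i" "y = t (s x)" "gcl G i x = gcl G i y" using pre[OF i y] by auto
  obtain w where w: "?k y \<otimes> inv y =
      (s (t x \<otimes> inv x) \<otimes> inv (t x \<otimes> inv x)) \<otimes> w \<otimes> inv (t (s x \<otimes> inv x) \<otimes> inv (s x \<otimes> inv x))"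
      "w \<in> lcs G (Suc (i + (j + k)))"
      using main[OF i x(1,2)] by blast
  have c: "x \<in> carrier G" "y \<in> carrier G" "w \<in> carrier G" using x(1) y w(2) by auto
  have J: "gcl G (i + j) (s x \<otimes> inv x) = gcl G (i + j) (s y \<otimes> inv y)"
    "gcl G (i + k) (t x \<otimes> inv x) = gcl G (i + k) (t y \<otimes> inv y)"
    using johnson_gcl[OF s j i x(1)] johnson_gcl[OF s j i y] johnson_gcl[OF t k i x(1)] johnson_gcl[OF t k i y] x(3)
    by simp_all
  have "gcl G (i + j + k) (t (s x \<otimes> inv x) \<otimes> inv (s x \<otimes> inv x)) =
      gcl G (i + j + k) (t (s y \<otimes> inv y) \<otimes> inv (s y \<otimes> inv y))"
    using johnson_gcl[OF t k _ andr_lcs[OF s i x(1)]] johnson_gcl[OF t k _ andr_lcs[OF s i y]] J(1) i by simp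
  then have J2: "gcl G (i + (j + k)) (inv (t (s x \<otimes> inv x) \<otimes> inv (s x \<otimes> inv x))) =
      gcl G (i + (j + k)) (inv (t (s y \<otimes> inv y) \<otimes> inv (s y \<otimes> inv y)))"
    using grQ_inv[OF andr_lcs[OF t _ andr_lcs[OF s i x(1)]]] grQ_inv[OF andr_lcs[OF t _ andr_lcs[OF s i y]]] i
    by (simp add: ac_simps)
  have J1: "gcl G (i + (j + k)) (s (t x \<otimes> inv x) \<otimes> inv (t x \<otimes> inv x)) =
      gcl G (i + (j + k)) (s (t y \<otimes> inv y) \<otimes> inv (t y \<otimes> inv y))"
    using johnson_gcl[OF s j _ andr_lcs[OF t i x(1)]] johnson_gcl[OF s j _ andr_lcs[OF t i y]] J(2) i by (simp add: ac_simps)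
  have Jw: "gcl G (i + (j + k)) w = gcl G (i + (j + k)) \<one>" using w c by (simp add: gcl_eq_one_iff)
  have "gcl G (i + (j + k)) (?k y \<otimes> inv y) =
      gcl G (i + (j + k)) ((s (t y \<otimes> inv y) \<otimes> inv (t y \<otimes> inv y)) \<otimes> \<one> \<otimes> inv (t (s y \<otimes> inv y) \<otimes> inv (s y \<otimes> inv y)))"
    unfolding w(1) by (intro gcl_mult_cong J1 J2 Jw) (use c in simp_all)
  then show "gcl G (i + (j + k)) (?k y \<otimes> inv y) =
      gcl G (i + (j + k)) ((s (t y \<otimes> inv y) \<otimes> inv (t y \<otimes> inv y)) \<otimes> inv (t (s y \<otimes> inv y) \<otimes> inv (s y \<otimes> inv y)))"
    using c by simp
qed

lemma acl_some:
  assumes s: "s \<in> andr G j"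
  shows "(SOME t. t \<in> acl G j s) \<in> andr G j" "acl G j (SOME t. t \<in> acl G j s) = acl G j s"
proof -
  interpret A: group "AutoGroup G" by (rule AutoGroup)
  obtain r where r: "r \<in> andr G (Suc j)" "(SOME t. t \<in> acl G j s) = r \<otimes>\<^bsub>AutoGroup G\<^esub> s"
    using some_acl[OF s] .
  have rj: "r \<in> andr G j" using r(1) andr_Suc_subset by auto
  have c: "r \<in> carrier (AutoGroup G)" "s \<in> carrier (AutoGroup G)" using rj s andr_auto by simp_all
  show "(SOME t. t \<in> acl G j s) \<in> andr G j"
    unfolding r(2) by (rule subgroup.m_closed[OF andr_subgroup rj s])
  have "r \<otimes>\<^bsub>AutoGroup G\<^esub> s \<otimes>\<^bsub>AutoGroup G\<^esub> inv\<^bsub>AutoGroup G\<^esub> s = r"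
    using c A.m_assoc[OF c A.inv_closed[OF c(2)]] A.r_inv[OF c(2)] A.r_one[OF c(1)] by simp
  then have "acl G j (r \<otimes>\<^bsub>AutoGroup G\<^esub> s) = acl G j s"
    unfolding acl_def using A.rcos_eq_iff[OF andr_normal A.m_closed[OF c] c(2)] r(1) by simp
  then show "acl G j (SOME t. t \<in> acl G j s) = acl G j s" unfolding r(2) .
qed

lemma johnson_comm:
  assumes j: "1 \<le> j" and k: "1 \<le> k" and "c \<in> carrier (AQ G j)" "d \<in> carrier (AQ G k)"
  shows "johnson G (j + k) (aut_br G j k c d) = der_br G j k (johnson G j c) (johnson G k d)"
proof -
  \<comment> \<open>These are the representatives chosen inside \<open>aut_br\<close>, so its
    commutator is literally [s, t]; \<open>acl_some\<close> says that they still represent c and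
    d.\<close>
  define s t where "s = (SOME s. s \<in> c)" and "t = (SOME t. t \<in> d)"
  have s: "s \<in> andr G j" "c = acl G j s" and t: "t \<in> andr G k" "d = acl G k t"
    using assms(3,4) acl_some unfolding s_def t_def by (auto simp: carrier_AQ)
  let ?k = "comm (AutoGroup G) s t"
  have br: "aut_br G j k c d = acl G (j + k) ?k"
    unfolding aut_br_def acl_def s_def t_def ..
  note ac = andr_comm[OF s(1) t(1) j k]
  have jk: "1 \<le> j + k" using j by simp
  show ?thesis
  proof
    fix i
    show "johnson G (j + k) (aut_br G j k c d) i = der_br G j k (johnson G j c) (johnson G k d) i"
    proof (cases "i = 0")
      case True then show ?thesis by (simp add: der_br_def johnson_ext)
    next
      case False
      then have i: "1 \<le> i" by simp
      have "johnson G (j + k) (acl G (j + k) ?k) i a = der_br G j k (johnson G j c) (johnson G k d) i a"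
        if a: "a \<in> carrier (grQ G i)" for a
      proof -
        obtain x where x: "x \<in> lcs G i" "a = gcl G i x" using a by (auto simp: carrier_grQ)
        define u v where "u = s x \<otimes> inv x" and "v = t x \<otimes> inv x"
        have uv: "u \<in> lcs G (i + j)" "v \<in> lcs G (i + k)"
          using andr_lcs[OF s(1) i x(1)] andr_lcs[OF t(1) i x(1)] by (auto simp: u_def v_def)
        have m: "s v \<otimes> inv v \<in> lcs G (i + j + k)" "t u \<otimes> inv u \<in> lcs G (i + j + k)"
          using andr_lcs[OF s(1) _ uv(2)] andr_lcs[OF t(1) _ uv(1)] i by (simp_all add: ac_simps)
        have jd: "johnson G k d i a = gcl G (i + k) v" "johnson G j c i a = gcl G (i + j) u"
          "johnson G j c (i + k) (gcl G (i + k) v) = gcl G (i + j + k) (s v \<otimes> inv v)"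
          "johnson G k d (i + j) (gcl G (i + j) u) = gcl G (i + j + k) (t u \<otimes> inv u)"
          unfolding s(2) t(2) x(2) u_def v_def
          using johnson_gcl[OF t(1) k i x(1)] johnson_gcl[OF s(1) j i x(1)]
            johnson_gcl[OF s(1) j _ uv(2)] johnson_gcl[OF t(1) k _ uv(1)] i
          by (simp_all add: u_def v_def ac_simps)
        have "johnson G (j + k) (acl G (j + k) ?k) i a =
            gcl G (i + j + k) ((s v \<otimes> inv v) \<otimes> inv (t u \<otimes> inv u))"
          unfolding x(2) u_def v_def using johnson_gcl[OF ac(1) jk i x(1)] ac(2)[OF i x(1)] by (simp add: add.assoc)
        then show ?thesis
          using a i m unfolding der_br_def by (simp add: jd grQ_inv grQ_mult lcs_carrier)
      qed
      then show ?thesis unfolding br using i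
        by (intro extensionalityI[OF johnson_ext(2)[OF i]]) (auto simp: der_br_def)
    qed
  qed
qed

end

section \<open>The reduced Magnus ring\<close>

text \<open>Non-commutative power series modulo the monomials with a repeated letter, encoded by their
  coefficient functions on words.\<close>

typedef magnus = "{f :: nat list \<Rightarrow> int. \<forall>w. \<not> distinct w \<longrightarrow> f w = 0}"
  morphisms coef Magnus
  by (rule exI[of _ "\<lambda>_. 0"]) simp

setup_lifting type_definition_magnus

lemma coef_not_distinct [simp]: "\<not> distinct w \<Longrightarrow> coef f w = 0"
  using coef by auto

lemma magnus_eqI: "(\<And>w. distinct w \<Longrightarrow> coef f w = coef g w) \<Longrightarrow> f = g"
  by (metis coef_inject coef_not_distinct ext)

text \<open>The Cauchy product over all splittings w = u @ v, organised by recursion on the first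
  letter so that the ring laws follow by induction on w with the left factor arbitrary.\<close>

fun conv :: "(nat list \<Rightarrow> int) \<Rightarrow> (nat list \<Rightarrow> int) \<Rightarrow> nat list \<Rightarrow> int" where
  "conv f g [] = f [] * g []"
| "conv f g (a # w) = f [] * g (a # w) + conv (\<lambda>v. f (a # v)) g w"

lemma conv_add_left: "conv (\<lambda>v. f v + g v) h w = conv f h w + conv g h w"
  by (induction w arbitrary: f g) (simp_all add: algebra_simps)

lemma conv_add_right: "conv h (\<lambda>v. f v + g v) w = conv h f w + conv h g w"
  by (induction w arbitrary: h) (simp_all add: algebra_simps)

lemma conv_scale_left: "conv (\<lambda>v. c * f v) h w = c * conv f h w"
  by (induction w arbitrary: f) (simp_all add: algebra_simps)

lemma conv_assoc: "conv (conv f g) h w = conv f (conv g h) w"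
proof (induction w arbitrary: f)
  case (Cons a w)
  have "conv (\<lambda>v. conv f g (a # v)) h w =
      f [] * conv (\<lambda>v. g (a # v)) h w + conv (conv (\<lambda>v. f (a # v)) g) h w"
    by (simp add: conv_add_left conv_scale_left)
  then show ?case by (simp add: Cons algebra_simps)
qed simp

lemma conv_cong:
  "(\<And>u v. w = u @ v \<Longrightarrow> f u * g v = f' u * g' v) \<Longrightarrow> conv f g w = conv f' g' w"
proof (induction w arbitrary: f f')
  case Nil
  then show ?case by simp
next
  case (Cons a w)
  have "f [] * g (a # w) = f' [] * g' (a # w)" using Cons.prems[of "[]" "a # w"] by simp
  moreover have "conv (\<lambda>v. f (a # v)) g w = conv (\<lambda>v. f' (a # v)) g' w"
    by (rule Cons.IH) (use Cons.prems in simp)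
  ultimately show ?case by simp
qed

lemma conv_zero: "conv (\<lambda>_. 0) g w = 0"
  by (induction w) simp_all

lemma conv_eq_zero: "(\<And>u v. w = u @ v \<Longrightarrow> f u * g v = 0) \<Longrightarrow> conv f g w = 0"
  using conv_cong[of w f g "\<lambda>_. 0" g] conv_zero by simp

text \<open>Evaluates products in which a single splitting contributes, such as those with 1 or with
  one variable.\<close>

lemma conv_split:
  assumes "\<And>u v. w @ w' = u @ v \<Longrightarrow> u \<noteq> w \<Longrightarrow> f u * g v = 0"
  shows "conv f g (w @ w') = f w * g w'"
  using assms
proof (induction w arbitrary: f)
  case Nil
  show ?case
  proof (cases w')
    case (Cons a v)
    have "conv (\<lambda>v. f (a # v)) g v = 0" by (rule conv_eq_zero) (use Nil[of "a # _"] Cons in simp)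
    then show ?thesis using Cons by simp
  qed simp
next
  case (Cons a w)
  have "f [] * g (a # w @ w') = 0" using Cons.prems[of "[]"] by simp
  moreover have "conv (\<lambda>v. f (a # v)) g (w @ w') = f (a # w) * g w'"
    by (rule Cons.IH) (use Cons.prems[of "a # _"] in simp)
  ultimately show ?case by simp
qed

instantiation magnus :: ring_1
begin

lift_definition zero_magnus :: magnus is "\<lambda>_. 0" by simp
lift_definition one_magnus :: magnus is "\<lambda>w. if w = [] then 1 else 0" by auto
lift_definition plus_magnus :: "magnus \<Rightarrow> magnus \<Rightarrow> magnus" is "\<lambda>f g w. f w + g w"
  by simp
lift_definition minus_magnus :: "magnus \<Rightarrow> magnus \<Rightarrow> magnus" is "\<lambda>f g w. f w - g w"
  by simp
lift_definition uminus_magnus :: "magnus \<Rightarrow> magnus" is "\<lambda>f w. - f w" by simp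
lift_definition times_magnus :: "magnus \<Rightarrow> magnus \<Rightarrow> magnus" is
  "\<lambda>f g w. if distinct w then conv f g w else 0" by simp

instance
proof
  fix a b c :: magnus
  show "a + b + c = a + (b + c)" by transfer (simp add: algebra_simps)
  show "a + b = b + a" by transfer (simp add: algebra_simps)
  show "0 + a = a" by transfer simp
  show "- a + a = 0" by transfer simp
  show "a - b = a + - b" by transfer simp
  show "a * b * c = a * (b * c)"
  proof transfer
    fix a b c :: "nat list \<Rightarrow> int"
    \<comment> \<open>Truncating to distinct words does not disturb associativity, because every
      factor of a distinct word is distinct.\<close>
    have "conv (\<lambda>w. if distinct w then conv a b w else 0) c w = conv (conv a b) c w"
      "conv a (\<lambda>w. if distinct w then conv b c w else 0) w = conv a (conv b c) w" if "distinct w" for w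
      using that by (auto intro!: conv_cong)
    then show "(\<lambda>w. if distinct w then conv (\<lambda>w. if distinct w then conv a b w else 0) c w else 0) =
      (\<lambda>w. if distinct w then conv a (\<lambda>w. if distinct w then conv b c w else 0) w else 0)"
      by (auto simp: conv_assoc)
  qed
  show "(a + b) * c = a * c + b * c" by transfer (auto simp: conv_add_left)
  show "a * (b + c) = a * b + a * c" by transfer (auto simp: conv_add_right)
  show "1 * a = a"
  proof transfer
    fix a :: "nat list \<Rightarrow> int" assume "\<forall>w. \<not> distinct w \<longrightarrow> a w = 0"
    moreover have "conv (\<lambda>w. if w = [] then 1 else 0) a w = a w" for w
      using conv_split[of "[]" w "\<lambda>w. if w = [] then 1 else 0" a] by simp
    ultimately show "(\<lambda>w. if distinct w then conv (\<lambda>w. if w = [] then 1 else 0) a w else 0) = a"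
      by auto
  qed
  show "a * 1 = a"
  proof transfer
    fix a :: "nat list \<Rightarrow> int" assume "\<forall>w. \<not> distinct w \<longrightarrow> a w = 0"
    moreover have "conv a (\<lambda>w. if w = [] then 1 else 0) w = a w" for w
      using conv_split[of w "[]" a "\<lambda>w. if w = [] then 1 else 0"] by simp
    ultimately show "(\<lambda>w. if distinct w then conv a (\<lambda>w. if w = [] then 1 else 0) w else 0) = a"
      by auto
  qed
  show "(0::magnus) \<noteq> 1" by transfer (metis zero_neq_one)
qed

end

lemma coef_simps [simp]:
  "coef 0 w = 0" "coef (f + g) w = coef f w + coef g w" "coef (f - g) w = coef f w - coef g w"
  "coef (- f) w = - coef f w"
  by (transfer; simp)+

lemma coef_one: "coef 1 w = (if w = [] then 1 else 0)"
  by transfer simp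

lemma coef_times: "distinct w \<Longrightarrow> coef (f * g) w = conv (coef f) (coef g) w"
  by transfer simp

lift_definition mvar :: "nat \<Rightarrow> magnus" is "\<lambda>i w. if w = [i] then 1 else 0" by auto

lemma coef_mvar: "coef (mvar i) w = (if w = [i] then 1 else 0)"
  by transfer simp

lemma coef_times_eq_zero:
  assumes "\<And>u v. w = u @ v \<Longrightarrow> coef f u * coef g v = 0"
  shows "coef (f * g) w = 0"
  by (cases "distinct w") (use assms in \<open>auto simp: coef_times intro: conv_eq_zero\<close>)

lemma coef_mvar_times_Cons:
  "distinct (a # w) \<Longrightarrow> coef (mvar i * f) (a # w) = (if a = i then coef f w else 0)"
proof -
  assume d: "distinct (a # w)"
  have "conv (coef (mvar i)) (coef f) ([a] @ w) = coef (mvar i) [a] * coef f w"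
    by (rule conv_split) (auto simp: coef_mvar)
  then show ?thesis using d by (simp add: coef_times coef_mvar)
qed

lemma coef_times_mvar_snoc:
  "distinct (w @ [a]) \<Longrightarrow> coef (f * mvar i) (w @ [a]) = (if a = i then coef f w else 0)"
proof -
  assume d: "distinct (w @ [a])"
  have "conv (coef f) (coef (mvar i)) (w @ [a]) = coef f w * coef (mvar i) [a]"
    by (rule conv_split) (auto simp: coef_mvar)
  then show ?thesis using d by (simp add: coef_times coef_mvar)
qed

lemma coef_mvar_Nil [simp]: "coef (mvar i * f) [] = 0" "coef (f * mvar i) [] = 0"
  by (simp_all add: coef_times coef_mvar)

text \<open>Every monomial of X_i f X_i repeats the letter i. This is the ring form of the relation
  that x_i commutes with its conjugates.\<close>

lemma mvar_sandwich: "mvar i * f * mvar i = 0"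
proof (rule magnus_eqI)
  fix w :: "nat list" assume d: "distinct w"
  show "coef (mvar i * f * mvar i) w = coef 0 w"
  proof (cases w rule: rev_cases)
    case (snoc v a)
    show ?thesis
    proof (cases v)
      case Nil
      then show ?thesis using d snoc coef_times_mvar_snoc[of v a "mvar i * f" i] by simp
    next
      case (Cons b u)
      then show ?thesis using d snoc coef_times_mvar_snoc[of v a "mvar i * f" i]
        by (auto simp: coef_mvar_times_Cons)
    qed
  qed simp
qed

lemma mvar_square: "mvar i * mvar i = 0"
  using mvar_sandwich[of i 1] by simp

definition deg_ge :: "nat \<Rightarrow> magnus \<Rightarrow> bool" where
  "deg_ge m f \<longleftrightarrow> (\<forall>w. length w < m \<longrightarrow> coef f w = 0)"

lemma deg_ge_simps [simp, intro]:
  "deg_ge m 0" "deg_ge m f \<Longrightarrow> deg_ge m g \<Longrightarrow> deg_ge m (f + g)"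
  "deg_ge m f \<Longrightarrow> deg_ge m g \<Longrightarrow> deg_ge m (f - g)" "deg_ge m f \<Longrightarrow> deg_ge m (- f)"
  by (simp_all add: deg_ge_def)

lemma deg_ge_0 [simp]: "deg_ge 0 f" by (simp add: deg_ge_def)

lemma deg_ge_mono: "deg_ge m f \<Longrightarrow> k \<le> m \<Longrightarrow> deg_ge k f"
  by (simp add: deg_ge_def)

lemma deg_ge_mvar [simp]: "deg_ge (Suc 0) (mvar i)"
  by (auto simp: deg_ge_def coef_mvar)

lemma deg_ge_times:
  assumes "deg_ge i f" "deg_ge j g"
  shows "deg_ge (i + j) (f * g)"
  unfolding deg_ge_def
proof (intro allI impI)
  fix w :: "nat list" assume w: "length w < i + j"
  show "coef (f * g) w = 0"
  proof (rule coef_times_eq_zero)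
    fix u v assume "w = u @ v"
    then have "length u < i \<or> length v < j" using w by auto
    then show "coef f u * coef g v = 0" using assms by (auto simp: deg_ge_def)
  qed
qed

text \<open>The reason is the identity \<open>f g f' g' - 1 = (f g - g f) f' g'\<close>.\<close>

lemma commutator_leading_term:
  assumes "1 \<le> i" "1 \<le> j" "deg_ge i (f - 1)" "deg_ge j (g - 1)"
    and inv: "f * f' = 1" "g * g' = 1" "f' * f = 1" "g' * g = 1"
  shows "deg_ge (Suc (i + j)) (f * g * f' * g' - 1 - ((f - 1) * (g - 1) - (g - 1) * (f - 1)))"
proof -
  have g: "g * (f * (f' * g')) = 1"
    using inv by (metis mult.assoc mult_1)
  have c: "(f - 1) * (g - 1) - (g - 1) * (f - 1) = f * g - g * f" by (simp add: algebra_simps)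
  have d: "deg_ge (i + j) (f * g - g * f)"
    using deg_ge_times[OF assms(3,4)] deg_ge_times[OF assms(4,3)] unfolding c[symmetric]
    by (simp add: add.commute)
  have f': "deg_ge 1 (f' - 1)" if "1 \<le> i" "deg_ge i (f - 1)" "f * f' = 1" for f f' :: magnus and i
  proof -
    have "f' - 1 = - ((f - 1) * f')" using that by (simp add: algebra_simps)
    moreover have "deg_ge (i + 0) ((f - 1) * f')" by (rule deg_ge_times) (use that in auto)
    ultimately show ?thesis using deg_ge_mono[of "i + 0" _ 1] that by simp
  qed
  have "f' * g' - 1 = (f' - 1) * g' + (g' - 1)" by (simp add: algebra_simps)
  moreover have "deg_ge (1 + 0) ((f' - 1) * g')"
    by (rule deg_ge_times) (use f'[OF assms(1,3) inv(1)] in auto)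
  ultimately have "deg_ge 1 (f' * g' - 1)"
    using deg_ge_simps(2)[OF _ f'[OF assms(2,4) inv(2)], of "(f' - 1) * g'"]
    by (simp add: add_diff_eq)
  \<comment> \<open>The error is the product of f g - g f with f' g' - 1, and the latter has no
    constant term.\<close>
  then have "deg_ge (i + j + 1) ((f * g - g * f) * (f' * g' - 1))"
    using d deg_ge_times by blast
  moreover have "f * g * f' * g' - 1 - ((f - 1) * (g - 1) - (g - 1) * (f - 1)) = (f * g - g * f) * (f' * g' - 1)"
    unfolding c using g by (simp add: algebra_simps)
  ultimately show ?thesis by simp
qed

section \<open>Homomorphisms close to the identity\<close>

context group
begin

text \<open>Modulo N, the elements on which h agrees with the identity form a subgroup.\<close>

lemma hom_displacement_generate:
  assumes N: "N \<lhd> G" and h: "h \<in> hom G G" and S: "S \<subseteq> carrier G"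
    and "\<And>s. s \<in> S \<Longrightarrow> h s \<otimes> inv s \<in> N" and "g \<in> generate G S"
  shows "h g \<otimes> inv g \<in> N"
proof -
  interpret N: normal N G by fact
  interpret h: group_hom G G h by unfold_locales fact
  show ?thesis using assms(5)
  proof (induction rule: generate.induct)
    case one then show ?case by simp
  next
    case (incl s) then show ?case using assms(4) by simp
  next
    case (inv s)
    then have s: "s \<in> carrier G" using S by auto
    have "inv (h s) \<otimes> inv (h s \<otimes> inv s) \<otimes> inv (inv (h s)) \<in> N"
      using N.inv_op_closed2[of "inv (h s)" "inv (h s \<otimes> inv s)"] assms(4)[OF inv] s by simp
    then show ?case using s by (simp add: m_assoc inv_mult_group)
  next
    case (eng a b)
    then have c: "a \<in> carrier G" "b \<in> carrier G" using generate_in_carrier[OF S] by auto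
    have "h a \<otimes> (h b \<otimes> inv b) \<otimes> inv (h a) \<otimes> (h a \<otimes> inv a) \<in> N"
      using N.inv_op_closed2[of "h a" "h b \<otimes> inv b"] eng c by simp
    then show ?case using c by (simp add: m_assoc inv_mult_group)
  qed
qed

text \<open>Makes membership in the Andreadakis filtration a condition on generators: it spreads
  over G in degree 1, and the Leibniz rule raises the degree. Only an endomorphism is required,
  since bijectivity is deduced from the conclusion.\<close>

lemma hom_displacement_lcs:
  assumes h: "h \<in> hom G G" and S: "S \<subseteq> carrier G" "generate G S = carrier G" and j: "1 \<le> j"
    and disp: "\<And>s. s \<in> S \<Longrightarrow> h s \<otimes> inv s \<in> lcs G (1 + j)"
    and "1 \<le> i" "g \<in> lcs G i"
  shows "h g \<otimes> inv g \<in> lcs G (i + j)"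
proof -
  interpret h: group_hom G G h by unfold_locales fact
  have d1: "h g \<otimes> inv g \<in> lcs G (1 + j)" if "g \<in> carrier G" for g
    by (rule hom_displacement_generate[OF lcs_normal h S(1) disp]) (use that S in auto)
  have "\<forall>g\<in>lcs G i. h g \<otimes> inv g \<in> lcs G (i + j)" using \<open>1 \<le> i\<close>
  proof (induction i rule: nat_induct_at_least)
    case base
    then show ?case using d1 by auto
  next
    case (Suc i)
    let ?T = "{comm G x y | x y. x \<in> carrier G \<and> y \<in> lcs G i}"
    have "h s \<otimes> inv s \<in> lcs G (Suc i + j)" if "s \<in> ?T" for s
    proof -
      obtain x y where s: "s = comm G x y" and x: "x \<in> lcs G 1" and y: "y \<in> lcs G i"
        using \<open>s \<in> ?T\<close> by auto
      define u v where "u = h x \<otimes> inv x" and "v = h y \<otimes> inv y"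
      have uv: "u \<in> lcs G (1 + j)" "v \<in> lcs G (i + j)"
        unfolding u_def v_def using d1 x Suc.IH y by auto
      have c: "x \<in> carrier G" "y \<in> carrier G" "u \<in> carrier G" "v \<in> carrier G"
        using x y uv by auto
      have e: "h x = u \<otimes> x" "h y = v \<otimes> y" using c by (simp_all add: u_def v_def m_assoc)
      have "h s = comm G (u \<otimes> x) (v \<otimes> y)"
        unfolding s using hom_comm[OF is_group h c(1,2)] e by simp
      then have "gcl G (1 + i + j) (h s \<otimes> inv s) = gcl G (1 + i + j) (comm G u y \<otimes> comm G x v)"
        using gcl_comm_displacement[OF _ Suc.hyps j x y uv] s by simp
      then have "h s \<otimes> inv s \<otimes> inv (comm G u y \<otimes> comm G x v) \<in> lcs G (Suc (1 + i + j))"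
        using c s by (subst (asm) gcl_eq_iff) auto
      then have 1: "h s \<otimes> inv s \<otimes> inv (comm G u y \<otimes> comm G x v) \<in> lcs G (Suc i + j)"
        by (rule lcs_le) simp
      have 2: "comm G u y \<otimes> comm G x v \<in> lcs G (Suc i + j)"
        using comm_lcs[OF _ _ uv(1) y] comm_lcs[OF _ _ x uv(2)] Suc.hyps by (simp add: ac_simps)
      show ?thesis using lcs_closed(2)[OF 1 2] c s by (simp add: m_assoc)
    qed
    moreover have "?T \<subseteq> carrier G" by auto
    ultimately show ?case
      using hom_displacement_generate[OF lcs_normal h, of ?T "Suc i + j"] lcs_Suc[OF Suc.hyps] by simp
  qed
  then show ?thesis using assms by blast
qed

text \<open>If h g = 1, the displacement of g is g^-1, so g descends through all \<Gamma>_i. For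
  surjectivity g = (h g g^-1)^-1 (h g), where the first factor is an image by descending induction
  from \<Gamma>_{n+1} = 1.\<close>

lemma hom_bij_if_displacement:
  assumes h: "h \<in> hom G G" and j: "1 \<le> j"
    and disp: "\<And>i g. 1 \<le> i \<Longrightarrow> g \<in> lcs G i \<Longrightarrow> h g \<otimes> inv g \<in>
        lcs G (i + j)"
    and nil: "lcs G (Suc n) = {\<one>}"
  shows "bij_betw h (carrier G) (carrier G)"
proof -
  interpret h: group_hom G G h by unfold_locales fact
  have disp1: "h g \<otimes> inv g \<in> lcs G (Suc i)" if "1 \<le> i" "g \<in> lcs G i" for i g
    by (rule lcs_le[OF disp[OF that]]) (use j in simp)
  have ker: "g \<in> lcs G (Suc i)" if "g \<in> carrier G" "h g = \<one>" for g i
  proof (induction i)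
    case 0 then show ?case using that by simp
  next
    case (Suc i)
    have "inv (h g \<otimes> inv g) \<in> lcs G (Suc (Suc i))" using disp1[OF _ Suc] by simp
    then show ?case using that by simp
  qed
  have inj: "inj_on h (carrier G)"
    unfolding h.inj_on_one_iff using ker[of _ n] nil by simp
  have sub: "subgroup (h ` carrier G) G" by (rule h.img_is_subgroup)
  have surj: "\<forall>g\<in>lcs G (Suc (n - i)). g \<in> h ` carrier G" if "i \<le> n" for i
    using that
  proof (induction i)
    case 0
    then show ?case using nil subgroup.one_closed[OF sub] by simp
  next
    case (Suc i)
    show ?case
    proof
      fix g assume g: "g \<in> lcs G (Suc (n - Suc i))"
      then have gc: "g \<in> carrier G" by auto
      have "h g \<otimes> inv g \<in> lcs G (Suc (n - i))"
        using disp1[OF _ g] Suc.prems by (simp add: Suc_diff_Suc)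
      then have "h g \<otimes> inv g \<in> h ` carrier G" using Suc by simp
      then have "inv (h g \<otimes> inv g) \<otimes> h g \<in> h ` carrier G"
        by (rule subgroup.m_closed[OF sub subgroup.m_inv_closed[OF sub]]) (use gc in simp)
      then show "g \<in> h ` carrier G" using gc by (simp add: inv_mult_group m_assoc)
    qed
  qed
  have "h ` carrier G = carrier G" using surj[of n] by auto
  then show ?thesis using inj by (simp add: bij_betw_def)
qed

text \<open>\<Gamma>_k/\<Gamma>_{k+1} is central in G/\<Gamma>_{k+1}. Spans formed in one degree can
  therefore serve as the normal subgroup in \<open>comm_generate_subset\<close>.\<close>

lemma normal_between_lcs:
  assumes "subgroup H G" "1 \<le> k" "lcs G (Suc k) \<subseteq> H" "H \<subseteq> lcs G k"
  shows "H \<lhd> G"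
proof -
  interpret H: subgroup H G by fact
  have "g \<otimes> h \<otimes> inv g \<in> H" if "g \<in> carrier G" "h \<in> H" for g h
    using comm_lcs_Suc[OF assms(2) that(1), of h] assms(3,4) that conj_eq_comm[of g h] by auto
  then show ?thesis by (intro normal_invI[OF assms(1)])
qed

end

section \<open>Groups generated by elements commuting with their conjugates\<close>

text \<open>The interface to \<open>RF n\<close>: generators, relations, the universal property with
  G itself as target, and a multiplicative map to the Magnus ring. Injectivity of \<open>mu\<close>
  is not among the data; its substitute, that leading coefficients detect classes, is derived degree
  by degree.\<close>

locale reduced_magnus = group G for G (structure) +
  fixes n :: nat and x :: "nat \<Rightarrow> 'a" and mu :: "'a \<Rightarrow> magnus"
  assumes x_closed [intro, simp]: "i < n \<Longrightarrow> x i \<in> carrier G"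
    and generated: "generate G (x ` {..<n}) = carrier G"
    and reduced: "i < n \<Longrightarrow> g \<in> carrier G \<Longrightarrow> comm G (x i) (g \<otimes>
        x i \<otimes> inv g) = \<one>"
    and extend: "\<And>y. (\<And>i. i < n \<Longrightarrow> y i \<in> carrier G) \<Longrightarrow>
      (\<And>i g. i < n \<Longrightarrow> g \<in> carrier G \<Longrightarrow> comm G (y i) (g \<otimes> y i \<otimes> inv g) = \<one>) \<Longrightarrow>
      \<exists>h\<in>hom G G. \<forall>i<n. h (x i) = y i"
    and mu_mult: "g \<in> carrier G \<Longrightarrow> h \<in> carrier G \<Longrightarrow> mu (g \<otimes> h) =
        mu g * mu h"
    and mu_one [simp]: "mu \<one> = 1"
    and mu_gen: "i < n \<Longrightarrow> mu (x i) = 1 + mvar i"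
begin

definition Ncl :: "nat \<Rightarrow> 'a set" where
  "Ncl i = normal_closure G {x i}"

lemma Ncl_normal: "i < n \<Longrightarrow> Ncl i \<lhd> G"
  unfolding Ncl_def by (rule normal_closure_normal) simp

lemma Ncl_abelian:
  assumes i: "i < n" and "a \<in> Ncl i" "b \<in> Ncl i"
  shows "comm G a b = \<one>"
proof -
  let ?S = "\<Union>g\<in>carrier G. (\<lambda>s. g \<otimes> s \<otimes> inv g) ` {x i}"
  have S: "?S \<subseteq> carrier G" using i by auto
  have *: "comm G s t \<in> {\<one>}" if st: "s \<in> ?S" "t \<in> ?S" for s t
  proof -
    obtain g h where gh: "g \<in> carrier G" "s = g \<otimes> x i \<otimes> inv g" "h \<in> carrier G" "t =
        h \<otimes> x i \<otimes> inv h"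
      using st by auto
    \<comment> \<open>Conjugating back by g turns the commutator of two conjugates into
      [x_i, k x_i k^-1].\<close>
    define k where "k = inv g \<otimes> h"
    have k: "k \<in> carrier G" "h = g \<otimes> k" using gh by (simp_all add: k_def m_assoc[symmetric])
    have "comm G s t = g \<otimes> comm G (x i) (k \<otimes> x i \<otimes> inv k) \<otimes> inv g"
      unfolding gh(2,4) k(2) using gh(1) k(1) i by (simp add: comm_def m_assoc inv_mult_group)
    then show ?thesis using reduced[OF i k(1)] gh(1) by simp
  qed
  have "{\<one>} \<lhd> G" by (rule one_is_normal)
  then have "comm G a b \<in> {\<one>}"
    by (rule comm_generate_subset[OF _ S S *]) (use assms in \<open>auto simp: Ncl_def normal_closure_def\<close>)
  then show ?thesis by simp
qed

lemma x_in_Ncl: "i < n \<Longrightarrow> x i \<in> Ncl i"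
  unfolding Ncl_def using normal_closure_incl[of "{x i}"] by simp

text \<open>The weight-\<open>m\<close> subgroup generated by the intersections of \<open>m\<close> distinct \<open>Ncl i\<close> contains the
  \<open>m\<close>-th term of the lower central series, because each \<open>Ncl i\<close> is abelian.\<close>

lemma lcs_nilpotent: "lcs G (Suc n) = {\<one>}"
proof -
  define W where "W m = {a \<in> carrier G. \<exists>S\<subseteq>{..<n}. card S =
      m \<and> (\<forall>i\<in>S. a \<in> Ncl i)}" for m
  have Wc: "W m \<subseteq> carrier G" for m by (auto simp: W_def)
  have Wn: "generate G (W m) \<lhd> G" for m
  proof (rule normal_generateI[OF Wc])
    fix h g assume "h \<in> W m" and g: "g \<in> carrier G"
    then obtain S where S: "S \<subseteq> {..<n}" "card S =
        m" "\<forall>i\<in>S. h \<in> Ncl i" and h: "h \<in> carrier G"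
      by (auto simp: W_def)
    have "\<forall>i\<in>S. g \<otimes> h \<otimes> inv g \<in> Ncl i"
      using S g normal.inv_op_closed2[OF Ncl_normal, of _ g h] by auto
    then show "g \<otimes> h \<otimes> inv g \<in> W m" using S h g by (auto simp: W_def)
  qed
  have "lcs G m \<subseteq> generate G (W m)" if "1 \<le> m" for m
    using that
  proof (induction m rule: nat_induct_at_least)
    case base
    have "x ` {..<n} \<subseteq> W 1"
    proof
      fix a assume "a \<in> x ` {..<n}"
      then obtain i where i: "i < n" "a = x i" by auto
      then have "{i} \<subseteq> {..<n}" "card {i} = 1" "\<forall>k\<in>{i}. a \<in> Ncl k"
        using x_in_Ncl by auto
      then show "a \<in> W 1" using i unfolding W_def by blast
    qed
    then show ?case using mono_generate[of "x ` {..<n}" "W 1"] generated by simp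
  next
    case (Suc m)
    have *: "comm G a b \<in> generate G (W (Suc m))" if ab: "a \<in> x ` {..<n}" "b \<in> W m" for a b
    proof -
      obtain i where i: "i < n" "a = x i" using ab by auto
      obtain S where S: "S \<subseteq> {..<n}" "card S = m" "\<forall>i\<in>S. b \<in> Ncl i" and b: "b \<in> carrier G"
        using ab by (auto simp: W_def)
      show ?thesis
      proof (cases "i \<in> S")
        case True
        then show ?thesis using Ncl_abelian[OF i(1) x_in_Ncl[OF i(1)], of b] S i generate.one by simp
      next
        case False
        have "finite S" using S(1) finite_subset by blast
        then have 1: "insert i S \<subseteq> {..<n}" "card (insert i S) = Suc m" using S i False by auto
        have 2: "\<forall>k\<in>insert i S. comm G a b \<in> Ncl k"
          using comm_normal(2)[OF Ncl_normal[OF i(1)] b x_in_Ncl[OF i(1)]]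
            comm_normal(1)[OF Ncl_normal x_closed[OF i(1)], of _ b] S i(2) by auto
        have "comm G a b \<in> W (Suc m)"
          unfolding W_def using 1 2 i b by blast
        then show ?thesis by (rule generate.incl)
      qed
    qed
    have "{comm G a b | a b. a \<in> carrier G \<and> b \<in> lcs G m} \<subseteq> generate G (W (Suc m))"
    proof
      fix c assume "c \<in> {comm G a b | a b. a \<in> carrier G \<and> b \<in> lcs G m}"
      then obtain a b where c: "c = comm G a b" "a \<in> carrier G" "b \<in> lcs G m" by blast
      have a: "a \<in> generate G (x ` {..<n})" and b: "b \<in> generate G (W m)"
        using c generated Suc.IH by auto
      show "c \<in> generate G (W (Suc m))" unfolding c(1)
        by (rule comm_generate_subset[OF Wn _ Wc * a b]) auto
    qed
    then show ?case unfolding lcs_Suc[OF Suc.hyps]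
      by (rule generate_subgroup_incl[OF _ normal_imp_subgroup[OF Wn]])
  qed
  then have "lcs G (Suc n) \<subseteq> generate G (W (Suc n))" by simp
  moreover have "W (Suc n) = {}"
  proof -
    have "card S \<noteq> Suc n" if "S \<subseteq> {..<n}" for S
      using card_mono[OF _ that] by auto
    then show ?thesis by (auto simp: W_def)
  qed
  ultimately have "lcs G (Suc n) \<subseteq> {\<one>}" using generate_empty by simp
  then show ?thesis by auto
qed

section \<open>Iterated commutators that span the graded quotients\<close>

definition ad :: "nat list \<Rightarrow> 'a \<Rightarrow> 'a" where
  "ad u z = foldr (\<lambda>a y. comm G (x a) y) u z"

lemma ad_simps [simp]: "ad [] z = z" "ad (a # u) z = comm G (x a) (ad u z)"
  "ad (u @ v) z = ad u (ad v z)"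
  by (simp_all add: ad_def)

lemma ad_lcs:
  "set u \<subseteq> {..<n} \<Longrightarrow> 1 \<le> k \<Longrightarrow> z \<in>
      lcs G k \<Longrightarrow> ad u z \<in> lcs G (length u + k)"
  by (induction u) (auto intro: comm_lcs_Suc)

lemma ad_closed: "set u \<subseteq> {..<n} \<Longrightarrow> z \<in> carrier G \<Longrightarrow> ad u z \<in> carrier G"
  by (induction u) auto

lemma ad_Ncl:
  assumes "i < n" "set u \<subseteq> {..<n}" "z \<in> carrier G" "i \<in> set u \<or> z \<in> Ncl i"
  shows "ad u z \<in> Ncl i"
  using assms
proof (induction u)
  case (Cons a u)
  then have c: "ad u z \<in> carrier G" using ad_closed by simp
  show ?case
  proof (cases "a = i")
    case True
    then show ?thesis using comm_normal(2)[OF Ncl_normal c x_in_Ncl] Cons.prems by simp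
  next
    case False
    then show ?thesis using comm_normal(1)[OF Ncl_normal _ Cons.IH] Cons.prems by simp
  qed
qed simp

text \<open>Turns a commutator inside out so that z becomes the innermost entry. With b the first
  letter of the word and t the commutator of the rest, Jacobi gives [z, [x_b, t]] = [[z, x_b], t]
  [x_b, [z, t]] modulo the next term. The first factor uses the induction hypothesis for [x_b, z],
  one degree deeper, and puts b at the end of the word; the second puts b at its beginning. Hence z
  and k stay arbitrary.\<close>

lemma comm_ad_in_span:
  assumes "distinct (u @ [s])" "set (u @ [s]) \<subseteq> {..<n}" "1 \<le> k" "z \<in> lcs G k"
  shows "comm G z (ad u (x s)) \<in>
    generate G ({ad v z | v. distinct v \<and> set v = insert s (set u)} \<union> lcs G (Suc (Suc (length u) + k)))"
  using assms
proof (induction u arbitrary: z k)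
  case Nil
  then have c: "z \<in> carrier G" "x s \<in> carrier G" by auto
  have "ad [s] z \<in> {ad v z | v. distinct v \<and> set v = insert s (set [])}"
    by (intro CollectI exI[of _ "[s]"]) simp
  then have "inv (ad [s] z) \<in> generate G ({ad v z | v. distinct v \<and> set v =
      insert s (set [])} \<union> lcs G (Suc (Suc (length []) + k)))"
    by (intro generate.inv) blast
  then show ?case using inv_comm[OF c(2,1)] by simp
next
  case (Cons b u)
  define L where "L = generate G ({ad v z | v. distinct v \<and> set v =
      insert s (set (b # u))} \<union> lcs G (Suc (Suc (length (b # u)) + k)))"
  define t where "t = ad u (x s)"
  have zc: "z \<in> carrier G" and b: "b < n" and s: "s < n" and u: "set u \<subseteq> {..<n}" and bs: "b \<noteq> s" "b \<notin> set u"
    using Cons.prems by auto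
  have bc: "x b \<in> carrier G" using b by simp
  have t: "t \<in> lcs G (length u + 1)" "t \<in> carrier G"
    unfolding t_def using ad_lcs[OF u, of 1 "x s"] s by auto
  have v: "length v = Suc (Suc (length u)) \<and> set v \<subseteq> {..<n}"
    if "distinct v" "set v = insert s (set (b # u))" for v
  proof -
    have "length v = card (set (b # u @ [s]))"
      using distinct_card[OF that(1)] that(2) by (simp add: insert_commute)
    also have "\<dots> = length (b # u @ [s])" using distinct_card[of "b # u @ [s]"] Cons.prems by simp
    finally show ?thesis using that Cons.prems by auto
  qed
  have gsub: "{ad v z | v. distinct v \<and> set v =
      insert s (set (b # u))} \<union> lcs G (Suc (Suc (length (b # u)) + k)) \<subseteq> lcs G (Suc (length (b # u)) + k)"
  proof (rule Un_least[OF subsetI lcs_Suc_subset])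
    fix a assume "a \<in> {ad v z | v. distinct v \<and> set v = insert s (set (b # u))}"
    then obtain v where v': "distinct v" "set v = insert s (set (b # u))" "a = ad v z" by blast
    then show "a \<in> lcs G (Suc (length (b # u)) + k)"
      using ad_lcs[OF _ Cons.prems(3,4), of v] v[OF v'(1,2)] by simp
  qed
  have L: "L \<lhd> G" unfolding L_def
  proof (rule normal_between_lcs)
    show "subgroup (generate G ({ad v z | v. distinct v \<and> set v =
        insert s (set (b # u))} \<union> lcs G (Suc (Suc (length (b # u)) + k)))) G"
      by (rule generate_is_subgroup[OF subset_trans[OF gsub subgroup.subset[OF lcs_subgroup]]])
    show "generate G ({ad v z | v. distinct v \<and> set v =
        insert s (set (b # u))} \<union> lcs G (Suc (Suc (length (b # u)) + k))) \<subseteq> lcs G (Suc (length (b # u)) + k)"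
      by (rule generate_subgroup_incl[OF gsub lcs_subgroup])
  qed (auto intro: generate.incl)
  have Linc: "ad v z \<in> L" if "distinct v" "set v = insert s (set (b # u))" for v
    unfolding L_def using that by (intro generate.incl) blast
  have Llcs: "lcs G (Suc (Suc (length (b # u)) + k)) \<subseteq> L"
    unfolding L_def by (auto intro: generate.incl)
  have Lsub: "subgroup L G" using L by (rule normal_imp_subgroup)
  have 1: "comm G (comm G z (x b)) t \<in> L"
  proof -
    let ?z = "comm G (x b) z"
    have z': "?z \<in> lcs G (Suc k)" using comm_lcs_Suc[OF Cons.prems(3) bc Cons.prems(4)] .
    have "comm G ?z t \<in> generate G ({ad v ?z | v. distinct v \<and> set v =
        insert s (set u)} \<union> lcs G (Suc (Suc (length u) + Suc k)))"
      unfolding t_def by (rule Cons.IH) (use Cons.prems z' in auto)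
    also have "\<dots> \<subseteq> L"
    proof (rule generate_subgroup_incl[OF _ Lsub], rule Un_least)
      show "{ad v ?z | v. distinct v \<and> set v = insert s (set u)} \<subseteq> L"
      proof clarify
        fix v assume "distinct v" "set v = insert s (set u)"
        then have "ad (v @ [b]) z \<in> L" using bs by (intro Linc) auto
        then show "ad v ?z \<in> L" by simp
      qed
      show "lcs G (Suc (Suc (length u) + Suc k)) \<subseteq> L" using Llcs by simp
    qed
    finally have zt: "comm G ?z t \<in> L" .
    \<comment> \<open>[z, x_b] is the inverse of [x_b, z]; singleton generating sets carry the
      membership over to the inverse.\<close>
    have "comm G (inv ?z) t \<in> L"
      by (rule comm_generate_subset[OF L _ _ _ generate.inv[of ?z "{?z}"] generate.incl[of t "{t}"]])
         (use bc zc t(2) zt in simp_all)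
    then show ?thesis using inv_comm[OF bc zc] by simp
  qed
  have 2: "comm G (x b) (comm G z t) \<in> L"
  proof -
    have zt: "comm G z t \<in> generate G ({ad v z | v. distinct v \<and> set v =
        insert s (set u)} \<union> lcs G (Suc (Suc (length u) + k)))"
      unfolding t_def by (rule Cons.IH) (use Cons.prems in auto)
    have xb: "x b \<in> generate G {x b}" by (auto intro: generate.incl)
    show ?thesis
    proof (rule comm_generate_subset[OF L _ _ _ xb zt])
      show "{ad v z | v. distinct v \<and> set v =
          insert s (set u)} \<union> lcs G (Suc (Suc (length u) + k)) \<subseteq> carrier G"
        using ad_closed[OF _ zc] u s subgroup.subset[OF lcs_subgroup]
        by (intro Un_least) auto
      fix a c assume "a \<in> {x b}" and "c \<in> {ad v z | v. distinct v \<and> set v =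
          insert s (set u)} \<union> lcs G (Suc (Suc (length u) + k))"
      then consider v where "distinct v" "set v = insert s (set u)" "c = ad v z" | "c \<in> lcs G (Suc (Suc (length u) + k))"
        by auto
      then show "comm G a c \<in> L"
      proof cases
        case 1
        then have "ad (b # v) z \<in> L" using bs by (intro Linc) auto
        then show ?thesis using 1 \<open>a \<in> _\<close> by simp
      next
        case 2
        then show ?thesis using comm_lcs_Suc[OF _ bc 2] Llcs \<open>a \<in> _\<close> by auto
      qed
    qed (use bc in auto)
  qed
  have c: "comm G (x b) t \<in> carrier G" "comm G z (x b) \<in> carrier G" "comm G z t \<in> carrier G"
    using bc zc t by auto
  have "gcl G (1 + (length u + 1) + k) (comm G z (comm G (x b) t)) =
    gcl G (1 + (length u + 1) + k) (comm G (comm G z (x b)) t \<otimes> comm G (x b) (comm G z t))"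
    by (rule gcl_jacobi) (use Cons.prems t b in auto)
  then have "comm G z (comm G (x b) t) \<otimes> inv (comm G (comm G z (x b)) t \<otimes>
      comm G (x b) (comm G z t)) \<in> L"
    using Llcs c t zc bc by (subst (asm) gcl_eq_iff) auto
  then have "comm G z (comm G (x b) t) \<otimes> inv (comm G (comm G z (x b)) t \<otimes> comm G (x b) (comm G z t))
     \<otimes> (comm G (comm G z (x b)) t \<otimes> comm G (x b) (comm G z t)) \<in> L"
    by (rule subgroup.m_closed[OF Lsub _ subgroup.m_closed[OF Lsub 1 2]])
  then have "comm G z (comm G (x b) t) \<in> L"
    using c t zc bc by (simp add: m_assoc)
  then show ?case unfolding L_def t_def by simp
qed

text \<open>Words in distinct letters whose last letter s is the largest, (m-1)! of them on each set
  of m letters. For m \<ge> 1 the commutators \<open>ad u (x s)\<close> give a basis of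
  \<Gamma>_m/\<Gamma>_{m+1}: they span by \<open>lcs_spanned\<close>, and \<open>coef_basic\<close>
  supplies dual coordinates.\<close>

definition basic :: "nat \<Rightarrow> (nat list \<times> nat) set" where
  "basic m = {(u, s). distinct (u @ [s]) \<and> s < n \<and> (\<forall>a\<in>set u. a < s) \<and> Suc (length u) = m}"

lemma basic_ad_lcs: "(u, s) \<in> basic m \<Longrightarrow> ad u (x s) \<in> lcs G m"
  using ad_lcs[of u 1 "x s"] by (fastforce simp: basic_def)

text \<open>Let c = \<open>ad u (x s)\<close> be basic. If i occurs in c, then x_i and c lie in the
  abelian \<open>Ncl i\<close> and [x_i, c] = 1. If i < s and i is new, [x_i, c] is basic. If i > s,
  turning [x_i, c] inside out makes i the innermost letter, and i is now the largest.\<close>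

lemma lcs_spanned:
  assumes "1 \<le> m"
  shows "lcs G m \<subseteq> generate G ((\<lambda>(u, s). ad u (x s)) ` basic m \<union> lcs G (Suc m))"
  using assms
proof (induction m rule: nat_induct_at_least)
  case base
  have "x ` {..<n} \<subseteq> (\<lambda>(u, s). ad u (x s)) ` basic 1 \<union> lcs G (Suc 1)"
  proof clarify
    fix s assume "s < n"
    then have "([], s) \<in> basic 1" by (simp add: basic_def)
    then show "x s \<in> (\<lambda>(u, s). ad u (x s)) ` basic 1" by (force intro: image_eqI)
  qed
  then show ?case using mono_generate[of "x ` {..<n}"] generated by simp
next
  case (Suc m)
  let ?E = "\<lambda>m. (\<lambda>(u, s). ad u (x s)) ` basic m \<union> lcs G (Suc m)"
  define L where "L = generate G (?E (Suc m))"
  have E: "?E k \<subseteq> lcs G k" for k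
    using basic_ad_lcs by (intro Un_least lcs_Suc_subset) auto
  have L: "L \<lhd> G" unfolding L_def
  proof (rule normal_between_lcs)
    show "subgroup (generate G (?E (Suc m))) G"
      by (rule generate_is_subgroup[OF subset_trans[OF E subgroup.subset[OF lcs_subgroup]]])
    show "generate G (?E (Suc m)) \<subseteq> lcs G (Suc m)"
      by (rule generate_subgroup_incl[OF E lcs_subgroup])
  qed (auto intro: generate.incl)
  have *: "comm G a c \<in> L" if ac: "a \<in> x ` {..<n}" "c \<in> ?E m" for a c
  proof -
    obtain i where i: "i < n" "a = x i" using ac by auto
    consider "c \<in> lcs G (Suc m)" | u s where "(u, s) \<in> basic m" "c = ad u (x s)" using ac(2) by auto
    then show ?thesis
    proof cases
      case 1
      then have "comm G a c \<in> lcs G (Suc (Suc m))" using i comm_lcs_Suc[of "Suc m" "x i" c] by simp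
      then show ?thesis unfolding L_def by (intro generate.incl) simp
    next
      case 2
      then have us: "distinct (u @ [s])" "s < n" "\<forall>a\<in>set u. a < s" "Suc (length u) =
          m" "set u \<subseteq> {..<n}"
        by (auto simp: basic_def)
      show ?thesis
      proof (cases "i \<in> set u \<or> i = s")
        case True
        then have "c \<in> Ncl i" unfolding 2(2) using ad_Ncl[OF i(1) us(5), of "x s"] us x_in_Ncl by auto
        then show ?thesis using Ncl_abelian[OF i(1) x_in_Ncl[OF i(1)]] i L_def generate.one by simp
      next
        case False
        show ?thesis
        proof (cases "i < s")
          case True
          then have "(i # u, s) \<in> basic (Suc m)" using us False by (simp add: basic_def)
          then have "ad (i # u) (x s) \<in> ?E (Suc m)" by (force intro: image_eqI)
          then show ?thesis unfolding L_def i 2 by (intro generate.incl) simp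
        next
          case ge: False
          then have s: "s < i" using False by simp
          have "comm G (x i) (ad u (x s)) \<in>
            generate G ({ad v (x i) | v. distinct v \<and> set v = insert s (set u)} \<union> lcs G (Suc (Suc (length u) + 1)))"
            by (rule comm_ad_in_span) (use us i in auto)
          also have "\<dots> \<subseteq> generate G (?E (Suc m))"
          proof (rule mono_generate, rule Un_mono)
            show "{ad v (x i) | v. distinct v \<and> set v =
                insert s (set u)} \<subseteq> (\<lambda>(u, s). ad u (x s)) ` basic (Suc m)"
            proof clarify
              fix v assume v: "distinct v" "set v = insert s (set u)"
              have "length v = card (set (u @ [s]))" using distinct_card[OF v(1)] v(2) by simp
              also have "\<dots> = m" using distinct_card[OF us(1)] us(4) by simp
              finally have "(v, i) \<in> basic (Suc m)" using v us s i False by (auto simp: basic_def)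
              then show "ad v (x i) \<in> (\<lambda>(u, s). ad u (x s)) ` basic (Suc m)"
                by (force intro: image_eqI)
            qed
            show "lcs G (Suc (Suc (length u) + 1)) \<subseteq> lcs G (Suc (Suc m))" using us by simp
          qed
          finally show ?thesis using i 2 L_def by simp
        qed
      qed
    qed
  qed
  have "{comm G a b | a b. a \<in> carrier G \<and> b \<in> lcs G m} \<subseteq> L"
  proof clarify
    fix a b assume "a \<in> carrier G" "b \<in> lcs G m"
    then have a: "a \<in> generate G (x ` {..<n})" and b: "b \<in> generate G (?E m)"
      using generated Suc.IH by auto
    show "comm G a b \<in> L"
      by (rule comm_generate_subset[OF L _ subset_trans[OF E subgroup.subset[OF lcs_subgroup]] * a b]) auto
  qed
  then show ?case unfolding lcs_Suc[OF Suc.hyps] L_def[symmetric]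
    by (rule generate_subgroup_incl[OF _ normal_imp_subgroup[OF L]])
qed

end

section \<open>Leading terms in the Magnus ring\<close>

fun mbr :: "nat list \<Rightarrow> nat \<Rightarrow> magnus" where
  "mbr [] s = mvar s"
| "mbr (a # u) s = mvar a * mbr u s - mbr u s * mvar a"

lemma mbr_support: "coef (mbr u s) w \<noteq> 0 \<Longrightarrow> set w = insert s (set u)"
proof (induction u arbitrary: w)
  case Nil
  then show ?case by (auto simp: coef_mvar split: if_splits)
next
  case (Cons a u)
  have d: "distinct w" using Cons.prems coef_not_distinct by blast
  consider "coef (mvar a * mbr u s) w \<noteq> 0" | "coef (mbr u s * mvar a) w \<noteq> 0"
    using Cons.prems by (cases "coef (mvar a * mbr u s) w = 0") auto
  then show ?case
  proof cases
    case 1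
    then obtain b v where w: "w = b # v" by (cases w) auto
    then show ?thesis using 1 d coef_mvar_times_Cons[of b v a] Cons.IH[of v] by (auto split: if_splits)
  next
    case 2
    then obtain b v where w: "w = v @ [b]" by (cases w rule: rev_cases) auto
    then show ?thesis using 2 d coef_times_mvar_snoc[of v b _ a] Cons.IH[of v] by (auto split: if_splits)
  qed
qed

text \<open>At each step the term with X_a on the right cannot end in s, so exactly one monomial of
  the expanded bracket does.\<close>

lemma coef_mbr_last:
  "distinct (u @ [s]) \<Longrightarrow> distinct (v @ [s]) \<Longrightarrow> coef (mbr u s) (v @ [s]) = (if v =
      u then 1 else 0)"
proof (induction u arbitrary: v)
  case Nil
  then show ?case by (simp add: coef_mvar)
next
  case (Cons a u)
  have "coef (mbr u s * mvar a) (v @ [s]) = 0"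
    using Cons.prems coef_times_mvar_snoc[of v s "mbr u s" a] by auto
  moreover have "coef (mvar a * mbr u s) (v @ [s]) = (if v = a # u then 1 else 0)"
  proof (cases v)
    case Nil
    then show ?thesis using Cons.prems coef_mvar_times_Cons[of s "[]" a] by auto
  next
    case (Cons b v')
    then show ?thesis using Cons.prems Cons.IH[of v'] coef_mvar_times_Cons[of b "v' @ [s]" a] by auto
  qed
  ultimately show ?case by simp
qed

text \<open>The ring endomorphism setting X_i = 0, in terms of coefficients. It is the counterpart
  of the retraction of G that kills x_i.\<close>

lift_definition kill :: "nat \<Rightarrow> magnus \<Rightarrow> magnus" is "\<lambda>i f w. if i \<in> set w then 0 else f w"
  by auto

lemma coef_kill: "coef (kill i f) w = (if i \<in> set w then 0 else coef f w)"
  by transfer simp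

lemma kill_times: "kill i (f * g) = kill i f * kill i g"
proof (rule magnus_eqI)
  fix w :: "nat list" assume d: "distinct w"
  show "coef (kill i (f * g)) w = coef (kill i f * kill i g) w"
  proof (cases "i \<in> set w")
    case True
    then have "coef (kill i f * kill i g) w = 0"
      by (intro coef_times_eq_zero) (auto simp: coef_kill)
    then show ?thesis using True by (simp add: coef_kill)
  next
    case False
    then show ?thesis using d by (auto simp: coef_kill coef_times intro!: conv_cong)
  qed
qed

lemma kill_gen: "kill i (1 + mvar k) = (if k = i then 1 else 1 + mvar k)" "kill i 1 = 1"
  by (rule magnus_eqI; auto simp: coef_kill coef_one coef_mvar)+

context reduced_magnus
begin

section \<open>Magnus images of the lower central series\<close>

lemma mu_inv: "g \<in> carrier G \<Longrightarrow> mu g * mu (inv g) =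
    1" "g \<in> carrier G \<Longrightarrow> mu (inv g) * mu g = 1"
  by (simp_all flip: mu_mult)

lemma mu_comm: "g \<in> carrier G \<Longrightarrow> h \<in> carrier G \<Longrightarrow>
    mu (comm G g h) = mu g * mu h * mu (inv g) * mu (inv h)"
  by (simp add: comm_def mu_mult)

lemma mu_deg_generate:
  assumes S: "S \<subseteq> carrier G" "\<And>s. s \<in> S \<Longrightarrow> deg_ge m (mu s - 1)" and "g \<in>
      generate G S"
  shows "deg_ge m (mu g - 1)"
  using assms(3)
proof (induction rule: generate.induct)
  case one then show ?case by simp
next
  case (incl s) then show ?case using S by simp
next
  case (inv s)
  then have s: "s \<in> carrier G" using S by auto
  have "mu (inv s) - 1 = - ((mu s - 1) * mu (inv s))"
    using mu_inv(1)[OF s] by (simp add: algebra_simps)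
  moreover have "deg_ge (m + 0) ((mu s - 1) * mu (inv s))" by (rule deg_ge_times) (use S inv in auto)
  ultimately show ?case by simp
next
  case (eng a b)
  then have c: "a \<in> carrier G" "b \<in> carrier G" using generate_in_carrier[OF S(1)] by auto
  have e: "mu (a \<otimes> b) - 1 = (mu a - 1) * mu b + (mu b - 1)"
    using c by (simp add: mu_mult algebra_simps)
  have "deg_ge (m + 0) ((mu a - 1) * mu b)" by (rule deg_ge_times) (use eng in auto)
  then show ?case unfolding e using eng by (intro deg_ge_simps(2)) simp_all
qed

lemma mu_deg: "1 \<le> m \<Longrightarrow> g \<in> lcs G m \<Longrightarrow> deg_ge m (mu g - 1)"
proof (induction m arbitrary: g rule: nat_induct_at_least)
  case base
  show ?case
    by (rule mu_deg_generate[of "x ` {..<n}"]) (use base generated in \<open>auto simp: mu_gen\<close>)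
next
  case (Suc m)
  have 1: "deg_ge 1 (mu g - 1)" if "g \<in> carrier G" for g
    by (rule mu_deg_generate[of "x ` {..<n}"]) (use that generated in \<open>auto simp: mu_gen\<close>)
  show ?case
  proof (rule mu_deg_generate)
    show "g \<in> generate G {comm G x y |x y. x \<in> carrier G \<and> y \<in> lcs G m}"
      using Suc.prems lcs_Suc[OF Suc.hyps] by simp
    fix s assume "s \<in> {comm G x y |x y. x \<in> carrier G \<and> y \<in> lcs G m}"
    then obtain a y where s: "s = comm G a y" and a: "a \<in> carrier G" and y: "y \<in> lcs G m" by blast
    have yc: "y \<in> carrier G" using y by auto
    let ?b = "(mu a - 1) * (mu y - 1) - (mu y - 1) * (mu a - 1)"
    have "deg_ge (Suc (1 + m)) (mu a * mu y * mu (inv a) * mu (inv y) - 1 - ?b)"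
      by (rule commutator_leading_term) (use Suc 1 a y yc mu_inv in auto)
    then have "deg_ge (Suc m) (mu s - 1 - ?b)"
      using deg_ge_mono s mu_comm[OF a yc] by simp
    moreover have "deg_ge (Suc m) ?b"
      using deg_ge_times[OF 1[OF a] Suc.IH[OF y]] deg_ge_times[OF Suc.IH[OF y] 1[OF a]] by simp
    ultimately have "deg_ge (Suc m) (mu s - 1 - ?b + ?b)" by (rule deg_ge_simps)
    then show "deg_ge (Suc m) (mu s - 1)" by simp
  qed auto
qed

text \<open>Only the degree m part of f is determined by g; higher terms are arbitrary. So nothing
  has to be made homogeneous: f + f' serves for a product and f f' - f' f for a commutator.\<close>

definition lead :: "nat \<Rightarrow> 'a \<Rightarrow> magnus \<Rightarrow> bool" where
  "lead m g f \<longleftrightarrow> g \<in> lcs G m \<and> deg_ge m f \<and> deg_ge (Suc m) (mu g - 1 - f)"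

lemma lead_self: "1 \<le> m \<Longrightarrow> g \<in> lcs G m \<Longrightarrow> lead m g (mu g - 1)"
  using mu_deg by (simp add: lead_def)

lemma lead_zero: "g \<in> lcs G (Suc m) \<Longrightarrow> lead m g 0"
  using mu_deg[of "Suc m" g] lcs_le[of g "Suc m" m] by (simp add: lead_def)

lemma lead_gen: "i < n \<Longrightarrow> lead 1 (x i) (mvar i)"
  using deg_ge_mvar by (simp add: lead_def mu_gen)

lemma lead_coef: "1 \<le> m \<Longrightarrow> lead m g f \<Longrightarrow> length w =
    m \<Longrightarrow> coef (mu g) w = coef f w"
proof -
  assume "1 \<le> m" "lead m g f" "length w = m"
  then have "coef (mu g - 1 - f) w = 0" "w \<noteq> []" unfolding lead_def deg_ge_def by auto
  then show ?thesis by (simp add: coef_one)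
qed

lemma lead_unique_zero: "1 \<le> m \<Longrightarrow> g \<in>
    lcs G (Suc m) \<Longrightarrow> lead m g f \<Longrightarrow> length w = m \<Longrightarrow> coef f w = 0"
  using lead_coef[of m g f w] lead_coef[OF _ lead_zero, of m g w] by simp

lemma lead_mult:
  assumes m: "1 \<le> m" and g: "lead m g f" and h: "lead m h f'"
  shows "lead m (g \<otimes> h) (f + f')"
proof -
  have gh: "g \<in> lcs G m" "h \<in> lcs G m" "g \<in> carrier G" "h \<in> carrier G"
    using g h by (auto simp: lead_def)
  have e: "mu (g \<otimes> h) - 1 - (f + f') = (mu g - 1 - f) + (mu h - 1 - f') + (mu g - 1) * (mu h - 1)"
    using gh by (simp add: mu_mult algebra_simps)
  have "deg_ge (Suc m) ((mu g - 1) * (mu h - 1))"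
    using deg_ge_mono[OF deg_ge_times[OF mu_deg[OF m gh(1)] mu_deg[OF m gh(2)]]] m by simp
  then have "deg_ge (Suc m) (mu (g \<otimes> h) - 1 - (f + f'))"
    unfolding e using g h by (intro deg_ge_simps(2)) (simp_all add: lead_def)
  then show ?thesis using g h by (simp add: lead_def)
qed

lemma lead_comm:
  assumes i: "1 \<le> i" and j: "1 \<le> j" and g: "lead i g f" and h: "lead j h f'"
  shows "lead (i + j) (comm G g h) (f * f' - f' * f)"
proof -
  have gh: "g \<in> lcs G i" "h \<in> lcs G j" "g \<in> carrier G" "h \<in> carrier G"
    using g h by (auto simp: lead_def)
  let ?a = "mu g - 1" and ?b = "mu h - 1"
  have d: "deg_ge i ?a" "deg_ge j ?b" "deg_ge i f" "deg_ge j f'" "deg_ge (Suc i) (?a - f)" "deg_ge (Suc j) (?b - f')"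
    using g h mu_deg[OF i gh(1)] mu_deg[OF j gh(2)] by (auto simp: lead_def)
  \<comment> \<open>Exchanging one factor at a time, \<open>?a\<close> for f and \<open>?b\<close>
    for f', each error has degree at least i + j + 1.\<close>
  have "?a * ?b - ?b * ?a - (f * f' - f' * f) =
    (?a - f) * ?b + f * (?b - f') - ((?b - f') * ?a + f' * (?a - f))" by (simp add: algebra_simps)
  moreover have "deg_ge (Suc (i + j)) ((?a - f) * ?b)" "deg_ge (Suc (i + j)) (f * (?b - f'))"
    "deg_ge (Suc (i + j)) ((?b - f') * ?a)" "deg_ge (Suc (i + j)) (f' * (?a - f))"
    using deg_ge_times[OF d(5,2)] deg_ge_times[OF d(3,6)] deg_ge_times[OF d(6,1)] deg_ge_times[OF d(4,5)]
    by (simp_all add: ac_simps)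
  ultimately have 1: "deg_ge (Suc (i + j)) (?a * ?b - ?b * ?a - (f * f' - f' * f))"
    by (metis deg_ge_simps(2,3))
  have "deg_ge (Suc (i + j)) (mu g * mu h * mu (inv g) * mu (inv h) - 1 - (?a * ?b - ?b * ?a))"
    by (rule commutator_leading_term[OF i j d(1,2)]) (use gh mu_inv in auto)
  then have 2: "deg_ge (Suc (i + j)) (mu (comm G g h) - 1 - (?a * ?b - ?b * ?a))"
    using gh by (simp add: mu_comm)
  have "deg_ge (Suc (i + j)) ((mu (comm G g h) - 1 - (?a * ?b - ?b * ?a)) + (?a * ?b - ?b * ?a - (f * f' - f' * f)))"
    using 2 1 by (rule deg_ge_simps(2))
  then have "deg_ge (Suc (i + j)) (mu (comm G g h) - 1 - (f * f' - f' * f))"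
    by (simp add: algebra_simps)
  moreover have "deg_ge (i + j) (f * f' - f' * f)"
    using deg_ge_times[OF d(3,4)] deg_ge_times[OF d(4,3)] by (simp add: add.commute)
  ultimately show ?thesis using comm_lcs[OF i j gh(1,2)] by (simp add: lead_def)
qed

lemma lead_ad: "set u \<subseteq> {..<n} \<Longrightarrow> s < n \<Longrightarrow> lead (Suc (length u)) (ad u (x s)) (mbr u s)"
proof (induction u)
  case Nil
  then show ?case using lead_gen by simp
next
  case (Cons a u)
  then show ?case using lead_comm[OF _ _ lead_gen[of a] Cons.IH] by simp
qed

text \<open>The words of \<open>basic m\<close> read off coordinates: for s = t a single monomial of
  the bracket ends in s, and for s different from t the letter sets differ because their maxima
  do.\<close>

lemma coef_basic:
  assumes "(u, s) \<in> basic m" "(v, t) \<in> basic m"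
  shows "coef (mu (ad u (x s))) (v @ [t]) = (if (v, t) = (u, s) then 1 else 0)"
proof -
  have us: "distinct (u @ [s])" "s < n" "\<forall>a\<in>set u. a < s" "Suc (length u) = m" "set u \<subseteq> {..<n}"
    and vt: "distinct (v @ [t])" "t < n" "\<forall>a\<in>set v. a < t" "Suc (length v) = m"
    using assms by (auto simp: basic_def)
  have e: "coef (mu (ad u (x s))) (v @ [t]) = coef (mbr u s) (v @ [t])"
    by (rule lead_coef[OF _ lead_ad]) (use us vt in auto)
  show ?thesis
  proof (cases "s = t")
    case True
    then show ?thesis using e coef_mbr_last us vt by auto
  next
    case False
    have "set (v @ [t]) \<noteq> insert s (set u)"
    proof
      assume *: "set (v @ [t]) = insert s (set u)"
      then have "t \<in> insert s (set u)" "s \<in> insert t (set v)" by auto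
      then have "t < s" "s < t" using us vt False by auto
      then show False by simp
    qed
    then show ?thesis using e mbr_support[of u s "v @ [t]"] False by auto
  qed
qed

lemma finite_basic: "finite (basic m)"
proof (rule finite_subset)
  show "basic m \<subseteq> {u. set u \<subseteq> {..<n} \<and> length u = m - 1} \<times> {..<n}"
    by (auto simp: basic_def)
  show "finite ({u. set u \<subseteq> {..<n} \<and> length u = m - 1} \<times> {..<n})"
    by (intro finite_cartesian_product finite_lists_length_eq) auto
qed

text \<open>\<open>Phi\<close> rebuilds a class in \<Gamma>_m/\<Gamma>_{m+1} from the coefficients
  at the basic words. It is additive on \<Gamma>_m and agrees with the projection on the spanning
  set of \<open>lcs_spanned\<close>, hence everywhere on \<Gamma>_m; if all these coefficients
  vanish, the class is trivial.\<close>

lemma lcs_Suc_if_coef_zero: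
  assumes m: "1 \<le> m" and g: "g \<in> lcs G m"
    and zero: "\<And>u s. (u, s) \<in> basic m \<Longrightarrow> coef (mu g) (u @ [s]) = 0"
  shows "g \<in> lcs G (Suc m)"
proof -
  let ?Q = "grQ G m"
  interpret Q: group ?Q by (rule grQ_group)
  interpret Q: comm_group ?Q
  proof (rule Q.group_comm_groupI)
    fix a b assume "a \<in> carrier ?Q" "b \<in> carrier ?Q"
    then obtain y z where "y \<in> lcs G m" "a = gcl G m y" "z \<in> lcs G m" "b = gcl G m z"
      by (auto simp: carrier_grQ)
    then show "a \<otimes>\<^bsub>?Q\<^esub> b = b \<otimes>\<^bsub>?Q\<^esub> a"
      using gcl_commute[OF m, of y z] by (simp add: grQ_mult lcs_carrier)
  qed
  define e where "e = (\<lambda>(u, s). gcl G m (ad u (x s)))"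
  define w where "w = (\<lambda>(u::nat list, s). u @ [s])"
  have e: "e t \<in> carrier ?Q" if "t \<in> basic m" for t
    using basic_ad_lcs[of "fst t" "snd t" m] that by (auto simp: e_def split: prod.splits)
  have wl: "length (w t) = m" if "t \<in> basic m" for t
    using that by (auto simp: basic_def w_def)
  define Phi where "Phi h = finprod ?Q (\<lambda>t. e t [^]\<^bsub>?Q\<^esub> coef (mu h) (w t)) (basic m)" for h
  have Pc: "Phi h \<in> carrier ?Q" for h
    unfolding Phi_def by (rule Q.finprod_closed) (use e in auto)
  have add: "Phi (h \<otimes> k) =
      Phi h \<otimes>\<^bsub>?Q\<^esub> Phi k" if "h \<in> lcs G m" "k \<in> lcs G m" for h k
  proof -
    have "coef (mu (h \<otimes> k)) (w t) = coef (mu h) (w t) + coef (mu k) (w t)" if "t \<in> basic m" for t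
    proof -
      have "w t \<noteq> []" using wl[OF that] m by auto
      then show ?thesis
        using lead_coef[OF m lead_mult[OF m lead_self lead_self] wl[OF that], OF m \<open>h \<in> _\<close> m \<open>k \<in> _\<close>]
        by (simp add: coef_one)
    qed
    then have "Phi (h \<otimes> k) =
        finprod ?Q (\<lambda>t. (e t [^]\<^bsub>?Q\<^esub> coef (mu h) (w t)) \<otimes>\<^bsub>?Q\<^esub> (e t [^]\<^bsub>?Q\<^esub> coef (mu k) (w t))) (basic m)"
      unfolding Phi_def using e by (intro Q.finprod_cong) (auto simp: Q.int_pow_mult simp_implies_def)
    also have "\<dots> = Phi h \<otimes>\<^bsub>?Q\<^esub> Phi k"
      unfolding Phi_def using e by (intro Q.finprod_multf) auto
    finally show ?thesis .
  qed
  have zeroP: "Phi h = \<one>\<^bsub>?Q\<^esub>" if "\<And>t. t \<in> basic m \<Longrightarrow> coef (mu h) (w t) =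
      0" for h
    unfolding Phi_def using that by (intro Q.finprod_one_eqI) auto
  have P1: "Phi \<one> = \<one>\<^bsub>?Q\<^esub>"
  proof (rule zeroP)
    fix t assume "t \<in> basic m"
    then have "w t \<noteq> []" using wl[of t] m by auto
    then show "coef (mu \<one>) (w t) = 0" by (simp add: coef_one)
  qed
  have Pinc: "Phi h = gcl G m h" if "h \<in> (\<lambda>(u, s). ad u (x s)) ` basic m \<union> lcs G (Suc m)" for h
    using that
  proof
    assume "h \<in> lcs G (Suc m)"
    moreover have "coef (mu h) (w t) = 0" if "t \<in> basic m" for t
      using lead_coef[OF m lead_zero[OF \<open>h \<in> lcs G (Suc m)\<close>] wl[OF that]] by simp
    ultimately show ?thesis using zeroP gcl_eq_one_iff[of h m] by (auto simp: grQ_one)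
  next
    assume "h \<in> (\<lambda>(u, s). ad u (x s)) ` basic m"
    then obtain u s where us: "(u, s) \<in> basic m" "h = ad u (x s)" by auto
    have "Phi h = finprod ?Q (\<lambda>t. if (u, s) = t then e t else \<one>\<^bsub>?Q\<^esub>) (basic m)"
      unfolding Phi_def
    proof (rule Q.finprod_cong')
      fix t assume "t \<in> basic m"
      then show "e t [^]\<^bsub>?Q\<^esub> coef (mu h) (w t) = (if (u, s) = t then e t else \<one>\<^bsub>?Q\<^esub>)"
        using coef_basic[OF us(1), of "fst t" "snd t"] us(2) e by (auto simp: w_def split: prod.splits)
    next
      show "(\<lambda>t. if (u, s) = t then e t else \<one>\<^bsub>?Q\<^esub>) \<in> basic m \<rightarrow> carrier ?Q"
        by (rule Pi_I) (simp add: e)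
    qed simp
    also have "\<dots> = e (u, s)"
      by (rule Q.finprod_singleton[OF us(1) finite_basic]) (use e in auto)
    finally show ?thesis using us by (simp add: e_def)
  qed
  have E: "(\<lambda>(u, s). ad u (x s)) ` basic m \<union> lcs G (Suc m) \<subseteq> lcs G m"
    using basic_ad_lcs by (intro Un_least lcs_Suc_subset) auto
  have "g \<in> generate G ((\<lambda>(u, s). ad u (x s)) ` basic m \<union> lcs G (Suc m))"
    using lcs_spanned[OF m] g by blast
  then have "g \<in> lcs G m \<and> Phi g = gcl G m g"
  proof (induction rule: generate.induct)
    case one
    then show ?case using P1 by (simp add: grQ_one)
  next
    case (incl h)
    then show ?case using E Pinc by blast
  next
    case (inv h)
    then have h: "h \<in> lcs G m" "Phi h = gcl G m h" "h \<in> carrier G" using E Pinc lcs_carrier by blast+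
    have "Phi (inv h) \<otimes>\<^bsub>?Q\<^esub> gcl G m h = \<one>\<^bsub>?Q\<^esub>"
      using add[of "inv h" h] h P1 by simp
    then have "inv\<^bsub>?Q\<^esub> gcl G m h = Phi (inv h)"
      by (rule Q.inv_equality) (use h Pc in auto)
    then show ?case using h grQ_inv by simp
  next
    case (eng h k)
    then show ?case using add[of h k] lcs_carrier[of h m] lcs_carrier[of k m] by (simp add: grQ_mult)
  qed
  moreover have "Phi g = \<one>\<^bsub>?Q\<^esub>"
    by (rule zeroP) (use zero in \<open>auto simp: w_def\<close>)
  ultimately show ?thesis using gcl_eq_one_iff[of g m] g by (auto simp: grQ_one)
qed

end

section \<open>Realising derivations\<close>

lemma (in group) der_gcl_comm:
  assumes D: "D \<in> der G k" and i: "1 \<le> i" and l: "1 \<le> l"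
    and x: "x \<in> lcs G i" "x' \<in> lcs G (i + k)" "D i (gcl G i x) = gcl G (i + k) x'"
    and y: "y \<in> lcs G l" "y' \<in> lcs G (l + k)" "D l (gcl G l y) = gcl G (l + k) y'"
  shows "D (i + l) (gcl G (i + l) (comm G x y)) = gcl G (i + l + k) (comm G x' y \<otimes> comm G x y')"
proof -
  have c: "x \<in> carrier G" "y \<in> carrier G" "x' \<in> carrier G" "y' \<in> carrier G" using x y by auto
  have "D (i + l) (gcl G (i + l) (comm G x y)) = D (i + l) (lie_br G i l (gcl G i x) (gcl G l y))"
    using lie_br_gcl[OF i l x(1) y(1)] by simp
  also have "\<dots> = lie_br G (i + k) l (D i (gcl G i x)) (gcl G l y) \<otimes>\<^bsub>grQ G (i + l + k)\<^esub>
      lie_br G i (l + k) (gcl G i x) (D l (gcl G l y))"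
    using D i l gcl_closed[OF x(1)] gcl_closed[OF y(1)] unfolding der_def by blast
  also have "\<dots> = gcl G (i + l + k) (comm G x' y) \<otimes>\<^bsub>grQ G (i + l + k)\<^esub> gcl G (i + l + k) (comm G x y')"
    using lie_br_gcl[OF _ l x(2) y(1)] lie_br_gcl[OF i _ x(1) y(2)] x(3) y(3) i l by (simp add: ac_simps)
  finally show ?thesis using c by (simp add: grQ_mult)
qed

context reduced_magnus
begin

text \<open>\<open>extend\<close> applies because 1 and the remaining x_k satisfy the relations. On
  generators the displacement of p is 1 or x_i^-1, and \<open>mu\<close> intertwines p with
  \<open>kill i\<close>; both facts pass to all of G.\<close>

lemma retraction:
  assumes i: "i < n"
  obtains p where "p \<in> hom G G" "\<And>g. g \<in> carrier G \<Longrightarrow> g \<otimes> inv (p g) \<in> Ncl i"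
    "\<And>g. g \<in> carrier G \<Longrightarrow> mu (p g) = kill i (mu g)"
proof -
  have "\<exists>h\<in>hom G G. \<forall>k<n. h (x k) = (if k = i then \<one> else x k)"
    by (rule extend) (use reduced in auto)
  then obtain p where p: "p \<in> hom G G" "\<And>k. k < n \<Longrightarrow> p (x k) = (if k = i then \<one> else x k)"
    by blast
  interpret p: group_hom G G p by unfold_locales (rule p)
  interpret N: normal "Ncl i" G by (rule Ncl_normal[OF i])
  have X: "x ` {..<n} \<subseteq> carrier G" by auto
  have 1: "p g \<otimes> inv g \<in> Ncl i" if "g \<in> carrier G" for g
  proof (rule hom_displacement_generate[OF Ncl_normal[OF i] p(1) X])
    fix s assume "s \<in> x ` {..<n}"
    then show "p s \<otimes> inv s \<in> Ncl i" using p(2) x_in_Ncl[OF i] i by auto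
  qed (use that generated in auto)
  have "g \<otimes> inv (p g) \<in> Ncl i" if "g \<in> carrier G" for g
    using N.m_inv_closed[OF 1[OF that]] that by (simp add: inv_mult_group)
  moreover have "mu (p g) = kill i (mu g)" if "g \<in> carrier G" for g
  proof -
    have "g \<in> generate G (x ` {..<n})" using that generated by simp
    then show ?thesis
    proof (induction rule: generate.induct)
      case one then show ?case by (simp add: kill_gen)
    next
      case (incl s) then show ?case using p(2) by (auto simp: kill_gen mu_gen)
    next
      case (inv s)
      then have s: "s \<in> carrier G" and e: "mu (p s) = kill i (mu s)"
        using p(2) by (auto simp: kill_gen mu_gen)
      have "kill i (mu (inv s)) * mu (p s) = 1"
        unfolding e using mu_inv(2)[OF s] kill_gen(2) by (simp flip: kill_times)
      then have "kill i (mu (inv s)) * mu (p s) * mu (inv (p s)) = mu (inv (p s))" by simp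
      then show ?case using s mu_inv(1)[of "p s"] by (simp add: mult.assoc)
    next
      case (eng a b)
      then have "a \<in> carrier G" "b \<in> carrier G" using generated by auto
      then show ?case using eng by (simp add: mu_mult kill_times)
    qed
  qed
  ultimately show ?thesis using that p(1) by blast
qed

text \<open>Applying a derivation \<open>x\<^sub>i \<mapsto> g\<^sub>i\<close> to the relation \<open>[x\<^sub>i, [x\<^sub>k, x\<^sub>i]] = 1\<close>, the monomial
  \<open>X\<^sub>k M X\<^sub>i\<close> occurs only in \<open>- [X\<^sub>k, g\<^sub>i] X\<^sub>i\<close>, hence with coefficient \<open>- coef g\<^sub>i M\<close>.\<close>

lemma coef_zero_if_relation:
  assumes m: "1 \<le> m" and i: "i < n" and k: "k < n" and gi: "gi \<in> lcs G m" and gk: "gk \<in> lcs G m"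
    and rel: "comm G gi (comm G (x k) (x i)) \<otimes>
        comm G (x i) (comm G gk (x i) \<otimes> comm G (x k) gi) \<in> lcs G (m + 3)"
    and M: "distinct (k # M @ [i])" "length M = m"
  shows "coef (mu gi) M = 0"
proof -
  let ?X = "mvar i" and ?Y = "mvar k"
  define V W where "V = mu gi - 1" and "W = mu gk - 1"
  have V: "lead m gi V" and W: "lead m gk W" unfolding V_def W_def using lead_self[OF m] gi gk by auto
  have B: "lead 2 (comm G (x k) (x i)) (?Y * ?X - ?X * ?Y)"
    using lead_comm[OF _ _ lead_gen[OF k] lead_gen[OF i]] by (simp add: numeral_2_eq_2)
  have C1: "lead (m + 1) (comm G gk (x i)) (W * ?X - ?X * W)"
    by (rule lead_comm[OF m _ W lead_gen[OF i]]) simp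
  have C2: "lead (m + 1) (comm G (x k) gi) (?Y * V - V * ?Y)"
    using lead_comm[OF _ m lead_gen[OF k] V] by simp
  define C where "C = W * ?X - ?X * W + (?Y * V - V * ?Y)"
  have C: "lead (m + 1) (comm G gk (x i) \<otimes> comm G (x k) gi) C"
    unfolding C_def by (rule lead_mult[OF _ C1 C2]) simp
  have 1: "lead (m + 2) (comm G gi (comm G (x k) (x i))) (V * (?Y * ?X - ?X * ?Y) - (?Y * ?X - ?X * ?Y) * V)"
    by (rule lead_comm[OF m _ V B]) simp
  have 2: "lead (m + 2) (comm G (x i) (comm G gk (x i) \<otimes> comm G (x k) gi)) (?X * C - C * ?X)"
    using lead_comm[OF _ _ lead_gen[OF i] C] by simp
  \<comment> \<open>The product lies in \<Gamma>_{m+3}, so its leading term of degree m + 2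
    vanishes; it is read at the word k M i.\<close>
  have "coef (V * (?Y * ?X - ?X * ?Y) - (?Y * ?X - ?X * ?Y) * V + (?X * C - C * ?X)) (k # M @ [i]) = 0"
    by (rule lead_unique_zero[OF _ _ lead_mult[OF _ 1 2]]) (use rel M in \<open>auto simp: numeral_3_eq_3 numeral_2_eq_2\<close>)
  then have z: "coef (V * ?Y * ?X) (k # M @ [i]) - coef (V * ?X * ?Y) (k # M @ [i])
      - coef (?Y * (?X * V)) (k # M @ [i]) + coef (?X * (?Y * V)) (k # M @ [i])
      + coef (?X * C) (k # M @ [i]) - coef (C * ?X) (k # M @ [i]) = 0"
    by (simp add: algebra_simps)
  have M0: "M \<noteq> []" using M m by auto
  obtain M' c where c: "M = M' @ [c]" using M0 by (cases M rule: rev_cases) auto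
  obtain d M'' where d: "M = d # M''" using M0 by (cases M) auto
  have d1: "distinct ((k # M) @ [i])" "distinct (k # M)" "distinct (k # M @ [i])" "k \<noteq> i" "c \<noteq> k" "c \<noteq> i"
    using M(1) c by auto
  have "d \<noteq> i" using M(1) d by auto
  have last: "coef (f * ?X) (k # M @ [i]) = coef f (k # M)" "coef (f * ?Y) (k # M @ [i]) = 0" for f
    using coef_times_mvar_snoc[OF d1(1)] d1(4) by auto
  have last': "coef (f * ?X) (k # M) = 0" "coef (f * ?Y) (k # M) = 0" for f
    using coef_times_mvar_snoc[of "k # M'" c f] d1 c by auto
  have first: "coef (?Y * f) (k # M @ [i]) = coef f (M @ [i])" "coef (?X * f) (k # M @ [i]) = 0" for f
    using coef_mvar_times_Cons[OF d1(3)] d1(4) by auto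
  have first': "coef (?Y * f) (k # M) = coef f M" "coef (?X * f) (k # M) = 0" for f
    using coef_mvar_times_Cons[OF d1(2)] d1(4) by auto
  have "coef (?X * V) (M @ [i]) = 0"
    using coef_mvar_times_Cons[of d "M'' @ [i]" i V] d d1 \<open>d \<noteq> i\<close> by auto
  \<comment> \<open>The word k M i starts with k and ends with i, while M neither starts with i nor
    ends with k, so in \<open>z\<close> only \<open>coef (C * ?X)\<close> survives. Among the terms
    of C, in turn, only X_k V contributes to k M.\<close>
  then have "coef C (k # M) = 0" using z last first last' by simp
  then have "coef V M = 0" unfolding C_def using last' first' by simp
  then show ?thesis using M0 by (simp add: V_def coef_one)
qed

lemma good_lift:
  assumes m: "1 \<le> m" and i: "i < n" and g: "\<And>k. k < n \<Longrightarrow> g k \<in> lcs G m"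
    and rel: "\<And>k. k < n \<Longrightarrow> comm G (g i) (comm G (x k) (x i)) \<otimes>
        comm G (x i) (comm G (g k) (x i) \<otimes> comm G (x k) (g i)) \<in> lcs G (m + 3)"
  shows "\<exists>y\<in>lcs G m. gcl G m y = gcl G m (g i) \<and>
    (\<forall>h\<in>carrier G. comm G (y \<otimes> x i) (h \<otimes> (y \<otimes> x i) \<otimes> inv h) = \<one>)"
proof (cases "n \<le> m + 1")
  case True
  define a where "a = g i"
  have a: "a \<in> lcs G m" "a \<in> carrier G" using g[OF i] by (auto simp: a_def)
  have xi: "x i \<in> carrier G" using i by simp
  \<comment> \<open>Here \<Gamma>_{m+2} is contained in \<Gamma>_{n+1} = 1, so elements whose
    weights add up to m + 2 commute.\<close>
  have com: "u \<otimes> v = v \<otimes> u" if "comm G u v \<in> lcs G (m + 2)" "u \<in> carrier G" "v \<in>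
      carrier G" for u v
  proof -
    have "comm G u v \<in> lcs G (Suc n)" by (rule lcs_le[OF that(1)]) (use True in simp)
    then show ?thesis using lcs_nilpotent comm_eq_one_iff that by auto
  qed
  have "comm G (a \<otimes> x i) (h \<otimes> (a \<otimes> x i) \<otimes> inv h) =
      \<one>" if h: "h \<in> carrier G" for h
  proof -
    \<comment> \<open>It will turn out that [h, a x_i] = p q. The factor p has weight m + 1 and is
      central; q has weight 2, so it commutes with a, and it commutes with x_i because both lie in
      \<open>Ncl i\<close>. So p q (a x_i), the conjugate of a x_i by h, commutes with a
      x_i.\<close>
    define p q where "p = comm G h a" and "q = comm G h (x i)"
    have pq: "p \<in> lcs G (Suc m)" "q \<in> lcs G 2"
      unfolding p_def q_def using comm_lcs_Suc[OF m h a(1)] comm_lcs_Suc[of 1 h "x i"] h xi by (auto simp: numeral_2_eq_2)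
    have c: "p \<in> carrier G" "q \<in> carrier G" using pq by auto
    have pc: "u \<otimes> p = p \<otimes> u" if "u \<in> carrier G" for u
      by (rule com) (use comm_lcs_Suc[OF _ that pq(1)] that c in auto)
    have aq: "a \<otimes> q = q \<otimes> a"
      by (rule com) (use comm_lcs[OF m _ a(1) pq(2)] a c in auto)
    have "q \<in> Ncl i" unfolding q_def by (rule comm_normal(1)[OF Ncl_normal[OF i] h x_in_Ncl[OF i]])
    then have xq: "x i \<otimes> q = q \<otimes> x i"
      using Ncl_abelian[OF i x_in_Ncl[OF i]] comm_eq_one_iff[OF xi c(2)] by simp
    have aq': "a \<otimes> (q \<otimes> inv a) = q"
      using aq a c by (simp flip: m_assoc) (simp add: m_assoc)
    have "comm G h (a \<otimes> x i) = p \<otimes> (a \<otimes> (q \<otimes> inv a))"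
      unfolding p_def q_def using h a xi by (simp add: comm_def m_assoc inv_mult_group)
    then have hy: "comm G h (a \<otimes> x i) = p \<otimes> q" unfolding aq' .
    let ?y = "a \<otimes> x i"
    have y: "?y \<in> carrier G" using a xi by simp
    have yq: "?y \<otimes> q = q \<otimes> ?y"
    proof -
      have "?y \<otimes> q = a \<otimes> (x i \<otimes> q)" using a xi c by (simp add: m_assoc)
      also have "\<dots> = (a \<otimes> q) \<otimes> x i" unfolding xq using a xi c by (simp add: m_assoc)
      also have "\<dots> = q \<otimes> ?y" unfolding aq using a xi c by (simp add: m_assoc)
      finally show ?thesis .
    qed
    have "?y \<otimes> (p \<otimes> q \<otimes> ?y) = (?y \<otimes> p) \<otimes> q \<otimes> ?y"
      using y c a xi by (simp add: m_assoc)
    also have "\<dots> = p \<otimes> (?y \<otimes> q) \<otimes> ?y"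
      unfolding pc[OF y] using y c a xi by (simp add: m_assoc)
    also have "\<dots> = p \<otimes> q \<otimes> ?y \<otimes> ?y"
      unfolding yq using y c a xi by (simp add: m_assoc)
    finally have "?y \<otimes> (p \<otimes> q \<otimes> ?y) = p \<otimes> q \<otimes> ?y \<otimes> ?y" .
    then have "comm G ?y (p \<otimes> q \<otimes> ?y) = \<one>"
      using y c comm_eq_one_iff[of ?y "p \<otimes> q \<otimes> ?y"] by simp
    then show ?thesis using conj_eq_comm[OF h y] hy by simp
  qed
  then show ?thesis using a unfolding a_def by blast
next
  case False
  obtain p where p: "p \<in> hom G G" "\<And>g. g \<in> carrier G \<Longrightarrow> g \<otimes> inv (p g) \<in> Ncl i"
    "\<And>g. g \<in> carrier G \<Longrightarrow> mu (p g) = kill i (mu g)" using retraction[OF i] by blast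
  define h where "h = p (g i)"
  have gi: "g i \<in> lcs G m" "g i \<in> carrier G" using g[OF i] by auto
  have h: "h \<in> lcs G m" "h \<in> carrier G" using hom_lcs[OF p(1) gi(1)] by (auto simp: h_def)
  have hS: "h \<in> lcs G (Suc m)"
  proof (rule lcs_Suc_if_coef_zero[OF m h(1)])
    fix u s assume us: "(u, s) \<in> basic m"
    show "coef (mu h) (u @ [s]) = 0"
    proof (cases "i \<in> set (u @ [s])")
      case True
      then show ?thesis using p(3)[OF gi(2)] by (simp add: h_def coef_kill)
    next
      case ni: False
      have d: "distinct (u @ [s])" "length (u @ [s]) = m" using us by (auto simp: basic_def)
      \<comment> \<open>The word and i occupy at most m + 1 < n letters, which leaves the spare
        letter k for the test monomial.\<close>
      have "card (insert i (set (u @ [s]))) \<le> Suc m"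
        using card_insert_le_m1[of "Suc m" "set (u @ [s])" i] distinct_card[OF d(1)] d(2) by simp
      then have "\<not> {..<n} \<subseteq> insert i (set (u @ [s]))"
        using card_mono[of "insert i (set (u @ [s]))" "{..<n}"] False by auto
      then obtain k where k: "k < n" "k \<noteq> i" "k \<notin> set (u @ [s])" by blast
      have "coef (mu (g i)) (u @ [s]) = 0"
        by (rule coef_zero_if_relation[OF m i k(1) gi(1) g[OF k(1)] rel[OF k(1)]]) (use k ni d in auto)
      then show ?thesis using p(3)[OF gi(2)] ni by (simp add: h_def coef_kill)
    qed
  qed
  \<comment> \<open>Dividing by h keeps the class, as h lies in \<Gamma>_{m+1}, and brings the lift
    into \<open>Ncl i\<close> by the property of the retraction.\<close>
  define y where "y = g i \<otimes> inv h"
  have y: "y \<in> lcs G m" "y \<in> carrier G" unfolding y_def using gi h by auto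
  have "gcl G m y = gcl G m (g i \<otimes> \<one>)"
    unfolding y_def using gi h hS by (intro gcl_mult_cong) (auto simp: gcl_eq_iff)
  then have 1: "gcl G m y = gcl G m (g i)" using gi by simp
  interpret N: normal "Ncl i" G by (rule Ncl_normal[OF i])
  have "y \<in> Ncl i" using p(2)[OF gi(2)] by (simp add: y_def h_def)
  then have yx: "y \<otimes> x i \<in> Ncl i" using x_in_Ncl[OF i] by simp
  have "comm G (y \<otimes> x i) (k \<otimes> (y \<otimes> x i) \<otimes> inv k) = \<one>" if "k \<in> carrier G" for k
    by (rule Ncl_abelian[OF i yx N.inv_op_closed2[OF that yx]])
  then show ?thesis using y 1 by blast
qed

lemma johnson_surj:
  assumes j: "1 \<le> j" and D: "D \<in> der G j"
  shows "\<exists>s\<in>andr G j. johnson G j (acl G j s) = D"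
proof -
  have homD: "D i \<in> hom (grQ G i) (grQ G (i + j))" if "1 \<le> i" for i
    using D that by (auto simp: der_def)
  have "\<exists>g. g \<in> lcs G (1 + j) \<and> D 1 (gcl G 1 (x i)) = gcl G (1 + j) g" if "i < n" for i
  proof -
    have "D 1 (gcl G 1 (x i)) \<in> carrier (grQ G (1 + j))"
      using hom_in_carrier[OF homD[of 1] gcl_closed[of "x i" 1]] that by simp
    then show ?thesis by (auto simp: carrier_grQ)
  qed
  then obtain g where g: "\<And>i. i < n \<Longrightarrow> g i \<in> lcs G (1 + j)"
    "\<And>i. i < n \<Longrightarrow> D 1 (gcl G 1 (x i)) = gcl G (1 + j) (g i)" by metis
  \<comment> \<open>The Leibniz rule applied twice to [x_i, [x_k, x_i]], which is 1 because
    [x_k, x_i] lies in the abelian \<open>Ncl i\<close>. The derivation has a trivial value there,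
    so a representative in degree 3 + j lies one weight deeper, in \<Gamma>_{j+4}.\<close>
  have rel: "comm G (g i) (comm G (x k) (x i)) \<otimes>
        comm G (x i) (comm G (g k) (x i) \<otimes> comm G (x k) (g i)) \<in> lcs G (1 + j + 3)"
    if i: "i < n" and k: "k < n" for i k
  proof -
    let ?t = "comm G (x k) (x i)" and ?c = "comm G (g k) (x i) \<otimes> comm G (x k) (g i)"
    have x1: "x i \<in> lcs G 1" "x k \<in> lcs G 1" using i k by auto
    have t: "?t \<in> lcs G (1 + 1)" by (rule comm_lcs) (use x1 in auto)
    have c: "?c \<in> lcs G (1 + 1 + j)"
      using comm_lcs[OF _ _ g(1)[OF k] x1(1)] comm_lcs[OF _ _ x1(2) g(1)[OF i]] by simp
    have 2: "D (1 + 1) (gcl G (1 + 1) ?t) = gcl G (1 + 1 + j) ?c"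
      by (rule der_gcl_comm[OF D]) (use x1 g i k in auto)
    have 3: "D (1 + (1 + 1)) (gcl G (1 + (1 + 1)) (comm G (x i) ?t)) =
      gcl G (1 + (1 + 1) + j) (comm G (g i) ?t \<otimes> comm G (x i) ?c)"
      by (rule der_gcl_comm[OF D _ _ x1(1) g(1)[OF i] g(2)[OF i] t c 2]) auto
    have "?t \<in> Ncl i" using comm_normal(1)[OF Ncl_normal[OF i] x_closed[OF k] x_in_Ncl[OF i]] .
    then have "comm G (x i) ?t = \<one>" by (rule Ncl_abelian[OF i x_in_Ncl[OF i]])
    moreover have "D (1 + (1 + 1)) (gcl G (1 + (1 + 1)) \<one>) = gcl G (1 + (1 + 1) + j) \<one>"
      using hom_one[OF homD grQ_group grQ_group, of "1 + (1 + 1)"] by (simp add: grQ_one)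
    ultimately have "gcl G (1 + (1 + 1) + j) (comm G (g i) ?t \<otimes> comm G (x i) ?c) =
        gcl G (1 + (1 + 1) + j) \<one>"
      using 3 by simp
    then have "comm G (g i) ?t \<otimes> comm G (x i) ?c \<in> lcs G (Suc (1 + (1 + 1) + j))"
      using lcs_carrier[OF g(1)[OF i]] lcs_carrier[OF g(1)[OF k]] i k by (subst (asm) gcl_eq_one_iff) auto
    moreover have "Suc (1 + (1 + 1) + j) = 1 + j + 3" by simp
    ultimately show ?thesis by (simp only:)
  qed
  have "\<exists>y\<in>lcs G (1 + j). gcl G (1 + j) y = gcl G (1 + j) (g i) \<and>
    (\<forall>h\<in>carrier G. comm G (y \<otimes> x i) (h \<otimes> (y \<otimes> x i) \<otimes> inv h) = \<one>)" if "i < n" for i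
    by (rule good_lift[OF _ that g(1) rel[OF that]]) auto
  then obtain y where y: "\<And>i. i < n \<Longrightarrow> y i \<in> lcs G (1 + j)"
    "\<And>i. i < n \<Longrightarrow> gcl G (1 + j) (y i) = gcl G (1 + j) (g i)"
    "\<And>i h. i < n \<Longrightarrow> h \<in> carrier G \<Longrightarrow> comm G (y i \<otimes> x i) (h \<otimes>
        (y i \<otimes> x i) \<otimes> inv h) = \<one>"
    by metis
  have yc: "y i \<in> carrier G" if "i < n" for i using y(1)[OF that] by auto
  have "\<exists>h\<in>hom G G. \<forall>i<n. h (x i) = y i \<otimes> x i"
    by (rule extend) (use yc y(3) in auto)
  then obtain h where h: "h \<in> hom G G" "\<And>i. i < n \<Longrightarrow> h (x i) = y i \<otimes> x i"
    by blast
  have hx: "h (x i) \<otimes> inv (x i) = y i" if "i < n" for i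
    using h(2)[OF that] yc[OF that] that by (simp add: m_assoc)
  have disp: "h a \<otimes> inv a \<in> lcs G (i + j)" if "1 \<le> i" "a \<in> lcs G i" for i a
    by (rule hom_displacement_lcs[OF h(1) _ generated j _ that]) (use hx y(1) in auto)
  have bij: "bij_betw h (carrier G) (carrier G)"
    by (rule hom_bij_if_displacement[OF h(1) j disp lcs_nilpotent])
  \<comment> \<open>Elements of \<open>auto\<close> are extensional, whereas \<open>extend\<close>
    does not control h off the carrier.\<close>
  define s where "s = restrict h (carrier G)"
  have sh: "s a = h a" if "a \<in> carrier G" for a using that by (simp add: s_def)
  have "s \<in> hom G G" using h(1) by (auto simp: hom_def s_def)
  moreover have "bij_betw s (carrier G) (carrier G)" using bij sh by (simp cong: bij_betw_cong)
  ultimately have "s \<in> auto G" by (simp add: auto_def Bij_def s_def)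
  then have s: "s \<in> andr G j" using disp sh by (auto simp: andr_def lcs_carrier)
  have "johnson G j (acl G j s) = D"
  proof (rule der_eqI[OF johnson_der[OF s j] D j _ generated])
    fix a assume "a \<in> x ` {..<n}"
    then obtain i where i: "i < n" "a = x i" by auto
    then show "johnson G j (acl G j s) 1 (gcl G 1 a) = D 1 (gcl G 1 a)"
      using johnson_gcl[OF s j, of 1 "x i"] g(2) y(2) hx sh by simp
  qed auto
  then show ?thesis using s by blast
qed

theorem johnson_iso:
  assumes "1 \<le> j"
  shows "johnson G j \<in> iso (AQ G j) (der_grp G j)"
proof -
  have "der G j \<subseteq> johnson G j ` carrier (AQ G j)"
    using johnson_surj[OF assms] by (force simp: carrier_AQ)
  then have "bij_betw (johnson G j) (carrier (AQ G j)) (carrier (der_grp G j))"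
    using johnson_inj[OF assms] hom_in_carrier[OF johnson_hom[OF assms]]
    unfolding bij_betw_def by (auto simp: der_grp_def)
  then show ?thesis using johnson_hom[OF assms] by (simp add: iso_def)
qed

end

section \<open>The reduced free group\<close>

definition linv :: "letter \<Rightarrow> letter" where
  "linv a = (fst a, \<not> snd a)"

lemma linv_linv [simp]: "linv (linv a) = a" and fst_linv [simp]: "fst (linv a) = fst a"
  and snd_linv [simp]: "snd (linv a) \<longleftrightarrow> \<not> snd a"
  by (simp_all add: linv_def)

lemma red_cons_Cons: "red_cons a (b # bs) = (if b = linv a then bs else a # b # bs)"
  by (auto simp: linv_def prod_eq_iff)

fun is_red :: "letter list \<Rightarrow> bool" where
  "is_red (a # b # w) \<longleftrightarrow> b \<noteq> linv a \<and> is_red (b # w)"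
| "is_red _ \<longleftrightarrow> True"

lemma is_red_tl: "is_red (a # w) \<Longrightarrow> is_red w"
  by (cases w) auto

lemma is_red_red_cons: "is_red w \<Longrightarrow> is_red (red_cons a w)"
  by (cases w) (auto simp: red_cons_Cons simp del: red_cons.simps(2) dest: is_red_tl)

lemma is_red_reduce: "is_red (reduce w)"
  by (induction w) (auto intro: is_red_red_cons)

lemma reduce_id: "is_red w \<Longrightarrow> reduce w = w"
proof (induction w rule: is_red.induct)
  case (1 a b w)
  then show ?case using red_cons_Cons[of a b w] by simp
qed auto

lemma reduce_eq_iff: "reduce w = w \<longleftrightarrow> is_red w"
  by (metis is_red_reduce reduce_id)

lemma red_cons_cancel:
  assumes "is_red w"
  shows "red_cons a (red_cons (linv a) w) = w"
proof (cases w)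
  case Nil
  then show ?thesis by (simp add: linv_def)
next
  case (Cons b v)
  show ?thesis
  proof (cases "b = a")
    case True
    then show ?thesis using assms Cons by (cases v) (auto simp: red_cons_Cons simp del: red_cons.simps(2))
  next
    case False
    then show ?thesis using Cons by (simp add: red_cons_Cons del: red_cons.simps(2))
  qed
qed

lemma reduce_append: "reduce (u @ v) = foldr red_cons u (reduce v)"
  by (induction u) auto

lemma is_red_foldr: "is_red z \<Longrightarrow> is_red (foldr red_cons u z)"
  by (induction u) (auto intro: is_red_red_cons)

lemma foldr_red_cons:
  assumes "is_red z"
  shows "foldr red_cons (red_cons a u) z = red_cons a (foldr red_cons u z)"
proof (cases u)
  case (Cons b v)
  then show ?thesis
    using red_cons_cancel[OF is_red_foldr[OF assms], of a v] by (auto simp: red_cons_Cons simp del: red_cons.simps(2))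
qed simp

text \<open>Words act on reduced words by prefixing letters, a letter and its inverse acting
  inversely to each other. A word and its reduction therefore act alike; this is van der Waerden's
  route to associativity.\<close>

lemma foldr_reduce: "is_red z \<Longrightarrow> foldr red_cons (reduce u) z = foldr red_cons u z"
  by (induction u) (auto simp: foldr_red_cons)

lemma reduce_reduce_append:
  "reduce (reduce u @ v) = reduce (u @ v)" "reduce (u @ reduce v) = reduce (u @ v)"
  by (simp_all add: reduce_append foldr_reduce is_red_reduce reduce_id)

lemma set_reduce: "set (reduce w) \<subseteq> set w"
proof (induction w)
  case (Cons a w)
  have "set (red_cons a v) \<subseteq> insert a (set v)" for v by (cases v) auto
  then show ?case using Cons by fastforce
qed simp

lemma free_grp_simps:
  "w \<in> carrier (free_grp n) \<longleftrightarrow> is_red w \<and> (\<forall>x\<in>set w. fst x < n)"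
  "u \<otimes>\<^bsub>free_grp n\<^esub> v = reduce (u @ v)"
  "\<one>\<^bsub>free_grp n\<^esub> = []"
  by (simp_all add: free_grp_def reduce_eq_iff)

lemma reduce_inverse: "reduce (rev (map linv w) @ w) = []"
proof (induction w)
  case (Cons a w)
  have "reduce (rev (map linv (a # w)) @ a # w) =
      foldr red_cons (rev (map linv w)) (red_cons (linv a) (red_cons (linv (linv a)) (reduce w)))"
    by (simp add: reduce_append)
  also have "\<dots> = foldr red_cons (rev (map linv w)) (reduce w)"
    by (simp only: red_cons_cancel[OF is_red_reduce])
  finally show ?case using Cons by (simp add: reduce_append)
qed simp

lemma reduce_in_free_grp: "\<forall>x\<in>set w. fst x < n \<Longrightarrow> reduce w \<in> carrier (free_grp n)"
  using set_reduce by (auto simp: free_grp_simps is_red_reduce)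

lemma free_grp_group: "group (free_grp n)"
proof (rule groupI)
  fix u v w assume c: "u \<in> carrier (free_grp n)" "v \<in> carrier (free_grp n)"
  then show "u \<otimes>\<^bsub>free_grp n\<^esub> v \<in> carrier (free_grp n)"
    unfolding free_grp_simps(2) by (intro reduce_in_free_grp) (auto simp: free_grp_simps)
  show "u \<otimes>\<^bsub>free_grp n\<^esub> v \<otimes>\<^bsub>free_grp n\<^esub> w =
      u \<otimes>\<^bsub>free_grp n\<^esub> (v \<otimes>\<^bsub>free_grp n\<^esub> w)"
    by (simp add: free_grp_simps reduce_reduce_append)
next
  show "\<one>\<^bsub>free_grp n\<^esub> \<in> carrier (free_grp n)" by (simp add: free_grp_simps)
next
  fix u assume u: "u \<in> carrier (free_grp n)"
  then show "\<one>\<^bsub>free_grp n\<^esub> \<otimes>\<^bsub>free_grp n\<^esub> u = u"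
    by (simp add: free_grp_simps reduce_id)
  have "reduce (rev (map linv u)) \<in> carrier (free_grp n)"
    by (rule reduce_in_free_grp) (use u in \<open>auto simp: free_grp_simps\<close>)
  moreover have "reduce (rev (map linv u)) \<otimes>\<^bsub>free_grp n\<^esub> u = \<one>\<^bsub>free_grp n\<^esub>"
    by (simp add: free_grp_simps reduce_reduce_append reduce_inverse)
  ultimately show "\<exists>v\<in>carrier (free_grp n). v \<otimes>\<^bsub>free_grp n\<^esub> u = \<one>\<^bsub>free_grp n\<^esub>"
    by blast
qed

lemma gen_closed: "i < n \<Longrightarrow> gen i \<in> carrier (free_grp n)"
  by (simp add: free_grp_simps gen_def)

lemma generate_free_grp: "generate (free_grp n) (gen ` {..<n}) = carrier (free_grp n)"
proof
  interpret F: group "free_grp n" by (rule free_grp_group)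
  show "generate (free_grp n) (gen ` {..<n}) \<subseteq> carrier (free_grp n)"
    by (rule F.generate_incl) (auto simp: gen_closed)
  have "w \<in> generate (free_grp n) (gen ` {..<n})" if "is_red w" "\<forall>x\<in>set w. fst x < n" for w
    using that
  proof (induction w)
    case Nil
    then show ?case using generate.one[of "free_grp n"] by (simp add: free_grp_simps)
  next
    case (Cons a w)
    have "[a] \<in> generate (free_grp n) (gen ` {..<n})"
    proof (cases "snd a")
      case True
      then have "[a] = gen (fst a)" by (simp add: gen_def prod_eq_iff)
      then show ?thesis using Cons.prems by (auto intro!: generate.incl)
    next
      case False
      have "[a] \<otimes>\<^bsub>free_grp n\<^esub> gen (fst a) = \<one>\<^bsub>free_grp n\<^esub>"
        using False by (simp add: gen_def free_grp_simps)
      then have "inv\<^bsub>free_grp n\<^esub> gen (fst a) = [a]"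
        by (rule F.inv_equality) (use Cons.prems gen_closed[of "fst a" n] in \<open>simp_all add: free_grp_simps(1)\<close>)
      then show ?thesis using generate.inv[of "gen (fst a)" "gen ` {..<n}" "free_grp n"] Cons.prems by auto
    qed
    moreover have "w \<in> generate (free_grp n) (gen ` {..<n})" using Cons is_red_tl by auto
    ultimately have "[a] \<otimes>\<^bsub>free_grp n\<^esub> w \<in> generate (free_grp n) (gen ` {..<n})"
      by (rule generate.eng)
    then show ?case using reduce_id[OF Cons.prems(1)] unfolding free_grp_simps(2) by simp
  qed
  then show "carrier (free_grp n) \<subseteq> generate (free_grp n) (gen ` {..<n})"
    by (auto simp: free_grp_simps)
qed

text \<open>Evaluating words letter by letter is multiplicative for concatenation, and it survives
  reduction because \<open>red_cons\<close> only cancels two factors with product one.\<close>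

lemma free_grp_universal:
  assumes H: "group H" and y: "\<And>i. i < n \<Longrightarrow> y i \<in> carrier H"
  shows "\<exists>h\<in>hom (free_grp n) H. \<forall>i<n. h (gen i) = y i"
proof -
  interpret H: group H by (rule H)
  define val where "val a = (if snd a then y (fst a) else inv\<^bsub>H\<^esub> y (fst a))" for a :: letter
  define ev where "ev w = foldr (\<lambda>a r. val a \<otimes>\<^bsub>H\<^esub> r) w \<one>\<^bsub>H\<^esub>" for w
  have ev_simps: "ev [] = \<one>\<^bsub>H\<^esub>" "ev (a # w) =
      val a \<otimes>\<^bsub>H\<^esub> ev w" for a w by (simp_all add: ev_def)
  have val: "val a \<in> carrier H" if "fst a < n" for a using y that by (simp add: val_def)
  have val_linv: "val a \<otimes>\<^bsub>H\<^esub> val (linv a) =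
      \<one>\<^bsub>H\<^esub>" if "fst a < n" for a using y that by (simp add: val_def)
  have evc: "ev w \<in> carrier H" if "\<forall>a\<in>set w. fst a < n" for w
    using that by (induction w) (auto simp: ev_simps val)
  have ev_app: "ev (u @ v) = ev u \<otimes>\<^bsub>H\<^esub> ev v" if "\<forall>a\<in>set u. fst a < n" "\<forall>a\<in>set v. fst a < n" for u v
    using that by (induction u) (auto simp: ev_simps val evc H.m_assoc)
  have ev_red_cons: "ev (red_cons a w) =
      val a \<otimes>\<^bsub>H\<^esub> ev w" if "fst a < n" "\<forall>a\<in>set w. fst a < n" for a w
  proof (cases w)
    case (Cons b v)
    show ?thesis
    proof (cases "b = linv a")
      case True
      have "val a \<otimes>\<^bsub>H\<^esub> (val (linv a) \<otimes>\<^bsub>H\<^esub> ev v) = ev v"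
        using val_linv[OF that(1)] val[OF that(1)] val[of "linv a"] evc[of v] that Cons by (simp flip: H.m_assoc)
      then show ?thesis using True Cons by (simp add: red_cons_Cons ev_simps del: red_cons.simps(2))
    next
      case False
      then show ?thesis using Cons by (simp add: red_cons_Cons ev_simps del: red_cons.simps(2))
    qed
  qed (simp add: ev_simps)
  have ev_reduce: "ev (reduce w) = ev w" if "\<forall>a\<in>set w. fst a < n" for w
    using that
  proof (induction w)
    case (Cons a w)
    then have "\<forall>a\<in>set (reduce w). fst a < n" using set_reduce[of w] by auto
    then show ?case using Cons by (simp add: ev_red_cons ev_simps)
  qed simp
  have "ev \<in> hom (free_grp n) H"
  proof (rule homI)
    fix u assume "u \<in> carrier (free_grp n)"
    then show "ev u \<in> carrier H" using evc by (simp add: free_grp_simps)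
  next
    fix u v assume "u \<in> carrier (free_grp n)" "v \<in> carrier (free_grp n)"
    then have l: "\<forall>a\<in>set u. fst a < n" "\<forall>a\<in>set v. fst a < n"
      by (auto simp: free_grp_simps)
    then have "\<forall>a\<in>set (u @ v). fst a < n" by auto
    then show "ev (u \<otimes>\<^bsub>free_grp n\<^esub> v) = ev u \<otimes>\<^bsub>H\<^esub> ev v"
      using ev_reduce ev_app[OF l] by (simp add: free_grp_simps)
  qed
  moreover have "ev (gen i) = y i" if "i < n" for i
    using y[OF that] by (simp add: gen_def ev_simps val_def)
  ultimately show ?thesis by blast
qed

section \<open>The presentation and its universal property\<close>

definition rf_gen :: "nat \<Rightarrow> nat \<Rightarrow> letter list set" where
  "rf_gen n i = r_coset (free_grp n) (normal_closure (free_grp n) (rf_rel n)) (gen i)"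

lemma rf_rel_closed: "rf_rel n \<subseteq> carrier (free_grp n)"
proof -
  interpret F: group "free_grp n" by (rule free_grp_group)
  show ?thesis by (auto simp: rf_rel_def gen_closed)
qed

lemma rf_normal: "normal_closure (free_grp n) (rf_rel n) \<lhd> free_grp n"
  by (rule group.normal_closure_normal[OF free_grp_group rf_rel_closed])

lemma RF_group: "group (RF n)"
  unfolding RF_def by (rule normal.factorgroup_is_group[OF rf_normal])

lemma RF_proj: "(\<lambda>w. r_coset (free_grp n) (normal_closure (free_grp n) (rf_rel n)) w) \<in>
    hom (free_grp n) (RF n)"
  unfolding RF_def by (rule normal.r_coset_hom_Mod[OF rf_normal])

text \<open>The relations are asked for every g in H and not only for values of words. Both targets
  used later satisfy this form: the units of the Magnus ring, and \<open>RF n\<close> itself with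
  the corrected generators.\<close>

lemma RF_universal:
  assumes H: "group H" and y: "\<And>i. i < n \<Longrightarrow> y i \<in> carrier H"
    and rel: "\<And>i g. i < n \<Longrightarrow> g \<in>
        carrier H \<Longrightarrow> comm H (y i) (g \<otimes>\<^bsub>H\<^esub> y i \<otimes>\<^bsub>H\<^esub> inv\<^bsub>H\<^esub> g) = \<one>\<^bsub>H\<^esub>"
  shows "\<exists>h\<in>hom (RF n) H. \<forall>i<n. h (rf_gen n i) = y i"
proof -
  interpret F: group "free_grp n" by (rule free_grp_group)
  interpret H: group H by (rule H)
  let ?K = "normal_closure (free_grp n) (rf_rel n)"
  obtain f where f: "f \<in> hom (free_grp n) H" "\<And>i. i < n \<Longrightarrow> f (gen i) = y i"
    using free_grp_universal[of H n y, OF H y] by blast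
  interpret f: group_hom "free_grp n" H f by unfold_locales (rule f)
  have "rf_rel n \<subseteq> kernel (free_grp n) H f"
  proof
    fix r assume "r \<in> rf_rel n"
    then obtain i w where iw: "i < n" "w \<in> carrier (free_grp n)"
      and r: "r = comm (free_grp n) (gen i) (inv\<^bsub>free_grp n\<^esub> w \<otimes>\<^bsub>free_grp n\<^esub> gen i \<otimes>\<^bsub>free_grp n\<^esub> w)"
      by (auto simp: rf_rel_def)
    have gi: "gen i \<in> carrier (free_grp n)" using iw gen_closed by simp
    have "f r = comm H (y i) (inv\<^bsub>H\<^esub> f w \<otimes>\<^bsub>H\<^esub> y i \<otimes>\<^bsub>H\<^esub> inv\<^bsub>H\<^esub> (inv\<^bsub>H\<^esub> f w))"
      unfolding r using F.hom_comm[OF H f(1) gi] iw gi f(2) by simp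
    also have "\<dots> = \<one>\<^bsub>H\<^esub>" by (rule rel) (use iw in auto)
    finally show "r \<in> kernel (free_grp n) H f"
      using rf_rel_closed \<open>r \<in> rf_rel n\<close> by (auto simp: kernel_def)
  qed
  then have K: "?K \<subseteq> kernel (free_grp n) H f"
    by (rule F.normal_closure_subset[OF f.normal_kernel])
  have eq: "f u = f v" if "u \<in> carrier (free_grp n)" "v \<in> carrier (free_grp n)"
      "r_coset (free_grp n) ?K u = r_coset (free_grp n) ?K v" for u v
  proof -
    have "u \<otimes>\<^bsub>free_grp n\<^esub> inv\<^bsub>free_grp n\<^esub> v \<in> ?K"
      using F.rcos_eq_iff[OF rf_normal that(1,2)] that(3) by simp
    then have "f u \<otimes>\<^bsub>H\<^esub> inv\<^bsub>H\<^esub> f v = \<one>\<^bsub>H\<^esub>"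
      using K that by (auto simp: kernel_def)
    then show ?thesis using that by (metis H.inv_equality H.inv_inv H.inv_closed f.hom_closed)
  qed
  obtain h where h: "h \<in> hom (RF n) H" "\<And>w. w \<in>
      carrier (free_grp n) \<Longrightarrow> h (r_coset (free_grp n) ?K w) = f w"
    using FactGroup_universal[OF f(1) rf_normal eq] unfolding RF_def by blast
  then have "\<forall>i<n. h (rf_gen n i) = y i" using f(2) gen_closed by (simp add: rf_gen_def)
  then show ?thesis using h(1) by blast
qed

lemma rf_gen_closed: "i < n \<Longrightarrow> rf_gen n i \<in> carrier (RF n)"
  unfolding rf_gen_def using hom_in_carrier[OF RF_proj gen_closed] .

lemma RF_generated: "generate (RF n) (rf_gen n ` {..<n}) = carrier (RF n)"
proof -
  let ?p = "\<lambda>w. r_coset (free_grp n) (normal_closure (free_grp n) (rf_rel n)) w"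
  interpret p: group_hom "free_grp n" "RF n" ?p
    using free_grp_group RF_group RF_proj by (simp add: group_hom_def group_hom_axioms_def)
  have "generate (RF n) (?p ` gen ` {..<n}) = ?p ` generate (free_grp n) (gen ` {..<n})"
    by (rule p.generate_img) (auto simp: gen_closed)
  also have "\<dots> = carrier (RF n)" by (simp add: generate_free_grp RF_def carrier_FactGroup)
  finally show ?thesis by (simp add: rf_gen_def image_image)
qed

lemma RF_reduced:
  assumes i: "i < n" and g: "g \<in> carrier (RF n)"
  shows "comm (RF n) (rf_gen n i) (g \<otimes>\<^bsub>RF n\<^esub> rf_gen n i \<otimes>\<^bsub>RF n\<^esub> inv\<^bsub>RF n\<^esub> g) = \<one>\<^bsub>RF n\<^esub>"
proof -
  let ?K = "normal_closure (free_grp n) (rf_rel n)"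
  let ?p = "\<lambda>w. r_coset (free_grp n) ?K w"
  interpret F: group "free_grp n" by (rule free_grp_group)
  interpret R: group "RF n" by (rule RF_group)
  interpret p: group_hom "free_grp n" "RF n" ?p by unfold_locales (rule RF_proj)
  obtain w where w: "w \<in> carrier (free_grp n)" "g = ?p w"
    using g by (auto simp: RF_def carrier_FactGroup)
  have gi: "gen i \<in> carrier (free_grp n)" using i gen_closed by simp
  \<comment> \<open>Relators contain w^-1 x_i w, so conjugation by w itself belongs to the relator
    of w^-1.\<close>
  let ?v = "inv\<^bsub>free_grp n\<^esub> w"
  let ?r = "comm (free_grp n) (gen i) (inv\<^bsub>free_grp n\<^esub> ?v \<otimes>\<^bsub>free_grp n\<^esub> gen i \<otimes>\<^bsub>free_grp n\<^esub> ?v)"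
  have "?r \<in> rf_rel n" unfolding rf_rel_def using i w F.inv_closed[OF w(1)] by blast
  then have "?r \<in> ?K" using F.normal_closure_incl[OF rf_rel_closed] by blast
  then have "?p ?r = \<one>\<^bsub>RF n\<^esub>"
    using F.rcos_eq_self_iff[OF rf_normal, of ?r] gi w by (simp add: RF_def one_FactGroup)
  moreover have "?p ?r = comm (RF n) (rf_gen n i) (g \<otimes>\<^bsub>RF n\<^esub> rf_gen n i \<otimes>\<^bsub>RF n\<^esub> inv\<^bsub>RF n\<^esub> g)"
    unfolding w(2) rf_gen_def using F.hom_comm[OF RF_group RF_proj gi] gi w(1) by simp
  ultimately show ?thesis by simp
qed

definition magnus_monoid :: "magnus monoid" where
  "magnus_monoid = \<lparr>carrier = UNIV, monoid.mult = (*), one = 1\<rparr>"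

text \<open>1 + X_i has inverse 1 - X_i because X_i X_i = 0. The conjugate u (1 + X_i) u^-1 = 1 + u
  X_i u^-1 commutes with 1 + X_i because both products of X_i and u X_i u^-1 contain X_i twice. So
  the units 1 + X_i satisfy the relations.\<close>

lemma magnus_representation:
  "\<exists>mu. (\<forall>g\<in>carrier (RF n). \<forall>h\<in>carrier (RF n). mu (g \<otimes>\<^bsub>RF n\<^esub> h) = mu g * mu h) \<and>
    mu \<one>\<^bsub>RF n\<^esub> = 1 \<and> (\<forall>i<n. mu (rf_gen n i) = 1 + mvar i)"
proof -
  interpret M: monoid magnus_monoid
    by unfold_locales (simp_all add: magnus_monoid_def mult.assoc)
  let ?U = "units_of magnus_monoid"
  interpret U: group ?U by (rule M.units_group)
  have Us: "u \<otimes>\<^bsub>?U\<^esub> v = u * v" "\<one>\<^bsub>?U\<^esub> = 1" for u v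
    by (simp_all add: units_of_def magnus_monoid_def)
  have y: "1 + mvar i \<in> carrier ?U" for i
    unfolding units_of_carrier Units_def using mvar_square[of i]
    by (auto simp: magnus_monoid_def algebra_simps intro!: exI[of _ "1 - mvar i"])
  have rel: "comm ?U (1 + mvar i) (u \<otimes>\<^bsub>?U\<^esub> (1 + mvar i) \<otimes>\<^bsub>?U\<^esub> inv\<^bsub>?U\<^esub> u) = \<one>\<^bsub>?U\<^esub>" if u: "u \<in> carrier ?U" for i u
  proof -
    have inv: "u * inv\<^bsub>?U\<^esub> u = 1" using U.r_inv[OF u] by (simp add: Us)
    have sw: "mvar i * (u * (mvar i * v)) = 0" "u * (mvar i * (v * mvar i)) = 0" for v u
      using mvar_sandwich[of i u] mvar_sandwich[of i v] by (simp_all add: mult.assoc[symmetric])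
    have c: "u * (1 + mvar i) * inv\<^bsub>?U\<^esub> u = 1 + u * mvar i * inv\<^bsub>?U\<^esub> u"
      using inv by (simp add: algebra_simps)
    have "(1 + mvar i) * (1 + u * mvar i * inv\<^bsub>?U\<^esub> u) =
        (1 + u * mvar i * inv\<^bsub>?U\<^esub> u) * (1 + mvar i)"
      by (simp add: algebra_simps sw)
    then have "(1 + mvar i) \<otimes>\<^bsub>?U\<^esub> (u \<otimes>\<^bsub>?U\<^esub> (1 + mvar i) \<otimes>\<^bsub>?U\<^esub> inv\<^bsub>?U\<^esub> u) =
        (u \<otimes>\<^bsub>?U\<^esub> (1 + mvar i) \<otimes>\<^bsub>?U\<^esub> inv\<^bsub>?U\<^esub> u) \<otimes>\<^bsub>?U\<^esub> (1 + mvar i)"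
      unfolding Us c .
    then show ?thesis using y u by (subst U.comm_eq_one_iff) auto
  qed
  obtain mu where mu: "mu \<in> hom (RF n) ?U" "\<And>i. i < n \<Longrightarrow> mu (rf_gen n i) = 1 + mvar i"
    using RF_universal[of ?U n "\<lambda>i. 1 + mvar i", OF U.is_group y rel] by blast
  have "mu (g \<otimes>\<^bsub>RF n\<^esub> h) =
      mu g * mu h" if "g \<in> carrier (RF n)" "h \<in> carrier (RF n)" for g h
    using hom_mult[OF mu(1) that] by (simp add: Us)
  moreover have "mu \<one>\<^bsub>RF n\<^esub> = 1"
    using hom_one[OF mu(1) RF_group U.is_group] by (simp add: Us)
  ultimately show ?thesis using mu(2) by blast
qed

theorem theorem3p4:
  fixes n :: nat
  assumes "n \<ge> 2"
  shows "(\<forall>j\<ge>1. johnson (RF n) j \<in> iso (AQ (RF n) j) (der_grp (RF n) j)) \<and>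
         (\<forall>j\<ge>1. \<forall>k\<ge>1. \<forall>c\<in>carrier (AQ (RF n) j). \<forall>d\<in>carrier (AQ (RF n) k).
            johnson (RF n) (j + k) (aut_br (RF n) j k c d) =
            der_br (RF n) j k (johnson (RF n) j c) (johnson (RF n) k d))"
proof -
  interpret R: group "RF n" by (rule RF_group)
  obtain mu where "\<forall>g\<in>carrier (RF n). \<forall>h\<in>carrier (RF n). mu (g \<otimes>\<^bsub>RF n\<^esub> h) = mu g * mu h"
    "mu \<one>\<^bsub>RF n\<^esub> = 1" "\<forall>i<n. mu (rf_gen n i) = 1 + mvar i"
    using magnus_representation by blast
  \<comment> \<open>\<open>extend\<close> is the universal property of \<open>RF n\<close> with
    \<open>RF n\<close> as target.\<close>
  then interpret R: reduced_magnus "RF n" n "rf_gen n" mu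
    by unfold_locales (auto simp: rf_gen_closed RF_generated RF_reduced intro!: RF_universal RF_group)
  show ?thesis using R.johnson_iso R.johnson_comm by blast
qed

end
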